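(* The class $$\mathcal{SM}_0^2=\Big\{m:\ m(t)=\int_0^tv(s)\,ds+\int_0^t\Sigma(s)\,dW(s),\ t\in I,\ \text{ for some } v\in L_2^a(I,\mathbb R^n)\text{ and }\Sigma\in L_2^a(I,\mathcal L(\mathbb R^m,\mathbb R^n))\Big\}$$ is a real linear vector space, and it is a Hilbert space with respect to the norm given by $$\|m\|_{\mathcal{SM}_0^2}^2=\mathcal E\int_I|v(t)|_{\mathbb R^n}^2\,dt+\mathcal E\int_I\mathrm{tr}(\Sigma^*(t)\Sigma(t))\,dt .$$ Further, $\mathcal{SM}_0^2$ is isometrically isomorphic to $L_2^a(I,\mathbb R^n)\times L_2^a(I,\mathcal L(\mathbb R^m,\mathbb R^n))$.
   Context: $(\Omega,\mathcal F,\{\mathcal F_t\}_{t\ge0},P)$ is a complete filtered probability space with $\{\mathcal F_t\}$ increasing; $\mathcal E$ denotes expectation; $W$ is an $\mathbb R^m$-valued standard Brownian motion on this filtered space with $W(0)=0$ a.s.; $I=[0,T]$ is a finite interval. $L_2^a(I,\mathbb R^n)\subset L_2(I\times\Omega,\mathbb R^n)$ is the space of $\mathcal F_t$-adapted processes $v$ with $\mathcal E\int_I|v(t)|^2dt<\infty$. $L_2^a(I,\mathcal L(\mathbb R^m,\mathbb R^n))\subset L_2(I\times\Omega,\mathcal L(\mathbb R^m,\mathbb R^n))$ is the space of $\mathcal F_t$-adapted $n\times m$-matrix-valued processes $\Sigma$ with $\mathcal E\int_I\mathrm{tr}(\Sigma^*(t)\Sigma(t))dt<\infty$. Both carry their natural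 $L_2$ norms, with elements identified up to $dt\times dP$-null sets. Here $\Sigma^*$ is the transpose. The elements of $\mathcal{SM}_0^2$ are continuous square integrable $\mathcal F_t$-semimartingales starting from $0$; the pair $(v,\Sigma)$ representing $m$ is called its intensity. *)

theory Defs
  imports "HOL-Probability.Probability" "HOL-Algebra.Module"
begin

section \<open>The filtered probability space and the Brownian motion\<close>

text \<open>
  Time is \<^typ>\<open>real\<close>; only indices \<open>t \<ge> 0\<close> of \<open>F\<close> and \<open>W\<close> are constrained.
  Completeness of the filtered space means that \<open>P\<close> is complete and that \<open>F 0\<close> (hence every
  \<open>F t\<close>) contains all null sets. Right-continuity is not assumed.
\<close>

locale filtered_prob_space = prob_space P + complete_measure P for P :: "'w measure" +
  fixes F :: "real \<Rightarrow> 'w measure"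
  assumes subalgebra_F: "\<And>t. 0 \<le> t \<Longrightarrow> subalgebra P (F t)"
    and F_mono: "\<And>s t. 0 \<le> s \<Longrightarrow> s \<le> t \<Longrightarrow> sets (F s) \<subseteq> sets (F t)"
    and null_F: "null_sets P \<subseteq> sets (F 0)"

locale brownian_motion = filtered_prob_space P F
  for P :: "'w measure" and F :: "real \<Rightarrow> 'w measure" +
  fixes W :: "real \<Rightarrow> 'w \<Rightarrow> real ^ 'm"
  assumes W_adapted: "\<And>t. 0 \<le> t \<Longrightarrow> W t \<in> borel_measurable (F t)"
    and W_0: "AE \<omega> in P. W 0 \<omega> = 0"
    and W_continuous: "AE \<omega> in P. continuous_on {0..} (\<lambda>t. W t \<omega>)"
    and W_indep: "\<And>s t. 0 \<le> s \<Longrightarrow> s < t \<Longrightarrow>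
      indep_set (sets (F s)) {(\<lambda>\<omega>. W t \<omega> - W s \<omega>) -` A \<inter> space P | A. A \<in> sets borel}"
    and W_gaussian: "\<And>s t. 0 \<le> s \<Longrightarrow> s < t \<Longrightarrow>
      distributed P lborel (\<lambda>\<omega>. W t \<omega> - W s \<omega>)
        (\<lambda>x. ennreal (\<Prod>i\<in>UNIV. normal_density 0 (sqrt (t - s)) (x $ i)))"

section \<open>Adapted square integrable processes\<close>

text \<open>\<open>expect_int P T f\<close> is \<open>E \<integral>\<^sub>I f(t) dt\<close> with \<open>I = [0,T]\<close>, for \<open>f \<ge> 0\<close>.\<close>

definition expect_int :: "'w measure \<Rightarrow> real \<Rightarrow> (real \<Rightarrow> 'w \<Rightarrow> real) \<Rightarrow> ennreal" where
  "expect_int P T f = (\<integral>\<^sup>+ \<omega>. (\<integral>\<^sup>+ t\<in>{0..T}. ennreal (f t \<omega>) \<partial>lborel) \<partial>P)"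

definition vec_sq :: "real ^ 'n \<Rightarrow> real" where
  "vec_sq x = (norm x)\<^sup>2"

definition mat_sq :: "real ^ 'm ^ 'n \<Rightarrow> real" where
  "mat_sq A = trace (transpose A ** A)"

text \<open>
  The definitions below are parametrised by the pointwise square \<open>q\<close>, which is \<^const>\<open>vec_sq\<close> for
  vector-valued and \<^const>\<open>mat_sq\<close> for matrix-valued processes.
\<close>

definition L2a :: "'w measure \<Rightarrow> (real \<Rightarrow> 'w measure) \<Rightarrow> real \<Rightarrow> ('b \<Rightarrow> real) \<Rightarrow>
    (real \<Rightarrow> 'w \<Rightarrow> 'b :: euclidean_space) set" where
  "L2a P F T q = {v.
     (\<lambda>(t, \<omega>). v t \<omega>) \<in> borel_measurable (restrict_space lborel {0..T} \<Otimes>\<^sub>M P) \<and>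
     (\<forall>t\<in>{0..T}. v t \<in> borel_measurable (F t)) \<and>
     expect_int P T (\<lambda>t \<omega>. q (v t \<omega>)) < \<infinity>}"

definition L2a_rel :: "'w measure \<Rightarrow> (real \<Rightarrow> 'w measure) \<Rightarrow> real \<Rightarrow> ('b \<Rightarrow> real) \<Rightarrow>
    (real \<Rightarrow> 'w \<Rightarrow> 'b :: euclidean_space) rel" where
  "L2a_rel P F T q = {(v, v'). v \<in> L2a P F T q \<and> v' \<in> L2a P F T q \<and>
     (AE (t, \<omega>) in restrict_space lborel {0..T} \<Otimes>\<^sub>M P. v t \<omega> = v' t \<omega>)}"

section \<open>The stochastic integral\<close>

text \<open>A record \<open>s\<close> encodes the simple process
  \<open>\<Sum>i<steps s. height s i 1_(time s i, time s (i+1)]\<close>.\<close>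

record ('w, 'b) simple_integrand =
  steps :: nat
  time :: "nat \<Rightarrow> real"
  height :: "nat \<Rightarrow> 'w \<Rightarrow> 'b"

definition simple_adapted :: "'w measure \<Rightarrow> (real \<Rightarrow> 'w measure) \<Rightarrow> real \<Rightarrow>
    ('w, 'b :: euclidean_space) simple_integrand \<Rightarrow> bool" where
  "simple_adapted P F T s \<longleftrightarrow>
     0 \<le> time s 0 \<and> time s (steps s) \<le> T \<and>
     (\<forall>i<steps s. time s i \<le> time s (Suc i)) \<and>
     (\<forall>i<steps s. height s i \<in> borel_measurable (F (time s i)) \<and>
        (\<exists>C. \<forall>\<omega>\<in>space P. norm (height s i \<omega>) \<le> C))"

definition simple_process ::
    "('w, 'b :: euclidean_space) simple_integrand \<Rightarrow> real \<Rightarrow> 'w \<Rightarrow> 'b" where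
  "simple_process s t \<omega> =
     (\<Sum>i<steps s. indicator {time s i<..time s (Suc i)} t *\<^sub>R height s i \<omega>)"

definition simple_integral :: "(real \<Rightarrow> 'w \<Rightarrow> real ^ 'm) \<Rightarrow>
    ('w, real ^ 'm ^ 'n) simple_integrand \<Rightarrow> real \<Rightarrow> 'w \<Rightarrow> real ^ 'n" where
  "simple_integral W s t \<omega> =
     (\<Sum>i<steps s. height s i \<omega> *v
        (W (min t (time s (Suc i))) \<omega> - W (min t (time s i)) \<omega>))"

text \<open>
  \<open>M\<close> is an (almost surely continuous, adapted) version of the Ito integral process
  \<open>t \<mapsto> \<integral>\<^sub>0\<^sup>t \<Sigma> dW\<close> on \<open>[0,T]\<close>: the mean square limit of the integrals of simple processes
  approximating \<open>\<Sigma>\<close> in \<open>L\<^sub>2([0,T] \<times> \<Omega>)\<close>.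
\<close>

definition has_ito_integral :: "'w measure \<Rightarrow> (real \<Rightarrow> 'w measure) \<Rightarrow>
    (real \<Rightarrow> 'w \<Rightarrow> real ^ 'm) \<Rightarrow> real \<Rightarrow> (real \<Rightarrow> 'w \<Rightarrow> real ^ 'm ^ 'n) \<Rightarrow>
    (real \<Rightarrow> 'w \<Rightarrow> real ^ 'n) \<Rightarrow> bool" where
  "has_ito_integral P F W T \<Sigma> M \<longleftrightarrow>
     (\<forall>t\<in>{0..T}. M t \<in> borel_measurable (F t)) \<and>
     (AE \<omega> in P. continuous_on {0..T} (\<lambda>t. M t \<omega>)) \<and>
     (\<exists>s. (\<forall>j. simple_adapted P F T (s j)) \<and>
        (\<lambda>j::nat. expect_int P T (\<lambda>t \<omega>. mat_sq (simple_process (s j) t \<omega> - \<Sigma> t \<omega>)))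
          \<longlonglongrightarrow> 0 \<and>
        (\<forall>t\<in>{0..T}.
          (\<lambda>j. \<integral>\<^sup>+ \<omega>. ennreal (vec_sq (simple_integral W (s j) t \<omega> - M t \<omega>)) \<partial>P)
            \<longlonglongrightarrow> 0))"

section \<open>Semimartingales with an intensity\<close>

text \<open>The equation \<open>m(t) = \<integral>\<^sub>0\<^sup>t v ds + \<integral>\<^sub>0\<^sup>t \<Sigma> dW\<close> is understood up to indistinguishability on
  \<open>[0,T]\<close>, and so are the elements of \<open>SM\<^sub>0\<^sup>2\<close>.\<close>

definition has_intensity :: "'w measure \<Rightarrow> (real \<Rightarrow> 'w measure) \<Rightarrow>
    (real \<Rightarrow> 'w \<Rightarrow> real ^ 'm) \<Rightarrow> real \<Rightarrow> (real \<Rightarrow> 'w \<Rightarrow> real ^ 'n) \<Rightarrow>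
    (real \<Rightarrow> 'w \<Rightarrow> real ^ 'n) \<Rightarrow> (real \<Rightarrow> 'w \<Rightarrow> real ^ 'm ^ 'n) \<Rightarrow> bool" where
  "has_intensity P F W T m v \<Sigma> \<longleftrightarrow>
     v \<in> L2a P F T vec_sq \<and> \<Sigma> \<in> L2a P F T mat_sq \<and>
     (\<exists>M. has_ito_integral P F W T \<Sigma> M \<and>
        (AE \<omega> in P. \<forall>t\<in>{0..T}. m t \<omega> = (LINT s:{0..t}|lborel. v s \<omega>) + M t \<omega>))"

definition SM :: "'w measure \<Rightarrow> (real \<Rightarrow> 'w measure) \<Rightarrow> (real \<Rightarrow> 'w \<Rightarrow> real ^ 'm) \<Rightarrow> real \<Rightarrow>
    (real \<Rightarrow> 'w \<Rightarrow> real ^ 'n) set" where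
  "SM P F W T = {m. \<exists>v \<Sigma>. has_intensity P F W T m v \<Sigma>}"

definition SM_rel :: "'w measure \<Rightarrow> (real \<Rightarrow> 'w measure) \<Rightarrow> (real \<Rightarrow> 'w \<Rightarrow> real ^ 'm) \<Rightarrow> real \<Rightarrow>
    (real \<Rightarrow> 'w \<Rightarrow> real ^ 'n) rel" where
  "SM_rel P F W T = {(m, m'). m \<in> SM P F W T \<and> m' \<in> SM P F W T \<and>
     (AE \<omega> in P. \<forall>t\<in>{0..T}. m t \<omega> = m' t \<omega>)}"

section \<open>Real vector spaces and Hilbert spaces on a carrier set\<close>

definition real_scalars :: "real ring" where
  "real_scalars = \<lparr>carrier = UNIV, monoid.mult = (*), one = 1, ring.zero = 0, add = (+)\<rparr>"

lemma field_real_scalars: "field real_scalars"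
proof -
  have inv: "\<exists>y. x + y = 0 \<and> y + x = 0" for x :: real
    by (rule exI[of _ "- x"]) simp
  have "cring real_scalars"
    by (rule cringI; (rule abelian_groupI comm_monoidI)?)
      (use inv in \<open>auto simp: real_scalars_def algebra_simps\<close>)
  moreover have "\<exists>b. a * b = 1" if "a \<noteq> 0" for a :: real
    using that by (intro exI[of _ "inverse a"]) simp
  ultimately show ?thesis
    by (intro cring.cring_fieldI2) (auto simp: real_scalars_def)
qed

text \<open>The ring multiplication and unit of the record \<open>V\<close> are irrelevant for a module.\<close>

definition real_vector_space :: "(real, 'v) module \<Rightarrow> bool" where
  "real_vector_space V \<longleftrightarrow> Module.module real_scalars V"

definition inner_product_on :: "(real, 'v) module \<Rightarrow> ('v \<Rightarrow> 'v \<Rightarrow> real) \<Rightarrow> bool" where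
  "inner_product_on V ip \<longleftrightarrow>
     (\<forall>x\<in>carrier V. \<forall>y\<in>carrier V. ip x y = ip y x) \<and>
     (\<forall>x\<in>carrier V. \<forall>y\<in>carrier V. \<forall>z\<in>carrier V. ip (x \<oplus>\<^bsub>V\<^esub> y) z = ip x z + ip y z) \<and>
     (\<forall>c. \<forall>x\<in>carrier V. \<forall>y\<in>carrier V. ip (c \<odot>\<^bsub>V\<^esub> x) y = c * ip x y) \<and>
     (\<forall>x\<in>carrier V. 0 \<le> ip x x) \<and>
     (\<forall>x\<in>carrier V. ip x x = 0 \<longrightarrow> x = \<zero>\<^bsub>V\<^esub>)"

text \<open>\<^locale>\<open>Metric_space\<close> wants symmetry and nonnegativity on the whole type, hence the guard.\<close>

definition norm_dist :: "(real, 'v) module \<Rightarrow> ('v \<Rightarrow> real) \<Rightarrow> 'v \<Rightarrow> 'v \<Rightarrow> real" where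
  "norm_dist V nrm x y =
     (if x \<in> carrier V \<and> y \<in> carrier V then nrm (x \<ominus>\<^bsub>V\<^esub> y) else 0)"

definition hilbert_space :: "(real, 'v) module \<Rightarrow> ('v \<Rightarrow> real) \<Rightarrow> bool" where
  "hilbert_space V nrm \<longleftrightarrow>
     real_vector_space V \<and>
     (\<exists>ip. inner_product_on V ip \<and> (\<forall>x\<in>carrier V. nrm x = sqrt (ip x x))) \<and>
     Metric_space (carrier V) (norm_dist V nrm) \<and>
     Metric_space.mcomplete (carrier V) (norm_dist V nrm)"

definition isometric_isomorphism :: "(real, 'v) module \<Rightarrow> ('v \<Rightarrow> real) \<Rightarrow>
    (real, 'u) module \<Rightarrow> ('u \<Rightarrow> real) \<Rightarrow> ('v \<Rightarrow> 'u) \<Rightarrow> bool" where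
  "isometric_isomorphism V nV U nU \<Phi> \<longleftrightarrow>
     bij_betw \<Phi> (carrier V) (carrier U) \<and>
     (\<forall>x\<in>carrier V. \<forall>y\<in>carrier V. \<Phi> (x \<oplus>\<^bsub>V\<^esub> y) = \<Phi> x \<oplus>\<^bsub>U\<^esub> \<Phi> y) \<and>
     (\<forall>c. \<forall>x\<in>carrier V. \<Phi> (c \<odot>\<^bsub>V\<^esub> x) = c \<odot>\<^bsub>U\<^esub> \<Phi> x) \<and>
     (\<forall>x\<in>carrier V. nU (\<Phi> x) = nV x)"

definition prod_space :: "(real, 'v) module \<Rightarrow> (real, 'u) module \<Rightarrow> (real, 'v \<times> 'u) module" where
  "prod_space V U = \<lparr>carrier = carrier V \<times> carrier U, monoid.mult = undefined, one = undefined,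
     ring.zero = (\<zero>\<^bsub>V\<^esub>, \<zero>\<^bsub>U\<^esub>),
     add = (\<lambda>(x, y) (x', y'). (x \<oplus>\<^bsub>V\<^esub> x', y \<oplus>\<^bsub>U\<^esub> y')),
     smult = (\<lambda>c (x, y). (c \<odot>\<^bsub>V\<^esub> x, c \<odot>\<^bsub>U\<^esub> y))\<rparr>"

definition prod_norm :: "('v \<Rightarrow> real) \<Rightarrow> ('u \<Rightarrow> real) \<Rightarrow> 'v \<times> 'u \<Rightarrow> real" where
  "prod_norm nV nU = (\<lambda>(x, y). sqrt ((nV x)\<^sup>2 + (nU y)\<^sup>2))"

text \<open>Equivalence classes of processes, with the pointwise operations on representatives.\<close>

definition process_space :: "(real \<Rightarrow> 'w \<Rightarrow> 'b :: real_vector) set \<Rightarrow>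
    (real \<Rightarrow> 'w \<Rightarrow> 'b) rel \<Rightarrow> (real, (real \<Rightarrow> 'w \<Rightarrow> 'b) set) module" where
  "process_space S R = \<lparr>carrier = S // R, monoid.mult = undefined, one = undefined,
     ring.zero = R `` {\<lambda>t \<omega>. 0},
     add = (\<lambda>X Y. \<Union>x\<in>X. \<Union>y\<in>Y. R `` {\<lambda>t \<omega>. x t \<omega> + y t \<omega>}),
     smult = (\<lambda>c X. \<Union>x\<in>X. R `` {\<lambda>t \<omega>. c *\<^sub>R x t \<omega>})\<rparr>"

section \<open>The Hilbert spaces\<close>

definition L2a_space :: "'w measure \<Rightarrow> (real \<Rightarrow> 'w measure) \<Rightarrow> real \<Rightarrow> ('b \<Rightarrow> real) \<Rightarrow>
    (real, (real \<Rightarrow> 'w \<Rightarrow> 'b :: euclidean_space) set) module" where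
  "L2a_space P F T q = process_space (L2a P F T q) (L2a_rel P F T q)"

definition L2a_norm :: "'w measure \<Rightarrow> real \<Rightarrow> ('b \<Rightarrow> real) \<Rightarrow>
    (real \<Rightarrow> 'w \<Rightarrow> 'b :: euclidean_space) set \<Rightarrow> real" where
  "L2a_norm P T q X =
     (THE r. \<exists>v\<in>X. r = sqrt (enn2real (expect_int P T (\<lambda>t \<omega>. q (v t \<omega>)))))"

definition SM_space :: "'w measure \<Rightarrow> (real \<Rightarrow> 'w measure) \<Rightarrow> (real \<Rightarrow> 'w \<Rightarrow> real ^ 'm) \<Rightarrow>
    real \<Rightarrow> (real, (real \<Rightarrow> 'w \<Rightarrow> real ^ 'n) set) module" where
  "SM_space P F W T = process_space (SM P F W T) (SM_rel P F W T)"

definition SM_norm :: "'w measure \<Rightarrow> (real \<Rightarrow> 'w measure) \<Rightarrow> (real \<Rightarrow> 'w \<Rightarrow> real ^ 'm) \<Rightarrow>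
    real \<Rightarrow> (real \<Rightarrow> 'w \<Rightarrow> real ^ 'n) set \<Rightarrow> real" where
  "SM_norm P F W T X =
     (THE r. \<exists>m\<in>X. \<exists>v \<Sigma>. has_intensity P F W T m v \<Sigma> \<and>
        r = sqrt (enn2real (expect_int P T (\<lambda>t \<omega>. vec_sq (v t \<omega>))) +
                  enn2real (expect_int P T (\<lambda>t \<omega>. mat_sq (\<Sigma> t \<omega>)))))"

end

theory Submission
  imports Defs
begin

text \<open>
  The map sending a pair \<open>(v, \<Sigma>)\<close> to \<open>\<integral> v ds + \<integral> \<Sigma> dW\<close> is defined on all of
  \<open>L\<^sub>2\<^sup>a \<times> L\<^sub>2\<^sup>a\<close>, linear and injective, and the norm of \<open>SM\<^sub>0\<^sup>2\<close> is the one it transports; so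
  everything reduces to these three points and to the completeness of \<open>L\<^sub>2\<^sup>a\<close>, which is that of
  \<open>L\<^sub>2\<close> together with the fact that pointwise limits preserve adaptedness. The stochastic integral exists
  since simple processes are dense, the integral of simple processes is an isometry, and by Kolmogorov's
  inequality and Borel--Cantelli a rapidly converging sequence of simple integrals converges uniformly
  in time. It is linear because a martingale is determined, up to indistinguishability, by the isometry:
  \<open>N - a M - b M'\<close> has terminal second moment \<open>0\<close>. Injectivity is the fact that a martingale which
  is a drift with square integrable density has vanishing quadratic variation, hence vanishes.
\<close>

section \<open>Real vector spaces and Hilbert spaces on a carrier set\<close>

text \<open>Neither the stochastic integral nor the norm is a function by definition:
  \<open>has_ito_integral\<close> quantifies over approximating sequences and admits any version,
  and \<open>SM_norm\<close> is a \<open>THE\<close> over all representatives and intensities. Hence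
  the pivotal role of \<open>has_intensity_cong\<close>: it makes both the norm and the passage from
  a class to its intensity well defined. The isometry is proved in polarised form, for the inner
  product of two integrals with unrelated approximating sequences, because one expansion of a square
  then yields uniqueness together with linearity. Martingales are described by orthogonality of
  their increments to the square integrable functions of the past, a condition that survives mean
  square limits. The obstacle in the density step is that an integrand is adapted at each time but
  jointly measurable only with respect to the full sigma-algebra of \<open>P\<close>: its time
  averages are not evidently adapted, so simple processes are formed from sampled values, with
  sampling points found by averaging over them.\<close>

lemma real_scalars_simps [simp]:
  "carrier real_scalars = UNIV" "a \<oplus>\<^bsub>real_scalars\<^esub> b = a + b"
  "a \<otimes>\<^bsub>real_scalars\<^esub> b = a * b" "\<one>\<^bsub>real_scalars\<^esub> = 1" "\<zero>\<^bsub>real_scalars\<^esub> = 0"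
  by (simp_all add: real_scalars_def)

lemma cring_real_scalars: "cring real_scalars"
  using field_real_scalars by (simp add: field_def domain_def)

lemma real_scalars_uminus [simp]: "\<ominus>\<^bsub>real_scalars\<^esub> a = - a"
proof -
  interpret cring real_scalars by (rule cring_real_scalars)
  show ?thesis by (rule minus_equality) simp_all
qed

lemma real_vector_spaceI:
  assumes "abelian_group V"
    and "\<And>a x. x \<in> carrier V \<Longrightarrow> a \<odot>\<^bsub>V\<^esub> x \<in> carrier V"
    and "\<And>a b x. x \<in> carrier V \<Longrightarrow> (a + b) \<odot>\<^bsub>V\<^esub> x = a \<odot>\<^bsub>V\<^esub> x \<oplus>\<^bsub>V\<^esub> b \<odot>\<^bsub>V\<^esub> x"
    and "\<And>a x y. x \<in> carrier V \<Longrightarrow> y \<in> carrier V \<Longrightarrow>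
      a \<odot>\<^bsub>V\<^esub> (x \<oplus>\<^bsub>V\<^esub> y) = a \<odot>\<^bsub>V\<^esub> x \<oplus>\<^bsub>V\<^esub> a \<odot>\<^bsub>V\<^esub> y"
    and "\<And>a b x. x \<in> carrier V \<Longrightarrow> (a * b) \<odot>\<^bsub>V\<^esub> x = a \<odot>\<^bsub>V\<^esub> (b \<odot>\<^bsub>V\<^esub> x)"
    and "\<And>x. x \<in> carrier V \<Longrightarrow> 1 \<odot>\<^bsub>V\<^esub> x = x"
  shows "real_vector_space V"
  unfolding real_vector_space_def
  by (rule moduleI[OF cring_real_scalars assms(1)]) (use assms in auto)

lemma real_vector_spaceD:
  assumes "real_vector_space V"
  shows "abelian_group V"
    and "\<And>a x. x \<in> carrier V \<Longrightarrow> a \<odot>\<^bsub>V\<^esub> x \<in> carrier V"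
    and "\<And>a b x. x \<in> carrier V \<Longrightarrow> (a + b) \<odot>\<^bsub>V\<^esub> x = a \<odot>\<^bsub>V\<^esub> x \<oplus>\<^bsub>V\<^esub> b \<odot>\<^bsub>V\<^esub> x"
    and "\<And>a x y. x \<in> carrier V \<Longrightarrow> y \<in> carrier V \<Longrightarrow>
      a \<odot>\<^bsub>V\<^esub> (x \<oplus>\<^bsub>V\<^esub> y) = a \<odot>\<^bsub>V\<^esub> x \<oplus>\<^bsub>V\<^esub> a \<odot>\<^bsub>V\<^esub> y"
    and "\<And>a b x. x \<in> carrier V \<Longrightarrow> (a * b) \<odot>\<^bsub>V\<^esub> x = a \<odot>\<^bsub>V\<^esub> (b \<odot>\<^bsub>V\<^esub> x)"
    and "\<And>x. x \<in> carrier V \<Longrightarrow> 1 \<odot>\<^bsub>V\<^esub> x = x"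
    and "\<And>x. x \<in> carrier V \<Longrightarrow> 0 \<odot>\<^bsub>V\<^esub> x = \<zero>\<^bsub>V\<^esub>"
    and "\<And>x y. x \<in> carrier V \<Longrightarrow> y \<in> carrier V \<Longrightarrow> x \<ominus>\<^bsub>V\<^esub> y = x \<oplus>\<^bsub>V\<^esub> (-1) \<odot>\<^bsub>V\<^esub> y"
proof -
  interpret module real_scalars V using assms by (simp add: real_vector_space_def)
  show "abelian_group V" by (rule M.abelian_group_axioms)
  fix a b x y assume x: "x \<in> carrier V"
  show "a \<odot>\<^bsub>V\<^esub> x \<in> carrier V" using x by simp
  show "(a + b) \<odot>\<^bsub>V\<^esub> x = a \<odot>\<^bsub>V\<^esub> x \<oplus>\<^bsub>V\<^esub> b \<odot>\<^bsub>V\<^esub> x"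
    using smult_l_distr[of a b x] x by simp
  show "(a * b) \<odot>\<^bsub>V\<^esub> x = a \<odot>\<^bsub>V\<^esub> (b \<odot>\<^bsub>V\<^esub> x)"
    using smult_assoc1[of a b x] x by simp
  show "1 \<odot>\<^bsub>V\<^esub> x = x" using smult_one[of x] x by simp
  show "0 \<odot>\<^bsub>V\<^esub> x = \<zero>\<^bsub>V\<^esub>" using smult_l_null[of x] x by simp
  assume y: "y \<in> carrier V"
  show "a \<odot>\<^bsub>V\<^esub> (x \<oplus>\<^bsub>V\<^esub> y) = a \<odot>\<^bsub>V\<^esub> x \<oplus>\<^bsub>V\<^esub> a \<odot>\<^bsub>V\<^esub> y"
    using smult_r_distr[of a x y] x y by simp
  show "x \<ominus>\<^bsub>V\<^esub> y = x \<oplus>\<^bsub>V\<^esub> (-1) \<odot>\<^bsub>V\<^esub> y"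
    using smult_l_minus[of 1 y] smult_one[of y] y by (simp add: a_minus_def)
qed

lemma inner_product_onD:
  assumes "inner_product_on V ip"
  shows "\<And>x y. x \<in> carrier V \<Longrightarrow> y \<in> carrier V \<Longrightarrow> ip x y = ip y x"
    and "\<And>x y z. x \<in> carrier V \<Longrightarrow> y \<in> carrier V \<Longrightarrow> z \<in> carrier V \<Longrightarrow>
      ip (x \<oplus>\<^bsub>V\<^esub> y) z = ip x z + ip y z"
    and "\<And>c x y. x \<in> carrier V \<Longrightarrow> y \<in> carrier V \<Longrightarrow> ip (c \<odot>\<^bsub>V\<^esub> x) y = c * ip x y"
    and "\<And>x. x \<in> carrier V \<Longrightarrow> 0 \<le> ip x x"
    and "\<And>x. x \<in> carrier V \<Longrightarrow> ip x x = 0 \<Longrightarrow> x = \<zero>\<^bsub>V\<^esub>"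
  using assms unfolding inner_product_on_def by blast+

text \<open>Cauchy sequences in terms of the norm alone, so that the guarded distance
  \<open>norm_dist\<close> is confined to the next three lemmas.\<close>

definition norm_Cauchy :: "(real, 'v) module \<Rightarrow> ('v \<Rightarrow> real) \<Rightarrow> (nat \<Rightarrow> 'v) \<Rightarrow> bool" where
  "norm_Cauchy V nrm \<sigma> \<longleftrightarrow> range \<sigma> \<subseteq> carrier V \<and>
     (\<forall>e>0. \<exists>N. \<forall>n\<ge>N. \<forall>k\<ge>N. nrm (\<sigma> n \<ominus>\<^bsub>V\<^esub> \<sigma> k) < e)"

text \<open>The usual route from an inner product to a metric, with Cauchy-Schwarz giving the
  triangle inequality. It is carried out in carrier notation because the vectors are equivalence
  classes, which form a set and not a type.\<close>

lemma Metric_space_norm_dist: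
  assumes V: "real_vector_space V" and ip: "inner_product_on V ip"
    and nrm: "\<And>x. x \<in> carrier V \<Longrightarrow> nrm x = sqrt (ip x x)"
  shows "Metric_space (carrier V) (norm_dist V nrm)"
proof -
  note VD = real_vector_spaceD[OF V]
  interpret abelian_group V by (rule VD(1))
  note sym = inner_product_onD(1)[OF ip] and addl = inner_product_onD(2)[OF ip]
    and scl = inner_product_onD(3)[OF ip] and pos = inner_product_onD(4)[OF ip]
    and def = inner_product_onD(5)[OF ip]
  have expand: "ip (x \<oplus>\<^bsub>V\<^esub> c \<odot>\<^bsub>V\<^esub> y) (x \<oplus>\<^bsub>V\<^esub> c \<odot>\<^bsub>V\<^esub> y) = ip x x + 2 * c * ip x y + c\<^sup>2 * ip y y"
    if x: "x \<in> carrier V" and y: "y \<in> carrier V" for x y c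
  proof -
    have cy: "c \<odot>\<^bsub>V\<^esub> y \<in> carrier V" and xcy: "x \<oplus>\<^bsub>V\<^esub> c \<odot>\<^bsub>V\<^esub> y \<in> carrier V"
      using VD(2) x y by auto
    have "ip (x \<oplus>\<^bsub>V\<^esub> c \<odot>\<^bsub>V\<^esub> y) (x \<oplus>\<^bsub>V\<^esub> c \<odot>\<^bsub>V\<^esub> y)
        = ip (x \<oplus>\<^bsub>V\<^esub> c \<odot>\<^bsub>V\<^esub> y) x + c * ip (x \<oplus>\<^bsub>V\<^esub> c \<odot>\<^bsub>V\<^esub> y) y"
      using addl[OF x cy xcy] scl[OF y xcy, of c] sym[OF x xcy] sym[OF y xcy] by simp
    also have "\<dots> = ip x x + c * ip y x + c * (ip x y + c * ip y y)"
      using addl[OF x cy x] addl[OF x cy y] scl[OF y x] scl[OF y y] x y by simp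
    also have "\<dots> = ip x x + 2 * c * ip x y + c\<^sup>2 * ip y y"
      using sym[OF x y] by (simp add: algebra_simps power2_eq_square)
    finally show ?thesis .
  qed
  have CS: "ip x y \<le> sqrt (ip x x) * sqrt (ip y y)"
    if x: "x \<in> carrier V" and y: "y \<in> carrier V" for x y
  proof (cases "ip y y = 0")
    case True
    then have "y = 0 \<odot>\<^bsub>V\<^esub> y" using def[OF y] VD(7)[OF y] y by simp
    then have "ip x y = 0" using scl[OF y x, of 0] sym[OF x y] x y by simp
    then show ?thesis using True by simp
  next
    case False
    with pos[OF y] have yy: "ip y y > 0" by simp
    \<comment> \<open>The value of \<open>c\<close> that minimises the quadratic polynomial on the
      right of \<open>expand\<close>.\<close>
    let ?c = "- ip x y / ip y y"
    have "0 \<le> ip (x \<oplus>\<^bsub>V\<^esub> ?c \<odot>\<^bsub>V\<^esub> y) (x \<oplus>\<^bsub>V\<^esub> ?c \<odot>\<^bsub>V\<^esub> y)"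
      using pos VD(2) x y by blast
    then have "0 \<le> ip x x - (ip x y)\<^sup>2 / ip y y"
      using yy unfolding expand[OF x y] by (simp add: field_simps power2_eq_square)
    then have "(ip x y)\<^sup>2 \<le> ip x x * ip y y" using yy by (simp add: field_simps)
    then have "\<bar>ip x y\<bar> \<le> sqrt (ip x x * ip y y)" by (metis real_sqrt_abs real_sqrt_le_iff)
    then show ?thesis by (simp add: real_sqrt_mult)
  qed
  have tri: "nrm (x \<oplus>\<^bsub>V\<^esub> y) \<le> nrm x + nrm y" if x: "x \<in> carrier V" and y: "y \<in> carrier V" for x y
  proof -
    have "ip (x \<oplus>\<^bsub>V\<^esub> y) (x \<oplus>\<^bsub>V\<^esub> y) = ip x x + 2 * ip x y + ip y y"
      using expand[OF x y, of 1] VD(6)[OF y] by simp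
    also have "\<dots> \<le> ip x x + 2 * (sqrt (ip x x) * sqrt (ip y y)) + ip y y"
      using CS[OF x y] by simp
    also have "\<dots> = (sqrt (ip x x) + sqrt (ip y y))\<^sup>2"
      using pos x y by (simp add: power2_sum)
    finally show ?thesis using pos x y by (simp add: nrm real_le_lsqrt)
  qed
  have m1: "nrm ((-1) \<odot>\<^bsub>V\<^esub> x) = nrm x" if x: "x \<in> carrier V" for x
  proof -
    have mx: "(-1) \<odot>\<^bsub>V\<^esub> x \<in> carrier V" using VD(2) x by blast
    have "ip ((-1) \<odot>\<^bsub>V\<^esub> x) ((-1) \<odot>\<^bsub>V\<^esub> x) = ip x x"
      using scl[OF x mx, of "-1"] sym[OF x mx] scl[OF x x, of "-1"] mx x by simp
    then show ?thesis using nrm x mx by simp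
  qed
  show ?thesis
  proof
    fix x y
    show "0 \<le> norm_dist V nrm x y"
      using pos by (auto simp: norm_dist_def nrm)
    have "(-1) \<odot>\<^bsub>V\<^esub> (x \<ominus>\<^bsub>V\<^esub> y) = y \<ominus>\<^bsub>V\<^esub> x" if x: "x \<in> carrier V" and y: "y \<in> carrier V"
      using VD(4)[of x "(-1) \<odot>\<^bsub>V\<^esub> y" "-1"] VD(5)[OF y, of "-1" "-1"] VD(6)[OF y] x y
      by (simp add: VD(2,8) a_comm)
    then show "norm_dist V nrm x y = norm_dist V nrm y x"
      unfolding norm_dist_def by (metis m1 minus_closed)
  next
    fix x y assume x: "x \<in> carrier V" and y: "y \<in> carrier V"
    have "nrm (x \<ominus>\<^bsub>V\<^esub> y) = 0 \<longleftrightarrow> x \<ominus>\<^bsub>V\<^esub> y = \<zero>\<^bsub>V\<^esub>"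
    proof
      assume "nrm (x \<ominus>\<^bsub>V\<^esub> y) = 0" then show "x \<ominus>\<^bsub>V\<^esub> y = \<zero>\<^bsub>V\<^esub>" using def x y by (simp add: nrm)
    next
      assume "x \<ominus>\<^bsub>V\<^esub> y = \<zero>\<^bsub>V\<^esub>"
      moreover have "ip \<zero>\<^bsub>V\<^esub> \<zero>\<^bsub>V\<^esub> = 0" using addl[of "\<zero>\<^bsub>V\<^esub>" "\<zero>\<^bsub>V\<^esub>" "\<zero>\<^bsub>V\<^esub>"] by simp
      ultimately show "nrm (x \<ominus>\<^bsub>V\<^esub> y) = 0" by (simp add: nrm)
    qed
    also have "\<dots> \<longleftrightarrow> x = y"
      using x y by (metis (full_types) a_inv_closed a_minus_def minus_equality minus_minus r_neg)
    finally show "norm_dist V nrm x y = 0 \<longleftrightarrow> x = y" using x y by (simp add: norm_dist_def)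
  next
    fix x y z assume x: "x \<in> carrier V" and y: "y \<in> carrier V" and z: "z \<in> carrier V"
    have "x \<ominus>\<^bsub>V\<^esub> z = (x \<ominus>\<^bsub>V\<^esub> y) \<oplus>\<^bsub>V\<^esub> (y \<ominus>\<^bsub>V\<^esub> z)"
      using x y z by (simp add: a_minus_def a_assoc r_neg1)
    then show "norm_dist V nrm x z \<le> norm_dist V nrm x y + norm_dist V nrm y z"
      using tri[of "x \<ominus>\<^bsub>V\<^esub> y" "y \<ominus>\<^bsub>V\<^esub> z"] x y z by (simp add: norm_dist_def)
  qed
qed

text \<open>A Cauchy sequence with a convergent subsequence converges, so a limit along some
  subsequence suffices. This is the form in which almost everywhere convergence delivers the
  completeness of \<open>L2a_space\<close>.\<close>

lemma hilbert_spaceI: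
  assumes V: "real_vector_space V" and ip: "inner_product_on V ip"
    and nrm: "\<And>x. x \<in> carrier V \<Longrightarrow> nrm x = sqrt (ip x x)"
    and complete: "\<And>\<sigma>. norm_Cauchy V nrm \<sigma> \<Longrightarrow>
      \<exists>x\<in>carrier V. \<exists>r. strict_mono r \<and> (\<lambda>n. nrm (\<sigma> (r n) \<ominus>\<^bsub>V\<^esub> x)) \<longlonglongrightarrow> 0"
  shows "hilbert_space V nrm"
proof -
  interpret Metric_space "carrier V" "norm_dist V nrm"
    by (rule Metric_space_norm_dist[OF V ip nrm])
  have "\<exists>x. limitin mtopology \<sigma> x sequentially" if \<sigma>: "MCauchy \<sigma>" for \<sigma>
  proof -
    have \<sigma>V: "\<sigma> n \<in> carrier V" for n using \<sigma> by (auto simp: MCauchy_def)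
    have "norm_Cauchy V nrm \<sigma>" using \<sigma> \<sigma>V by (simp add: MCauchy_def norm_Cauchy_def norm_dist_def)
    from complete[OF this] obtain x r where x: "x \<in> carrier V" and r: "strict_mono (r::nat\<Rightarrow>nat)"
      and lim: "(\<lambda>n. nrm (\<sigma> (r n) \<ominus>\<^bsub>V\<^esub> x)) \<longlonglongrightarrow> 0" by blast
    have "limitin mtopology (\<sigma> \<circ> r) x sequentially"
      unfolding limitin_metric_dist_null using lim x \<sigma>V by (simp add: norm_dist_def)
    then show ?thesis using MCauchy_convergent_subsequence[OF \<sigma> r] by blast
  qed
  then have "mcomplete" by (simp add: mcomplete_def)
  then show ?thesis using V ip nrm Metric_space_axioms unfolding hilbert_space_def by blast
qed

lemma hilbert_spaceD:
  assumes "hilbert_space V nrm"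
  shows "real_vector_space V"
    and "\<exists>ip. inner_product_on V ip \<and> (\<forall>x\<in>carrier V. nrm x = sqrt (ip x x))"
    and "\<And>\<sigma>. norm_Cauchy V nrm \<sigma> \<Longrightarrow> \<exists>x\<in>carrier V. (\<lambda>n. nrm (\<sigma> n \<ominus>\<^bsub>V\<^esub> x)) \<longlonglongrightarrow> 0"
proof -
  show "real_vector_space V" "\<exists>ip. inner_product_on V ip \<and> (\<forall>x\<in>carrier V. nrm x = sqrt (ip x x))"
    using assms by (auto simp: hilbert_space_def)
  interpret Metric_space "carrier V" "norm_dist V nrm"
    using assms by (simp add: hilbert_space_def)
  fix \<sigma> assume \<sigma>: "norm_Cauchy V nrm \<sigma>"
  then have \<sigma>V: "\<sigma> n \<in> carrier V" for n by (auto simp: norm_Cauchy_def)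
  have "MCauchy \<sigma>" using \<sigma> \<sigma>V by (simp add: norm_Cauchy_def MCauchy_def norm_dist_def)
  moreover have "mcomplete" using assms by (simp add: hilbert_space_def)
  ultimately obtain x where "limitin mtopology \<sigma> x sequentially" unfolding mcomplete_def by blast
  then show "\<exists>x\<in>carrier V. (\<lambda>n. nrm (\<sigma> n \<ominus>\<^bsub>V\<^esub> x)) \<longlonglongrightarrow> 0"
    unfolding limitin_metric_dist_null using \<sigma>V by (auto simp: norm_dist_def)
qed

text \<open>The inner product is pulled back along \<open>\<Phi>\<close>: injectivity keeps it
  definite, and surjectivity brings the limit of an image sequence back to \<open>V\<close>.\<close>

lemma hilbert_space_transport:
  assumes V: "real_vector_space V" and U: "hilbert_space U nU"
    and iso: "isometric_isomorphism V nV U nU \<Phi>"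
  shows "hilbert_space V nV"
proof -
  note VD = real_vector_spaceD[OF V] and UD = real_vector_spaceD[OF hilbert_spaceD(1)[OF U]]
  interpret V: abelian_group V by (rule VD(1))
  interpret U: abelian_group U by (rule UD(1))
  have bij: "bij_betw \<Phi> (carrier V) (carrier U)"
    and add: "\<And>x y. x \<in> carrier V \<Longrightarrow> y \<in> carrier V \<Longrightarrow> \<Phi> (x \<oplus>\<^bsub>V\<^esub> y) = \<Phi> x \<oplus>\<^bsub>U\<^esub> \<Phi> y"
    and smult: "\<And>c x. x \<in> carrier V \<Longrightarrow> \<Phi> (c \<odot>\<^bsub>V\<^esub> x) = c \<odot>\<^bsub>U\<^esub> \<Phi> x"
    and nrm: "\<And>x. x \<in> carrier V \<Longrightarrow> nU (\<Phi> x) = nV x"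
    using iso by (auto simp: isometric_isomorphism_def)
  have mem: "\<Phi> x \<in> carrier U" if "x \<in> carrier V" for x using bij that by (auto simp: bij_betw_def)
  have minus: "\<Phi> (x \<ominus>\<^bsub>V\<^esub> y) = \<Phi> x \<ominus>\<^bsub>U\<^esub> \<Phi> y" if "x \<in> carrier V" "y \<in> carrier V" for x y
    using that by (simp add: VD(2,8) UD(8) add smult mem)
  have zero: "\<Phi> \<zero>\<^bsub>V\<^esub> = \<zero>\<^bsub>U\<^esub>"
    using smult[of "\<zero>\<^bsub>V\<^esub>" 0] VD(7)[of "\<zero>\<^bsub>V\<^esub>"] UD(7) mem by simp
  obtain ip where ip: "inner_product_on U ip" and ipn: "\<forall>x\<in>carrier U. nU x = sqrt (ip x x)"
    using hilbert_spaceD(2)[OF U] by blast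
  show ?thesis
  proof (rule hilbert_spaceI[OF V, where ip = "\<lambda>x y. ip (\<Phi> x) (\<Phi> y)"])
    have inj0: "x = \<zero>\<^bsub>V\<^esub>" if "x \<in> carrier V" "\<Phi> x = \<zero>\<^bsub>U\<^esub>" for x
      using that bij zero by (auto simp: bij_betw_def inj_on_def)
    show "inner_product_on V (\<lambda>x y. ip (\<Phi> x) (\<Phi> y))"
    proof -
      note ipU = inner_product_onD[OF ip]
      show ?thesis
        unfolding inner_product_on_def
      proof (intro conjI ballI allI impI)
        fix x y z c assume x: "x \<in> carrier V"
        show "0 \<le> ip (\<Phi> x) (\<Phi> x)" by (rule ipU(4)[OF mem[OF x]])
        show "x = \<zero>\<^bsub>V\<^esub>" if "ip (\<Phi> x) (\<Phi> x) = 0" by (rule inj0[OF x ipU(5)[OF mem[OF x] that]])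
        assume y: "y \<in> carrier V"
        show "ip (\<Phi> x) (\<Phi> y) = ip (\<Phi> y) (\<Phi> x)" by (rule ipU(1)[OF mem mem, OF x y])
        show "ip (\<Phi> (c \<odot>\<^bsub>V\<^esub> x)) (\<Phi> y) = c * ip (\<Phi> x) (\<Phi> y)"
          by (simp only: smult[OF x] ipU(3)[OF mem mem, OF x y])
        assume z: "z \<in> carrier V"
        show "ip (\<Phi> (x \<oplus>\<^bsub>V\<^esub> y)) (\<Phi> z) = ip (\<Phi> x) (\<Phi> z) + ip (\<Phi> y) (\<Phi> z)"
          by (simp only: add[OF x y] ipU(2)[OF mem mem mem, OF x y z])
      qed
    qed
    show "nV x = sqrt (ip (\<Phi> x) (\<Phi> x))" if "x \<in> carrier V" for x
      using that ipn mem nrm by simp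
    fix \<sigma> assume \<sigma>: "norm_Cauchy V nV \<sigma>"
    then have \<sigma>V: "\<sigma> n \<in> carrier V" for n by (auto simp: norm_Cauchy_def)
    have "nU (\<Phi> (\<sigma> n) \<ominus>\<^bsub>U\<^esub> \<Phi> (\<sigma> k)) = nV (\<sigma> n \<ominus>\<^bsub>V\<^esub> \<sigma> k)" for n k
      using nrm[OF V.minus_closed[OF \<sigma>V \<sigma>V]] by (simp add: minus[OF \<sigma>V \<sigma>V])
    then have "norm_Cauchy U nU (\<Phi> \<circ> \<sigma>)" using \<sigma> mem \<sigma>V by (auto simp: norm_Cauchy_def)
    then obtain u where u: "u \<in> carrier U" and lim: "(\<lambda>n. nU ((\<Phi> \<circ> \<sigma>) n \<ominus>\<^bsub>U\<^esub> u)) \<longlonglongrightarrow> 0"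
      using hilbert_spaceD(3)[OF U] by blast
    obtain x where x: "x \<in> carrier V" "u = \<Phi> x" using u bij by (auto simp: bij_betw_def)
    have "nU ((\<Phi> \<circ> \<sigma>) n \<ominus>\<^bsub>U\<^esub> u) = nV (\<sigma> n \<ominus>\<^bsub>V\<^esub> x)" for n
      using nrm[OF V.minus_closed[OF \<sigma>V x(1)]] by (simp add: minus[OF \<sigma>V x(1)] x(2))
    then show "\<exists>x\<in>carrier V. \<exists>r. strict_mono r \<and> (\<lambda>n. nV (\<sigma> (r n) \<ominus>\<^bsub>V\<^esub> x)) \<longlonglongrightarrow> 0"
      using lim x(1) by (intro bexI[of _ x] exI[of _ id]) (auto simp: strict_mono_id)
  qed
qed

section \<open>Products of Hilbert spaces\<close>

lemma real_vector_space_prod: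
  assumes "real_vector_space V" "real_vector_space U"
  shows "real_vector_space (prod_space V U)"
proof -
  note VD = real_vector_spaceD[OF assms(1)] and UD = real_vector_spaceD[OF assms(2)]
  interpret V: abelian_group V by (rule VD(1))
  interpret U: abelian_group U by (rule UD(1))
  let ?P = "prod_space V U"
  have c: "carrier ?P = carrier V \<times> carrier U" and z: "\<zero>\<^bsub>?P\<^esub> = (\<zero>\<^bsub>V\<^esub>, \<zero>\<^bsub>U\<^esub>)"
    and a: "(x, y) \<oplus>\<^bsub>?P\<^esub> (x', y') = (x \<oplus>\<^bsub>V\<^esub> x', y \<oplus>\<^bsub>U\<^esub> y')"
    and s: "r \<odot>\<^bsub>?P\<^esub> (x, y) = (r \<odot>\<^bsub>V\<^esub> x, r \<odot>\<^bsub>U\<^esub> y)" for x x' y y' r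
    by (simp_all add: prod_space_def)
  have "abelian_group ?P"
  proof (rule abelian_groupI)
    show "\<zero>\<^bsub>?P\<^esub> \<in> carrier ?P" by (simp add: c z)
    fix p q r assume p: "p \<in> carrier ?P"
    show "\<zero>\<^bsub>?P\<^esub> \<oplus>\<^bsub>?P\<^esub> p = p"
      using p by (auto simp: c z a)
    obtain x y where "p = (x, y)" "x \<in> carrier V" "y \<in> carrier U" using p by (auto simp: c)
    then show "\<exists>q\<in>carrier ?P. q \<oplus>\<^bsub>?P\<^esub> p = \<zero>\<^bsub>?P\<^esub>"
      by (intro bexI[of _ "(\<ominus>\<^bsub>V\<^esub> x, \<ominus>\<^bsub>U\<^esub> y)"]) (simp_all add: c z a V.l_neg U.l_neg)
    assume q: "q \<in> carrier ?P"
    show "p \<oplus>\<^bsub>?P\<^esub> q \<in> carrier ?P" using p q by (auto simp: c a)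
    show "p \<oplus>\<^bsub>?P\<^esub> q = q \<oplus>\<^bsub>?P\<^esub> p" using p q by (auto simp: c a V.a_comm U.a_comm)
    assume r: "r \<in> carrier ?P"
    show "p \<oplus>\<^bsub>?P\<^esub> q \<oplus>\<^bsub>?P\<^esub> r = p \<oplus>\<^bsub>?P\<^esub> (q \<oplus>\<^bsub>?P\<^esub> r)"
      using p q r by (auto simp: c a V.a_assoc U.a_assoc)
  qed
  then show ?thesis
    by (rule real_vector_spaceI) (auto simp: c a s VD(2-6) UD(2-6))
qed

text \<open>The Euclidean combination of the two norms comes from the sum of the two inner products.
  It dominates each component norm, so the components of a Cauchy sequence are Cauchy, and it is
  continuous in them, so their limits can be put together.\<close>

lemma hilbert_space_prod:
  assumes V: "hilbert_space V nV" and U: "hilbert_space U nU"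
  shows "hilbert_space (prod_space V U) (prod_norm nV nU)"
proof -
  note V' = hilbert_spaceD(1)[OF V] and U' = hilbert_spaceD(1)[OF U]
  note VD = real_vector_spaceD[OF V'] and UD = real_vector_spaceD[OF U']
  note PV = real_vector_space_prod[OF V' U']
  interpret V: abelian_group V by (rule VD(1))
  interpret U: abelian_group U by (rule UD(1))
  obtain ip1 where ip1: "inner_product_on V ip1" and n1: "\<forall>x\<in>carrier V. nV x = sqrt (ip1 x x)"
    using hilbert_spaceD(2)[OF V] by blast
  obtain ip2 where ip2: "inner_product_on U ip2" and n2: "\<forall>x\<in>carrier U. nU x = sqrt (ip2 x x)"
    using hilbert_spaceD(2)[OF U] by blast
  note i1 = inner_product_onD[OF ip1] and i2 = inner_product_onD[OF ip2]
  note pos1 = i1(4) and pos2 = i2(4)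
  have minus: "(x, y) \<ominus>\<^bsub>prod_space V U\<^esub> (x', y') = (x \<ominus>\<^bsub>V\<^esub> x', y \<ominus>\<^bsub>U\<^esub> y')"
    if "x \<in> carrier V" "x' \<in> carrier V" "y \<in> carrier U" "y' \<in> carrier U" for x y x' y'
    using real_vector_spaceD(8)[OF PV, of "(x, y)" "(x', y')"] that
    by (simp add: prod_space_def VD(8) UD(8))
  have le: "nV x \<le> prod_norm nV nU (x, y)" "nU y \<le> prod_norm nV nU (x, y)" for x y
    by (simp_all add: prod_norm_def real_le_rsqrt)
  show ?thesis
  proof (rule hilbert_spaceI[OF PV, where ip = "\<lambda>(x, y) (x', y'). ip1 x x' + ip2 y y'"])
    show "inner_product_on (prod_space V U) (\<lambda>(x, y) (x', y'). ip1 x x' + ip2 y y')"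
    proof -
      have c: "carrier (prod_space V U) = carrier V \<times> carrier U"
        "\<zero>\<^bsub>prod_space V U\<^esub> = (\<zero>\<^bsub>V\<^esub>, \<zero>\<^bsub>U\<^esub>)"
        "(x, y) \<oplus>\<^bsub>prod_space V U\<^esub> (x', y') = (x \<oplus>\<^bsub>V\<^esub> x', y \<oplus>\<^bsub>U\<^esub> y')"
        "r \<odot>\<^bsub>prod_space V U\<^esub> (x, y) = (r \<odot>\<^bsub>V\<^esub> x, r \<odot>\<^bsub>U\<^esub> y)" for x x' y y' r
        by (simp_all add: prod_space_def)
      show ?thesis
        unfolding inner_product_on_def c
      proof (intro conjI ballI allI impI; clarify)
        fix x y x' y' r assume x: "x \<in> carrier V" "y \<in> carrier U"
        show "0 \<le> ip1 x x + ip2 y y" using pos1[OF x(1)] pos2[OF x(2)] by simp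
        show "x = \<zero>\<^bsub>V\<^esub> \<and> y = \<zero>\<^bsub>U\<^esub>" if "ip1 x x + ip2 y y = 0"
          using that pos1[OF x(1)] pos2[OF x(2)] i1(5)[OF x(1)] i2(5)[OF x(2)] by linarith
        assume x': "x' \<in> carrier V" "y' \<in> carrier U"
        show "ip1 x x' + ip2 y y' = ip1 x' x + ip2 y' y"
          using i1(1)[OF x(1) x'(1)] i2(1)[OF x(2) x'(2)] by simp
        show "(case r \<odot>\<^bsub>prod_space V U\<^esub> (x, y) of (x, y) \<Rightarrow> \<lambda>(x', y'). ip1 x x' + ip2 y y') (x', y')
            = r * (ip1 x x' + ip2 y y')"
          by (simp only: c prod.case i1(3)[OF x(1) x'(1)] i2(3)[OF x(2) x'(2)] distrib_left)
        fix x'' y'' assume x'': "x'' \<in> carrier V" "y'' \<in> carrier U"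
        show "(case (x, y) \<oplus>\<^bsub>prod_space V U\<^esub> (x', y') of (x, y) \<Rightarrow> \<lambda>(x', y'). ip1 x x'
            + ip2 y y') (x'', y'')
            = ip1 x x'' + ip2 y y'' + (ip1 x' x'' + ip2 y' y'')"
          by (simp only: c prod.case i1(2)[OF x(1) x'(1) x''(1)] i2(2)[OF x(2) x'(2) x''(2)]
              ac_simps)
      qed
    qed
    fix z assume "z \<in> carrier (prod_space V U)"
    then show "prod_norm nV nU z = sqrt ((\<lambda>(x, y) (x', y'). ip1 x x' + ip2 y y') z z)"
      using n1 n2 pos1 pos2 by (auto simp: prod_space_def prod_norm_def)
  next
    fix \<sigma> assume \<sigma>: "norm_Cauchy (prod_space V U) (prod_norm nV nU) \<sigma>"
    define a b where "a = fst \<circ> \<sigma>" and "b = snd \<circ> \<sigma>"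
    have \<sigma>_eq: "\<sigma> n = (a n, b n)" for n by (simp add: a_def b_def)
    have "\<sigma> n \<in> carrier (prod_space V U)" for n using \<sigma> by (auto simp: norm_Cauchy_def)
    then have ab: "a n \<in> carrier V" "b n \<in> carrier U" for n by (auto simp: prod_space_def \<sigma>_eq)
    have diff: "\<sigma> n \<ominus>\<^bsub>prod_space V U\<^esub> \<sigma> k = (a n \<ominus>\<^bsub>V\<^esub> a k, b n \<ominus>\<^bsub>U\<^esub> b k)" for n k
      using minus ab by (simp add: \<sigma>_eq)
    have "\<exists>N. \<forall>n\<ge>N. \<forall>k\<ge>N. nV (a n \<ominus>\<^bsub>V\<^esub> a k) < e \<and> nU (b n \<ominus>\<^bsub>U\<^esub> b k) < e" if "e > 0" for e
    proof -
      obtain N where "\<forall>n\<ge>N. \<forall>k\<ge>N. prod_norm nV nU (a n \<ominus>\<^bsub>V\<^esub> a k, b n \<ominus>\<^bsub>U\<^esub> b k) < e"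
        using \<sigma> \<open>e > 0\<close> unfolding norm_Cauchy_def diff by blast
      then show ?thesis
        by (intro exI[of _ N] allI impI conjI le_less_trans[OF le(1)] le_less_trans[OF le(2)]) auto
    qed
    then have "\<forall>e>0. \<exists>N. \<forall>n\<ge>N. \<forall>k\<ge>N. nV (a n \<ominus>\<^bsub>V\<^esub> a k) < e"
      and "\<forall>e>0. \<exists>N. \<forall>n\<ge>N. \<forall>k\<ge>N. nU (b n \<ominus>\<^bsub>U\<^esub> b k) < e"
      by meson+
    moreover have "range a \<subseteq> carrier V" "range b \<subseteq> carrier U" using ab by auto
    ultimately have "norm_Cauchy V nV a" "norm_Cauchy U nU b" by (simp_all add: norm_Cauchy_def)
    then obtain x y where x: "x \<in> carrier V" "(\<lambda>n. nV (a n \<ominus>\<^bsub>V\<^esub> x)) \<longlonglongrightarrow> 0"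
      and y: "y \<in> carrier U" "(\<lambda>n. nU (b n \<ominus>\<^bsub>U\<^esub> y)) \<longlonglongrightarrow> 0"
      using hilbert_spaceD(3)[OF V] hilbert_spaceD(3)[OF U] by blast
    have "(\<lambda>n. sqrt ((nV (a n \<ominus>\<^bsub>V\<^esub> x))\<^sup>2 + (nU (b n \<ominus>\<^bsub>U\<^esub> y))\<^sup>2)) \<longlonglongrightarrow> sqrt (0\<^sup>2 + 0\<^sup>2)"
      by (intro tendsto_intros x(2) y(2))
    then have "(\<lambda>n. prod_norm nV nU (\<sigma> n \<ominus>\<^bsub>prod_space V U\<^esub> (x, y))) \<longlonglongrightarrow> 0"
      using minus ab x(1) y(1) by (simp add: \<sigma>_eq prod_norm_def)
    then show "\<exists>z\<in>carrier (prod_space V U). \<exists>r. strict_mono r \<and>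
        (\<lambda>n. prod_norm nV nU (\<sigma> (r n) \<ominus>\<^bsub>prod_space V U\<^esub> z)) \<longlonglongrightarrow> 0"
      using x(1) y(1)
      by (intro bexI[of _ "(x, y)"] exI[of _ id]) (auto simp: strict_mono_id prod_space_def)
  qed
qed

text \<open>What lets the pointwise operations descend to classes: \<open>S\<close> is a space of
  functions and \<open>R\<close> a congruence on it. It is instantiated twice, with equality almost
  everywhere on the product space and with indistinguishability.\<close>

locale process_quotient =
  fixes S :: "(real \<Rightarrow> 'w \<Rightarrow> 'b :: real_vector) set" and R :: "(real \<Rightarrow> 'w \<Rightarrow> 'b) rel"
  assumes zero_mem: "(\<lambda>t \<omega>. 0) \<in> S"
    and add_mem: "\<And>x y. x \<in> S \<Longrightarrow> y \<in> S \<Longrightarrow> (\<lambda>t \<omega>. x t \<omega> + y t \<omega>) \<in> S"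
    and scale_mem: "\<And>c x. x \<in> S \<Longrightarrow> (\<lambda>t \<omega>. c *\<^sub>R x t \<omega>) \<in> S"
    and equiv_rel: "equiv S R"
    and add_rel: "\<And>x x' y y'. (x, x') \<in> R \<Longrightarrow> (y, y') \<in> R \<Longrightarrow>
      (\<lambda>t \<omega>. x t \<omega> + y t \<omega>, \<lambda>t \<omega>. x' t \<omega> + y' t \<omega>) \<in> R"
    and scale_rel: "\<And>c x x'. (x, x') \<in> R \<Longrightarrow> (\<lambda>t \<omega>. c *\<^sub>R x t \<omega>, \<lambda>t \<omega>. c *\<^sub>R x' t \<omega>) \<in> R"
begin

lemma class_eqI: "(x, y) \<in> R \<Longrightarrow> R `` {x} = R `` {y}"
  by (rule equiv_class_eq[OF equiv_rel])

lemma rel_refl: "x \<in> S \<Longrightarrow> (x, x) \<in> R"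
  using equiv_rel by (auto simp: equiv_def refl_on_def)

lemma class_mem: "x \<in> S \<Longrightarrow> R `` {x} \<in> carrier (process_space S R)"
  by (simp add: process_space_def quotientI)

lemma classE:
  assumes "X \<in> carrier (process_space S R)"
  obtains x where "x \<in> S" "X = R `` {x}"
  using assms by (auto simp: process_space_def elim: quotientE)

lemma zero_class: "\<zero>\<^bsub>process_space S R\<^esub> = R `` {\<lambda>t \<omega>. 0}"
  by (simp add: process_space_def)

text \<open>\<open>process_space\<close> defines the sum as a union over all pairs of
  representatives. The congruence makes all members of the union equal, and reflexivity keeps it
  from being empty.\<close>

lemma add_class:
  assumes "x \<in> S" "y \<in> S"
  shows "R `` {x} \<oplus>\<^bsub>process_space S R\<^esub> R `` {y} = R `` {\<lambda>t \<omega>. x t \<omega> + y t \<omega>}"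
proof -
  have "R `` {\<lambda>t \<omega>. x' t \<omega> + y' t \<omega>} = R `` {\<lambda>t \<omega>. x t \<omega> + y t \<omega>}"
    if "(x, x') \<in> R" "(y, y') \<in> R" for x' y'
    by (rule class_eqI[OF add_rel[OF that], symmetric])
  then have "(\<Union>x'\<in>R `` {x}. \<Union>y'\<in>R `` {y}. R `` {\<lambda>t \<omega>. x' t \<omega> + y' t \<omega>})
      = (\<Union>x'\<in>R `` {x}. \<Union>y'\<in>R `` {y}. R `` {\<lambda>t \<omega>. x t \<omega> + y t \<omega>})"
    by (intro SUP_cong refl) simp
  also have "\<dots> = R `` {\<lambda>t \<omega>. x t \<omega> + y t \<omega>}"
    using rel_refl assms by blast
  finally show ?thesis by (simp add: process_space_def)
qed

lemma scale_class:
  assumes "x \<in> S"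
  shows "c \<odot>\<^bsub>process_space S R\<^esub> R `` {x} = R `` {\<lambda>t \<omega>. c *\<^sub>R x t \<omega>}"
proof -
  have "R `` {\<lambda>t \<omega>. c *\<^sub>R x' t \<omega>} = R `` {\<lambda>t \<omega>. c *\<^sub>R x t \<omega>}" if "(x, x') \<in> R" for x'
    by (rule class_eqI[OF scale_rel[OF that], symmetric])
  then have "(\<Union>x'\<in>R `` {x}. R `` {\<lambda>t \<omega>. c *\<^sub>R x' t \<omega>})
      = (\<Union>x'\<in>R `` {x}. R `` {\<lambda>t \<omega>. c *\<^sub>R x t \<omega>})"
    by (intro SUP_cong refl) simp
  also have "\<dots> = R `` {\<lambda>t \<omega>. c *\<^sub>R x t \<omega>}"
    using rel_refl assms by blast
  finally show ?thesis by (simp add: process_space_def)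
qed

lemma real_vector_space_process: "real_vector_space (process_space S R)"
proof (rule real_vector_spaceI, rule abelian_groupI)
  let ?V = "process_space S R"
  show "\<zero>\<^bsub>?V\<^esub> \<in> carrier ?V" by (simp add: zero_class class_mem zero_mem)
  fix X Y assume X: "X \<in> carrier ?V" and Y: "Y \<in> carrier ?V"
  from X obtain x where x: "x \<in> S" "X = R `` {x}" by (rule classE)
  from Y obtain y where y: "y \<in> S" "Y = R `` {y}" by (rule classE)
  show "X \<oplus>\<^bsub>?V\<^esub> Y \<in> carrier ?V" by (simp add: x y add_class add_mem class_mem)
  show "X \<oplus>\<^bsub>?V\<^esub> Y = Y \<oplus>\<^bsub>?V\<^esub> X" by (simp add: x y add_class add.commute)
  show "\<zero>\<^bsub>?V\<^esub> \<oplus>\<^bsub>?V\<^esub> X = X" by (simp add: x zero_class add_class zero_mem)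
  show "\<exists>Z\<in>carrier ?V. Z \<oplus>\<^bsub>?V\<^esub> X = \<zero>\<^bsub>?V\<^esub>"
    by (rule bexI[of _ "R `` {\<lambda>t \<omega>. (-1) *\<^sub>R x t \<omega>}"])
      (simp_all only: x zero_class add_class scale_mem class_mem, simp)
  fix a b :: real
  show "a \<odot>\<^bsub>?V\<^esub> X \<in> carrier ?V" by (simp add: x scale_class scale_mem class_mem)
  show "(a + b) \<odot>\<^bsub>?V\<^esub> X = a \<odot>\<^bsub>?V\<^esub> X \<oplus>\<^bsub>?V\<^esub> b \<odot>\<^bsub>?V\<^esub> X"
    by (simp add: x scale_class add_class scale_mem scaleR_add_left)
  show "a \<odot>\<^bsub>?V\<^esub> (X \<oplus>\<^bsub>?V\<^esub> Y) = a \<odot>\<^bsub>?V\<^esub> X \<oplus>\<^bsub>?V\<^esub> a \<odot>\<^bsub>?V\<^esub> Y"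
    by (simp add: x y scale_class add_class add_mem scale_mem scaleR_add_right)
  show "(a * b) \<odot>\<^bsub>?V\<^esub> X = a \<odot>\<^bsub>?V\<^esub> (b \<odot>\<^bsub>?V\<^esub> X)"
    by (simp add: x scale_class scale_mem)
  show "1 \<odot>\<^bsub>?V\<^esub> X = X" by (simp add: x scale_class)
  fix Z assume "Z \<in> carrier ?V"
  then obtain z where z: "z \<in> S" "Z = R `` {z}" by (rule classE)
  show "X \<oplus>\<^bsub>?V\<^esub> Y \<oplus>\<^bsub>?V\<^esub> Z = X \<oplus>\<^bsub>?V\<^esub> (Y \<oplus>\<^bsub>?V\<^esub> Z)"
    by (simp add: x y z add_class add_mem add.assoc)
qed

lemma minus_class:
  assumes "x \<in> S" "y \<in> S"
  shows "R `` {x} \<ominus>\<^bsub>process_space S R\<^esub> R `` {y} = R `` {\<lambda>t \<omega>. x t \<omega> - y t \<omega>}"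
  using assms real_vector_spaceD(8)[OF real_vector_space_process class_mem class_mem, of x y]
    scale_class[of y "-1"] add_class[of x "\<lambda>t \<omega>. (-1) *\<^sub>R y t \<omega>"] scale_mem[of y "-1"] by simp

end

section \<open>Square integrable functions\<close>

text \<open>Phrased with a finite real integral because the later arguments expand squares and
  subtract the results; \<open>sq_integrable_iff_nn_integral\<close> connects it with the extended
  integrals of the definitions.\<close>

definition sq_integrable :: "'a measure \<Rightarrow> ('a \<Rightarrow> 'b :: euclidean_space) \<Rightarrow> bool" where
  "sq_integrable M f \<longleftrightarrow> f \<in> borel_measurable M \<and> integrable M (\<lambda>x. (norm (f x))\<^sup>2)"

lemma sq_integrableD:
  assumes "sq_integrable M f"
  shows "f \<in> borel_measurable M" "integrable M (\<lambda>x. (norm (f x))\<^sup>2)"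
  using assms by (auto simp: sq_integrable_def)

lemma sq_integrable_iff_nn_integral:
  assumes [measurable]: "f \<in> borel_measurable M"
  shows "sq_integrable M f \<longleftrightarrow> (\<integral>\<^sup>+ x. ennreal ((norm (f x))\<^sup>2) \<partial>M) < \<infinity>"
  by (simp add: sq_integrable_def integrable_iff_bounded)

text \<open>The parallelogram law without the term for \<open>x - y\<close>.\<close>

lemma norm_add_sq_le: "(norm (x + y))\<^sup>2 \<le> 2 * (norm x)\<^sup>2 + 2 * (norm (y :: 'a :: real_inner))\<^sup>2"
  using zero_le_power2[of "norm (x - y)"]
  by (simp add: power2_norm_eq_inner algebra_simps inner_commute)

lemma abs_inner_le_sq: "\<bar>x \<bullet> y\<bar> \<le> ((norm x)\<^sup>2 + (norm (y :: 'a :: real_inner))\<^sup>2) / 2"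
proof -
  have "\<bar>x \<bullet> y\<bar> \<le> norm x * norm y" by (rule Cauchy_Schwarz_ineq2)
  also have "\<dots> \<le> ((norm x)\<^sup>2 + (norm y)\<^sup>2) / 2"
    using sum_squares_bound[of "norm x" "norm y"] by simp
  finally show ?thesis .
qed

lemma sq_integrable_add:
  assumes "sq_integrable M f" "sq_integrable M g"
  shows "sq_integrable M (\<lambda>x. f x + g x)"
proof -
  note [measurable] = sq_integrableD(1)[OF assms(1)] sq_integrableD(1)[OF assms(2)]
  have "integrable M (\<lambda>x. 2 * (norm (f x))\<^sup>2 + 2 * (norm (g x))\<^sup>2)"
    using assms by (simp add: sq_integrable_def)
  then have "integrable M (\<lambda>x. (norm (f x + g x))\<^sup>2)"
    by (rule Bochner_Integration.integrable_bound) (auto intro!: AE_I2 norm_add_sq_le)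
  then show ?thesis by (simp add: sq_integrable_def)
qed

lemma sq_integrable_scaleR:
  assumes "sq_integrable M f" shows "sq_integrable M (\<lambda>x. c *\<^sub>R f x)"
  using assms by (auto simp: sq_integrable_def power_mult_distrib)

lemma sq_integrable_diff:
  assumes "sq_integrable M f" "sq_integrable M g"
  shows "sq_integrable M (\<lambda>x. f x - g x)"
  using sq_integrable_add[OF assms(1) sq_integrable_scaleR[OF assms(2), of "-1"]] by simp

lemma sq_integrable_zero: "sq_integrable M (\<lambda>x. 0)"
  by (simp add: sq_integrable_def)

lemma sq_integrable_sum:
  assumes "\<And>i. i \<in> I \<Longrightarrow> sq_integrable M (f i)"
  shows "sq_integrable M (\<lambda>x. \<Sum>i\<in>I. f i x)"
  using assms by (induction I rule: infinite_finite_induct) (auto intro: sq_integrable_zero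
      sq_integrable_add)

lemma sq_integrable_bounded:
  assumes "finite_measure M" and [measurable]: "f \<in> borel_measurable M"
    and "\<And>x. x \<in> space M \<Longrightarrow> norm (f x) \<le> C"
  shows "sq_integrable M f"
proof -
  have "integrable M (\<lambda>x. (norm (f x))\<^sup>2)"
    using assms by (intro finite_measure.integrable_const_bound[where B
        = "C\<^sup>2"]) (auto intro!: AE_I2 power_mono)
  then show ?thesis by (simp add: sq_integrable_def)
qed

lemma integrable_inner_sq:
  assumes "sq_integrable M f" "sq_integrable M g"
  shows "integrable M (\<lambda>x. f x \<bullet> g x)"
proof -
  note [measurable] = sq_integrableD(1)[OF assms(1)] sq_integrableD(1)[OF assms(2)]
  have "integrable M (\<lambda>x. ((norm (f x))\<^sup>2 + (norm (g x))\<^sup>2) / 2)"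
    using assms by (simp add: sq_integrable_def)
  then show ?thesis
    by (rule Bochner_Integration.integrable_bound)
      (use abs_inner_le_sq in \<open>auto intro!: AE_I2 simp: abs_of_nonneg field_simps\<close>)
qed

lemma sq_integrable_integrable:
  assumes "finite_measure M" "sq_integrable M f"
  shows "integrable M f"
proof -
  note [measurable] = sq_integrableD(1)[OF assms(2)]
  have "integrable M (\<lambda>x. 1 + (norm (f x))\<^sup>2)"
    using assms by (intro Bochner_Integration.integrable_add finite_measure.integrable_const)
      (auto simp: sq_integrable_def)
  moreover have "norm y \<le> 1 + (norm y)\<^sup>2" for y :: 'b
    using zero_le_power2[of "norm y - 1 / 2"] by (simp add: power2_eq_square algebra_simps)
  then have "norm (f x) \<le> norm (1 + (norm (f x))\<^sup>2)" for x by (simp add: add_nonneg_nonneg)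
  ultimately show ?thesis
    by (intro Bochner_Integration.integrable_bound[of M "\<lambda>x. 1 + (norm (f x))\<^sup>2" f] AE_I2) simp_all
qed

lemma sq_integral_add:
  assumes "sq_integrable M f" "sq_integrable M g"
  shows "(\<integral>x. (norm (f x + g x))\<^sup>2 \<partial>M)
    = (\<integral>x. (norm (f x))\<^sup>2 \<partial>M) + 2 * (\<integral>x. f x \<bullet> g x \<partial>M) + (\<integral>x. (norm (g x))\<^sup>2 \<partial>M)"
proof -
  have "(norm (x + y))\<^sup>2 = (norm x)\<^sup>2 + 2 * (x \<bullet> y) + (norm y)\<^sup>2" for x y :: 'b
    by (simp add: power2_norm_eq_inner algebra_simps inner_commute)
  then show ?thesis
    using integrable_inner_sq[OF assms] assms by (simp add: sq_integrable_def)
qed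

lemma sq_integral_lincomb:
  assumes f: "sq_integrable M f" and g: "sq_integrable M g"
  shows "(\<integral>x. (norm (a *\<^sub>R f x + b *\<^sub>R g x))\<^sup>2 \<partial>M)
    = a\<^sup>2 * (\<integral>x. (norm (f x))\<^sup>2 \<partial>M) + 2 * a * b * (\<integral>x. f x \<bullet> g x \<partial>M) + b\<^sup>2 * (\<integral>x. (norm (g x))\<^sup>2 \<partial>M)"
  using sq_integral_add[OF sq_integrable_scaleR[OF f, of a] sq_integrable_scaleR[OF g, of b]]
  by (simp add: power_mult_distrib mult.assoc)

lemma sq_integral_eq_0_iff:
  assumes "sq_integrable M f"
  shows "(\<integral>x. (norm (f x))\<^sup>2 \<partial>M) = 0 \<longleftrightarrow> (AE x in M. f x = 0)"
  using integral_nonneg_eq_0_iff_AE[OF sq_integrableD(2)[OF assms]] by simp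

lemma Cauchy_Schwarz_sq_integrable:
  assumes f: "sq_integrable M f" and g: "sq_integrable M g"
  shows "\<bar>\<integral>x. f x \<bullet> g x \<partial>M\<bar> \<le> sqrt (\<integral>x. (norm (f x))\<^sup>2 \<partial>M) * sqrt (\<integral>x. (norm (g x))\<^sup>2 \<partial>M)"
proof -
  define A where "A = (\<integral>x. (norm (f x))\<^sup>2 \<partial>M)"
  define G where "G = (\<integral>x. (norm (g x))\<^sup>2 \<partial>M)"
  define H where "H = (\<integral>x. f x \<bullet> g x \<partial>M)"
  have "H\<^sup>2 \<le> A * G"
  proof (cases "G = 0")
    case True
    then have "AE x in M. g x = 0" using sq_integral_eq_0_iff[OF g] by (simp add: G_def)
    then have "AE x in M. f x \<bullet> g x = 0" by eventually_elim simp
    then have "H = 0" unfolding H_def by (rule integral_eq_zero_AE)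
    then show ?thesis using True by simp
  next
    case False
    then have G: "G > 0" by (simp add: G_def less_le)
    \<comment> \<open>\<open>G f - H g\<close> is \<open>G\<close> times the component of
      \<open>f\<close> orthogonal to \<open>g\<close>; the factor clears the denominator.\<close>
    have "0 \<le> (\<integral>x. (norm (G *\<^sub>R f x + (- H) *\<^sub>R g x))\<^sup>2 \<partial>M)" by simp
    also have "\<dots> = G * (A * G - H\<^sup>2)"
      unfolding sq_integral_lincomb[OF f g] A_def[symmetric] G_def[symmetric] H_def[symmetric]
      by (simp add: algebra_simps power2_eq_square)
    finally show ?thesis using G by (simp add: zero_le_mult_iff)
  qed
  then have "\<bar>H\<bar> \<le> sqrt (A * G)" by (metis real_sqrt_abs real_sqrt_le_iff)
  then show ?thesis by (simp add: real_sqrt_mult A_def G_def H_def)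
qed

section \<open>Mean square convergence\<close>

definition L2_lim :: "'a measure \<Rightarrow> (nat \<Rightarrow> 'a \<Rightarrow> 'b :: euclidean_space) \<Rightarrow> ('a \<Rightarrow> 'b) \<Rightarrow> bool" where
  "L2_lim M f g \<longleftrightarrow> (\<forall>j. sq_integrable M (f j)) \<and> sq_integrable M g \<and>
     (\<lambda>j. \<integral>x. (norm (f j x - g x))\<^sup>2 \<partial>M) \<longlonglongrightarrow> 0"

definition L2_Cauchy :: "'a measure \<Rightarrow> (nat \<Rightarrow> 'a \<Rightarrow> 'b :: euclidean_space) \<Rightarrow> bool" where
  "L2_Cauchy M f \<longleftrightarrow> (\<forall>j. sq_integrable M (f j)) \<and>
     (\<forall>e>0. \<exists>N. \<forall>j\<ge>N. \<forall>k\<ge>N. (\<integral>x. (norm (f j x - f k x))\<^sup>2 \<partial>M) < e)"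

lemma nn_integral_sq_eq_integral:
  assumes "sq_integrable M f"
  shows "(\<integral>\<^sup>+ x. ennreal ((norm (f x))\<^sup>2) \<partial>M) = ennreal (\<integral>x. (norm (f x))\<^sup>2 \<partial>M)"
  using assms by (intro nn_integral_eq_integral) (auto simp: sq_integrable_def)

text \<open>Extended distances tending to \<open>0\<close> are eventually finite; then
  \<open>g\<close> is a difference of two square integrable functions. Square integrability of the
  limit is thus a consequence and need not be supposed.\<close>

lemma L2_limI_nn_integral:
  assumes f: "\<And>j. sq_integrable M (f j)" and [measurable]: "g \<in> borel_measurable M"
    and lim: "(\<lambda>j. \<integral>\<^sup>+ x. ennreal ((norm (f j x - g x))\<^sup>2) \<partial>M) \<longlonglongrightarrow> 0"
  shows "L2_lim M f g"
proof -
  note [measurable] = sq_integrableD(1)[OF f]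
  have "eventually (\<lambda>j. (\<integral>\<^sup>+ x. ennreal ((norm (f j x - g x))\<^sup>2) \<partial>M) < 1) sequentially"
    using order_tendstoD(2)[OF lim, of 1] by simp
  then obtain N where N: "(\<integral>\<^sup>+ x. ennreal ((norm (f j x - g x))\<^sup>2) \<partial>M) < 1" if "j \<ge> N" for j
    by (auto simp: eventually_sequentially)
  have d: "sq_integrable M (\<lambda>x. f j x - g x)" if "j \<ge> N" for j
    using N[OF that] by (subst sq_integrable_iff_nn_integral) (auto intro: less_trans[of _ 1])
  have g: "sq_integrable M g" using sq_integrable_diff[OF f[of N] d[of N]] by simp
  have "(\<lambda>j. enn2real (\<integral>\<^sup>+ x. ennreal ((norm (f j x - g x))\<^sup>2) \<partial>M)) \<longlonglongrightarrow> 0"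
    using tendsto_enn2real[OF lim[unfolded ennreal_0[symmetric]]] by simp
  moreover have "enn2real (\<integral>\<^sup>+ x. ennreal ((norm (f j x - g x))\<^sup>2) \<partial>M)
      = (\<integral>x. (norm (f j x - g x))\<^sup>2 \<partial>M)" for j
    using nn_integral_sq_eq_integral[OF sq_integrable_diff[OF f g]] by simp
  ultimately show ?thesis using f g by (simp add: L2_lim_def)
qed

lemma L2_lim_nn_integral:
  assumes "L2_lim M f g"
  shows "(\<lambda>j. \<integral>\<^sup>+ x. ennreal ((norm (f j x - g x))\<^sup>2) \<partial>M) \<longlonglongrightarrow> 0"
proof -
  have "(\<lambda>j. ennreal (\<integral>x. (norm (f j x - g x))\<^sup>2 \<partial>M)) \<longlonglongrightarrow> ennreal 0"
    using assms by (intro tendsto_ennrealI) (simp add: L2_lim_def)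
  moreover have "(\<integral>\<^sup>+ x. ennreal ((norm (f j x - g x))\<^sup>2) \<partial>M)
      = ennreal (\<integral>x. (norm (f j x - g x))\<^sup>2 \<partial>M)" for j
    using assms by (intro nn_integral_sq_eq_integral sq_integrable_diff) (auto simp: L2_lim_def)
  ultimately show ?thesis by simp
qed

lemma L2_lim_const: "sq_integrable M f \<Longrightarrow> L2_lim M (\<lambda>_. f) f"
  by (simp add: L2_lim_def)

lemma L2_lim_subseq: "L2_lim M f g \<Longrightarrow> strict_mono r \<Longrightarrow> L2_lim M (\<lambda>j. f (r j)) g"
  using LIMSEQ_subseq_LIMSEQ[of "\<lambda>j. \<integral>x. (norm (f j x - g x))\<^sup>2 \<partial>M" 0 r]
      by (simp add: L2_lim_def comp_def)

lemma L2_lim_add: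
  assumes "L2_lim M f g" "L2_lim M f' g'"
  shows "L2_lim M (\<lambda>j x. f j x + f' j x) (\<lambda>x. g x + g' x)"
proof -
  have s: "\<And>j. sq_integrable M (f j)" "\<And>j. sq_integrable M (f' j)" "sq_integrable M g"
      "sq_integrable M g'"
    using assms by (auto simp: L2_lim_def)
  have "(\<lambda>j. 2 * (\<integral>x. (norm (f j x - g x))\<^sup>2 \<partial>M) + 2 * (\<integral>x. (norm (f' j x - g' x))\<^sup>2 \<partial>M))
      \<longlonglongrightarrow> 2 * 0 + 2 * 0"
    using assms by (intro tendsto_intros) (auto simp: L2_lim_def)
  then have z: "(\<lambda>j. 2 * (\<integral>x. (norm (f j x - g x))\<^sup>2 \<partial>M) + 2 * (\<integral>x. (norm (f' j x - g' x))\<^sup>2 \<partial>M)) \<longlonglongrightarrow> 0"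
      by simp
  have b: "(\<integral>x. (norm (f j x + f' j x - (g x + g' x)))\<^sup>2 \<partial>M)
    \<le> 2 * (\<integral>x. (norm (f j x - g x))\<^sup>2 \<partial>M) + 2 * (\<integral>x. (norm (f' j x - g' x))\<^sup>2 \<partial>M)" for j
  proof -
    have "sq_integrable M (\<lambda>x. f j x + f' j x - (g x + g' x))"
      by (intro sq_integrable_diff sq_integrable_add s)
    moreover have "sq_integrable M (\<lambda>x. f j x - g x)" "sq_integrable M (\<lambda>x. f' j x - g' x)"
      by (intro sq_integrable_diff s)+
    ultimately have "(\<integral>x. (norm (f j x + f' j x - (g x + g' x)))\<^sup>2 \<partial>M)
      \<le> (\<integral>x. 2 * (norm (f j x - g x))\<^sup>2 + 2 * (norm (f' j x - g' x))\<^sup>2 \<partial>M)"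
      using norm_add_sq_le[of "f j x - g x" "f' j x - g' x" for x]
      by (intro integral_mono) (auto simp: sq_integrable_def algebra_simps)
    also have "\<dots> = 2 * (\<integral>x. (norm (f j x - g x))\<^sup>2 \<partial>M) + 2 * (\<integral>x. (norm (f' j x - g' x))\<^sup>2 \<partial>M)"
      using s by (simp add: sq_integrableD(2)[OF sq_integrable_diff])
    finally show ?thesis .
  qed
  have "(\<lambda>j. \<integral>x. (norm (f j x + f' j x - (g x + g' x)))\<^sup>2 \<partial>M) \<longlonglongrightarrow> 0"
    by (rule tendsto_sandwich[OF _ _ tendsto_const z]) (auto intro: always_eventually b)
  then show ?thesis using s by (simp add: L2_lim_def sq_integrable_add)
qed

lemma L2_lim_scaleR:
  assumes "L2_lim M f g"
  shows "L2_lim M (\<lambda>j x. c *\<^sub>R f j x) (\<lambda>x. c *\<^sub>R g x)"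
proof -
  have "(\<lambda>j. c\<^sup>2 * (\<integral>x. (norm (f j x - g x))\<^sup>2 \<partial>M)) \<longlonglongrightarrow> c\<^sup>2 * 0"
    using assms by (intro tendsto_intros) (auto simp: L2_lim_def)
  then show ?thesis
    using assms unfolding L2_lim_def
    by (simp add: sq_integrable_scaleR scaleR_diff_right[symmetric] power_mult_distrib)
qed

lemma L2_lim_diff:
  assumes "L2_lim M f g" "L2_lim M f' g'"
  shows "L2_lim M (\<lambda>j x. f j x - f' j x) (\<lambda>x. g x - g' x)"
  using L2_lim_add[OF assms(1) L2_lim_scaleR[OF assms(2), of "-1"]] by simp

text \<open>Continuity of the inner product: expanded around the limits, the difference is a sum of
  three terms, each with a factor tending to \<open>0\<close>. Through this lemma the isometry and
  the martingale property pass from simple integrals to general ones.\<close>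

lemma L2_lim_inner:
  assumes "L2_lim M f g" "L2_lim M f' g'"
  shows "(\<lambda>j. \<integral>x. f j x \<bullet> f' j x \<partial>M) \<longlonglongrightarrow> (\<integral>x. g x \<bullet> g' x \<partial>M)"
proof -
  have s: "\<And>j. sq_integrable M (f j)" "\<And>j. sq_integrable M (f' j)" "sq_integrable M g"
      "sq_integrable M g'"
    and l: "(\<lambda>j. \<integral>x. (norm (f j x - g x))\<^sup>2 \<partial>M) \<longlonglongrightarrow> 0" "(\<lambda>j. \<integral>x. (norm (f' j x - g' x))\<^sup>2 \<partial>M) \<longlonglongrightarrow> 0"
    using assms by (auto simp: L2_lim_def)
  define n where "n h = sqrt (\<integral>x. (norm (h x))\<^sup>2 \<partial>M)" for h :: "'a \<Rightarrow> 'b"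
  have eq: "(\<integral>x. f j x \<bullet> f' j x \<partial>M) - (\<integral>x. g x \<bullet> g' x \<partial>M)
      = (\<integral>x. (f j x - g x) \<bullet> (f' j x - g' x) \<partial>M) + (\<integral>x. (f j x - g x) \<bullet> g' x \<partial>M)
          + (\<integral>x. g x \<bullet> (f' j x - g' x) \<partial>M)" for j
  proof -
    have i: "integrable M (\<lambda>x. (f j x - g x) \<bullet> (f' j x - g' x))" "integrable M (\<lambda>x. (f j x
        - g x) \<bullet> g' x)"
      "integrable M (\<lambda>x. g x \<bullet> (f' j x
          - g' x))" "integrable M (\<lambda>x. f j x \<bullet> f' j x)" "integrable M (\<lambda>x. g x \<bullet> g' x)"
      by (intro integrable_inner_sq sq_integrable_diff s)+
    show ?thesis
      unfolding Bochner_Integration.integral_add[OF i(1,2), symmetric]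
        Bochner_Integration.integral_add[OF Bochner_Integration.integrable_add[OF i(1,2)] i(3),
            symmetric]
        Bochner_Integration.integral_diff[OF i(4,5), symmetric]
      by (intro Bochner_Integration.integral_cong) (auto simp: algebra_simps)
  qed
  have bound: "\<bar>(\<integral>x. f j x \<bullet> f' j x \<partial>M) - (\<integral>x. g x \<bullet> g' x \<partial>M)\<bar>
      \<le> n (\<lambda>x. f j x - g x) * n (\<lambda>x. f' j x - g' x) + n (\<lambda>x. f j x - g x) * n g'
          + n g * n (\<lambda>x. f' j x - g' x)" for j
    unfolding eq n_def
    by (intro order_trans[OF abs_triangle_ineq] add_mono Cauchy_Schwarz_sq_integrable
        sq_integrable_diff s)
  have n0: "(\<lambda>j. n (\<lambda>x. f j x - g x)) \<longlonglongrightarrow> 0" "(\<lambda>j. n (\<lambda>x. f' j x - g' x)) \<longlonglongrightarrow> 0"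
    using tendsto_real_sqrt[OF l(1)] tendsto_real_sqrt[OF l(2)] by (simp_all add: n_def)
  have "(\<lambda>j. n (\<lambda>x. f j x - g x) * n (\<lambda>x. f' j x - g' x) + n (\<lambda>x. f j x - g x) * n g'
      + n g * n (\<lambda>x. f' j x - g' x))
      \<longlonglongrightarrow> 0 * 0 + 0 * n g' + n g * 0"
    by (intro tendsto_intros n0)
  then have z: "(\<lambda>j. n (\<lambda>x. f j x - g x) * n (\<lambda>x. f' j x - g' x) + n (\<lambda>x. f j x - g x) * n g'
      + n g * n (\<lambda>x. f' j x - g' x))
      \<longlonglongrightarrow> 0" by simp
  have "(\<lambda>j. (\<integral>x. f j x \<bullet> f' j x \<partial>M) - (\<integral>x. g x \<bullet> g' x \<partial>M)) \<longlonglongrightarrow> 0"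
    by (rule Lim_null_comparison[OF always_eventually z]) (simp add: bound)
  then show ?thesis by (simp add: LIM_zero_iff)
qed

lemma L2_lim_Cauchy:
  assumes "L2_lim M f g" shows "L2_Cauchy M f"
proof -
  have s: "\<And>j. sq_integrable M (f j)" "sq_integrable M g"
    and l: "(\<lambda>j. \<integral>x. (norm (f j x - g x))\<^sup>2 \<partial>M) \<longlonglongrightarrow> 0"
    using assms by (auto simp: L2_lim_def)
  have b: "(\<integral>x. (norm (f j x - f k x))\<^sup>2 \<partial>M)
    \<le> 2 * (\<integral>x. (norm (f j x - g x))\<^sup>2 \<partial>M) + 2 * (\<integral>x. (norm (f k x - g x))\<^sup>2 \<partial>M)" for j k
  proof -
    have sq: "sq_integrable M (\<lambda>x. f j x - f k x)" "sq_integrable M (\<lambda>x. f j x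
        - g x)" "sq_integrable M (\<lambda>x. f k x - g x)"
      by (intro sq_integrable_diff s)+
    then have "(\<integral>x. (norm (f j x - f k x))\<^sup>2 \<partial>M)
      \<le> (\<integral>x. 2 * (norm (f j x - g x))\<^sup>2 + 2 * (norm (f k x - g x))\<^sup>2 \<partial>M)"
      using norm_add_sq_le[of "f j x - g x" "g x - f k x" for x]
      by (intro integral_mono) (auto simp: sq_integrable_def algebra_simps norm_minus_commute)
    also have "\<dots> = 2 * (\<integral>x. (norm (f j x - g x))\<^sup>2 \<partial>M) + 2 * (\<integral>x. (norm (f k x - g x))\<^sup>2 \<partial>M)"
      using sq by (simp add: sq_integrable_def)
    finally show ?thesis .
  qed
  have "\<exists>N. \<forall>j\<ge>N. \<forall>k\<ge>N. (\<integral>x. (norm (f j x - f k x))\<^sup>2 \<partial>M) < e" if "e > 0" for e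
  proof -
    obtain N where N: "\<And>j. j \<ge> N \<Longrightarrow> (\<integral>x. (norm (f j x - g x))\<^sup>2 \<partial>M) < e / 4"
      using order_tendstoD(2)[OF l, of "e / 4"] \<open>e > 0\<close> by (auto simp: eventually_sequentially)
    show ?thesis
    proof (intro exI[of _ N] allI impI)
      fix j k assume "j \<ge> N" "k \<ge> N"
      then show "(\<integral>x. (norm (f j x - f k x))\<^sup>2 \<partial>M) < e" using b[of j k] N[of j] N[of k] by linarith
    qed
  qed
  then show ?thesis using s by (simp add: L2_Cauchy_def)
qed

text \<open>Fatou's lemma in the second index: the distance of \<open>f j\<close> from
  \<open>g\<close> is at most the lower limit over \<open>k\<close> of its distances from
  \<open>f k\<close>, which the Cauchy property bounds.\<close>

lemma L2_lim_Cauchy_AE: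
  assumes f: "L2_Cauchy M f" and [measurable]: "g \<in> borel_measurable M"
    and ae: "AE x in M. (\<lambda>j. f j x) \<longlonglongrightarrow> g x"
  shows "L2_lim M f g"
proof (rule L2_limI_nn_integral)
  show s: "sq_integrable M (f j)" for j using f by (simp add: L2_Cauchy_def)
  note [measurable] = sq_integrableD(1)[OF s]
  show "(\<lambda>j. \<integral>\<^sup>+ x. ennreal ((norm (f j x - g x))\<^sup>2) \<partial>M) \<longlonglongrightarrow> 0"
  proof (rule order_tendstoI)
    fix e :: ennreal assume "0 < e"
    \<comment> \<open>The Cauchy condition asks for a real bound, whereas \<open>e\<close> may be
      infinite.\<close>
    then obtain e' where e': "0 < e'" "ennreal e' < e"
    proof (cases e)
      case (real r)
      with \<open>0 < e\<close> show ?thesis by (intro that[of "r / 2"]) (auto simp: ennreal_lessI)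
    next
      case top
      then show ?thesis by (intro that[of 1]) auto
    qed
    then obtain N where N: "\<And>j k. j \<ge> N \<Longrightarrow> k \<ge> N \<Longrightarrow> (\<integral>x. (norm (f j x - f k x))\<^sup>2 \<partial>M) < e'"
      using f unfolding L2_Cauchy_def using e'(1) by meson
    have "(\<integral>\<^sup>+ x. ennreal ((norm (f j x - g x))\<^sup>2) \<partial>M) \<le> ennreal e'" if j: "j \<ge> N" for j
    proof -
      have "(\<integral>\<^sup>+ x. ennreal ((norm (f j x - g x))\<^sup>2) \<partial>M)
          = (\<integral>\<^sup>+ x. liminf (\<lambda>k. ennreal ((norm (f j x - f k x))\<^sup>2)) \<partial>M)"
      proof (rule nn_integral_cong_AE)
        show "AE x in M. ennreal ((norm (f j x - g x))\<^sup>2)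
            = liminf (\<lambda>k. ennreal ((norm (f j x - f k x))\<^sup>2))"
          using ae
        proof eventually_elim
          case (elim x)
          then have "(\<lambda>k. ennreal ((norm (f j x - f k x))\<^sup>2)) \<longlonglongrightarrow> ennreal ((norm (f j x - g x))\<^sup>2)"
            by (intro tendsto_intros)
          then show ?case using lim_imp_Liminf[OF trivial_limit_sequentially] by metis
        qed
      qed
      also have "\<dots> \<le> liminf (\<lambda>k. \<integral>\<^sup>+ x. ennreal ((norm (f j x - f k x))\<^sup>2) \<partial>M)"
        by (rule nn_integral_liminf) simp
      also have "\<dots> \<le> ennreal e'"
      proof (rule Liminf_le)
        show "eventually (\<lambda>k. (\<integral>\<^sup>+ x. ennreal ((norm (f j x - f k x))\<^sup>2) \<partial>M)
            \<le> ennreal e') sequentially"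
          using N[OF j] unfolding eventually_sequentially nn_integral_sq_eq_integral[OF
              sq_integrable_diff[OF s s]]
          by (intro exI[of _ N] allI impI ennreal_leI less_imp_le)
      qed simp
      finally show ?thesis .
    qed
    then show "eventually (\<lambda>j. (\<integral>\<^sup>+ x. ennreal ((norm (f j x - g x))\<^sup>2) \<partial>M) < e) sequentially"
      using e'(2) by (auto simp: eventually_sequentially intro: le_less_trans)
  qed simp
qed simp

text \<open>The rate is dictated by the stochastic integral: with thresholds
  \<open>(1 / 2) ^ j\<close> the maximal inequality turns second moments \<open>(1 / 8) ^ j\<close>
  into probabilities \<open>(1 / 2) ^ j\<close>, and both the thresholds and the probabilities are
  summable. The same rate serves for almost everywhere convergence.\<close>

lemma L2_Cauchy_rapid_subseq:
  assumes "L2_Cauchy M f"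
  obtains r where "strict_mono r"
    "\<And>j. (\<integral>x. (norm (f (r (Suc j)) x - f (r j) x))\<^sup>2 \<partial>M) \<le> (1 / 8) ^ j"
proof -
  define P where "P n N \<longleftrightarrow> (\<forall>j\<ge>N. \<forall>k\<ge>N. (\<integral>x. (norm (f j x - f k x))\<^sup>2 \<partial>M) < (1 / 8) ^ n)" for n N
  have ex: "\<exists>N. P n N" for n using assms unfolding L2_Cauchy_def P_def by simp
  have mono: "P n N'" if "P n N" "N \<le> N'" for n N N' using that by (auto simp: P_def)
  have "\<exists>N'. P (Suc n) N' \<and> N < N'" for n N
  proof -
    obtain K where "P (Suc n) K" using ex by blast
    then have "P (Suc n) (max K (Suc N))" by (rule mono) simp
    then show ?thesis by (intro exI[of _ "max K (Suc N)"]) auto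
  qed
  then obtain r where r: "\<And>n. P n (r n)" "\<And>n. r n < r (Suc n)"
    using dependent_nat_choice[of P "\<lambda>_ N N'. N < N'"] ex by metis
  have "strict_mono r" using r(2) by (simp add: strict_mono_Suc_iff)
  moreover have "(\<integral>x. (norm (f (r (Suc j)) x - f (r j) x))\<^sup>2 \<partial>M) \<le> (1 / 8) ^ j" for j
    using r(1)[of j] r(2)[of j] unfolding P_def by (simp add: less_imp_le)
  ultimately show ?thesis by (rule that)
qed

text \<open>By AM-GM, \<open>2 |d\<^sub>j| \<le> 2\<^sup>j |d\<^sub>j|\<^sup>2 + 2\<^sup>-\<^sup>j\<close> for the increments \<open>d\<^sub>j\<close>, so that \<open>\<Sum>\<^sub>j |d\<^sub>j|\<close> is integrable.\<close>

lemma AE_convergent_rapid: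
  assumes M: "finite_measure M" and f: "\<And>j. sq_integrable M (f j)"
    and rapid: "\<And>j. (\<integral>x. (norm (f (Suc j) x - f j x))\<^sup>2 \<partial>M) \<le> (1 / 8) ^ j"
  shows "AE x in M. convergent (\<lambda>j. f j x)"
proof -
  interpret finite_measure M by (rule M)
  note [measurable] = sq_integrableD(1)[OF f]
  define d where "d j x = norm (f (Suc j) x - f j x)" for j x
  have [measurable]: "d j \<in> borel_measurable M" for j unfolding d_def by simp
  have sq: "integrable M (\<lambda>x. (d j x)\<^sup>2)" for j
    unfolding d_def by (intro sq_integrableD sq_integrable_diff f)
  have bnd: "(\<integral>\<^sup>+ x. ennreal (d j x) \<partial>M) \<le> ennreal ((1 + measure M (space M)) * (1 / 2) ^ j)" for j
  proof -
    have "d j x \<le> 2 ^ j * (d j x)\<^sup>2 + (1 / 2) ^ j" for x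
    proof -
      have "2 * (2 ^ j * d j x) * 1 \<le> (2 ^ j * d j x)\<^sup>2 + 1\<^sup>2" by (rule sum_squares_bound)
      moreover have "0 \<le> 2 ^ j * d j x" by (simp add: d_def)
      ultimately have "2 ^ j * d j x \<le> (2 ^ j * d j x)\<^sup>2 + 1" unfolding mult_1_right one_power2
          by linarith
      then have "(1 / 2) ^ j * (2 ^ j * d j x) \<le> (1 / 2) ^ j * ((2 ^ j * d j x)\<^sup>2 + 1)"
        by (intro mult_left_mono) auto
      then show ?thesis by (simp add: power_one_over power2_eq_square field_simps)
    qed
    then have "(\<integral>\<^sup>+ x. ennreal (d j x) \<partial>M) \<le> (\<integral>\<^sup>+ x. ennreal (2 ^ j * (d j x)\<^sup>2 + (1 / 2) ^ j) \<partial>M)"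
      by (intro nn_integral_mono ennreal_leI)
    also have "\<dots> = ennreal (\<integral>x. 2 ^ j * (d j x)\<^sup>2 + (1 / 2) ^ j \<partial>M)"
      using sq by (intro nn_integral_eq_integral) auto
    also have "(\<integral>x. 2 ^ j * (d j x)\<^sup>2 + (1 / 2) ^ j \<partial>M)
        = 2 ^ j * (\<integral>x. (d j x)\<^sup>2 \<partial>M) + (1 / 2) ^ j * measure M (space M)"
      using sq by simp
    also have "\<dots> \<le> 2 ^ j * (1 / 8) ^ j + (1 / 2) ^ j * measure M (space M)"
      using rapid[of j] by (simp add: d_def)
    also have "2 ^ j * (1 / 8 :: real) ^ j = (1 / 4) ^ j"
        by (simp add: power_mult_distrib[symmetric])
    also have "(1 / 4 :: real) ^ j \<le> (1 / 2) ^ j" by (intro power_mono) auto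
    finally show ?thesis by (simp add: algebra_simps ennreal_leI)
  qed
  have "(\<integral>\<^sup>+ x. (\<Sum>j. ennreal (d j x)) \<partial>M) = (\<Sum>j. \<integral>\<^sup>+ x. ennreal (d j x) \<partial>M)"
    by (rule nn_integral_suminf) simp
  also have "\<dots> \<le> (\<Sum>j. ennreal ((1 + measure M (space M)) * (1 / 2) ^ j))"
    by (intro suminf_le bnd) auto
  also have "\<dots> = ennreal (\<Sum>j. (1 + measure M (space M)) * (1 / 2) ^ j)"
    by (intro suminf_ennreal2) (auto intro!: summable_mult summable_geometric)
  also have "\<dots> < \<infinity>" by simp
  finally have "AE x in M. (\<Sum>j. ennreal (d j x)) \<noteq> \<infinity>"
    by (intro nn_integral_PInf_AE) auto
  then show ?thesis
  proof eventually_elim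
    case (elim x)
    then have "summable (\<lambda>j. norm (f (Suc j) x - f j x))"
      using summable_suminf_not_top[of "\<lambda>j. d j x"] by (simp add: d_def)
    then have "summable (\<lambda>j. f (Suc j) x - f j x)" by (rule summable_norm_cancel)
    then have "(\<lambda>n. (\<Sum>j<n. f (Suc j) x - f j x) + f 0 x) \<longlonglongrightarrow> (\<Sum>j. f (Suc j) x - f j x) + f 0 x"
      by (intro tendsto_add summable_LIMSEQ tendsto_const)
    then show ?case by (auto simp: sum_lessThan_telescope[of "\<lambda>j. f j x"] convergent_def)
  qed
qed

section \<open>The spaces of adapted processes\<close>

lemma vec_sq_eq: "vec_sq = (\<lambda>x. (norm x)\<^sup>2)"
  by (simp add: vec_sq_def fun_eq_iff)

lemma norm_matrix_sq: "(norm (A :: real ^ 'm ^ 'n))\<^sup>2 = (\<Sum>i\<in>UNIV. \<Sum>j\<in>UNIV. (A $ i $ j)\<^sup>2)"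
  unfolding power2_norm_eq_inner by (simp add: inner_vec_def power2_eq_square)

text \<open>The trace is the squared Frobenius norm, which is the Euclidean norm of
  \<open>real ^ 'm ^ 'n\<close>. Vector and matrix processes are therefore both covered by one
  theory with \<open>q\<close> the squared norm of a Euclidean space.\<close>

lemma mat_sq_eq: "mat_sq = (\<lambda>A. (norm A)\<^sup>2)"
proof
  fix A :: "real ^ 'm ^ 'n"
  have "mat_sq A = (\<Sum>j\<in>UNIV. \<Sum>i\<in>UNIV. (A $ i $ j)\<^sup>2)"
    by (simp add: mat_sq_def trace_def matrix_matrix_mult_def transpose_def power2_eq_square)
  also have "\<dots> = (norm A)\<^sup>2" unfolding norm_matrix_sq by (rule sum.swap)
  finally show "mat_sq A = (norm A)\<^sup>2" .
qed

section \<open>Adapted processes as functions on the product of the time interval and the sample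
  space\<close>

abbreviation time_prod :: "'w measure \<Rightarrow> real \<Rightarrow> (real \<times> 'w) measure" where
  "time_prod P T \<equiv> restrict_space lborel {0..T} \<Otimes>\<^sub>M P"

lemma finite_measure_time: "finite_measure (restrict_space lborel {0..T :: real})"
proof (rule finite_measureI)
  have "emeasure (restrict_space lborel {0..T}) {0..T} = emeasure lborel {0..T}"
    by (rule emeasure_restrict_space) auto
  then show "emeasure (restrict_space lborel {0..T}) (space (restrict_space lborel {0..T})) \<noteq> \<infinity>"
    using emeasure_lborel_cbox_finite[of 0 T] by (simp add: space_restrict_space)
qed

context filtered_prob_space begin

lemma pair_sigma_finite_time: "pair_sigma_finite (restrict_space lborel {0..T :: real}) P"
  unfolding pair_sigma_finite_def
  using finite_measure_time sigma_finite_measure_axioms by (auto simp: finite_measure_def)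

lemma finite_measure_time_prod: "finite_measure (time_prod P T)"
  using finite_measure_pair_measure[OF finite_measure_axioms finite_measure_time] .

text \<open>Tonelli's theorem in the order of \<open>expect_int\<close>, with the time integral
  inside.\<close>

lemma nn_integral_time_prod:
  assumes "f \<in> borel_measurable (time_prod P T)"
  shows "(\<integral>\<^sup>+ p. f p \<partial>time_prod P T) = (\<integral>\<^sup>+ \<omega>. (\<integral>\<^sup>+ t\<in>{0..T}. f (t, \<omega>) \<partial>lborel) \<partial>P)"
proof -
  interpret pair_sigma_finite "restrict_space lborel {0..T}" P by (rule pair_sigma_finite_time)
  show ?thesis
    unfolding nn_integral_snd[OF assms, symmetric]
    by (intro nn_integral_cong) (simp add: nn_integral_restrict_space)
qed

lemma expect_int_eq:
  assumes "(\<lambda>(t, \<omega>). f t \<omega>) \<in> borel_measurable (time_prod P T)"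
  shows "expect_int P T f = (\<integral>\<^sup>+ p. ennreal (case_prod f p) \<partial>time_prod P T)"
  using assms by (subst nn_integral_time_prod) (simp_all add: expect_int_def)

lemma expect_int_sq:
  fixes v :: "real \<Rightarrow> 'w \<Rightarrow> 'b :: euclidean_space"
  assumes [measurable]: "case_prod v \<in> borel_measurable (time_prod P T)"
  shows "expect_int P T (\<lambda>t \<omega>. (norm (v t \<omega>))\<^sup>2)
    = (\<integral>\<^sup>+ p. ennreal ((norm (case_prod v p))\<^sup>2) \<partial>time_prod P T)"
proof -
  have "(\<lambda>p. (norm (case_prod v p))\<^sup>2) \<in> borel_measurable (time_prod P T)" by measurable
  then show ?thesis by (subst expect_int_eq) (auto simp: case_prod_beta' intro!: nn_integral_cong)
qed

text \<open>The working description of \<open>L2a\<close>: square integrability on the product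
  space, plus adaptedness at each time of the interval.\<close>

lemma L2a_iff:
  fixes v :: "real \<Rightarrow> 'w \<Rightarrow> 'b :: euclidean_space"
  shows "v \<in> L2a P F T (\<lambda>x. (norm x)\<^sup>2) \<longleftrightarrow>
    sq_integrable (time_prod P T) (case_prod v) \<and> (\<forall>t\<in>{0..T}. v t \<in> borel_measurable (F t))"
proof (cases "case_prod v \<in> borel_measurable (time_prod P T)")
  case True
  then show ?thesis by (simp add: L2a_def expect_int_sq sq_integrable_iff_nn_integral conj_commute)
next
  case False
  then show ?thesis by (simp add: L2a_def sq_integrable_def)
qed

lemma expect_int_L2a:
  fixes v :: "real \<Rightarrow> 'w \<Rightarrow> 'b :: euclidean_space"
  assumes "v \<in> L2a P F T (\<lambda>x. (norm x)\<^sup>2)"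
  shows "enn2real (expect_int P T (\<lambda>t \<omega>. (norm (v t \<omega>))\<^sup>2))
      = (\<integral>p. (norm (case_prod v p))\<^sup>2 \<partial>time_prod P T)"
  using assms by (simp add: L2a_iff expect_int_sq sq_integrableD(1) nn_integral_sq_eq_integral)

lemma L2a_zero: "(\<lambda>t \<omega>. 0 :: 'b :: euclidean_space) \<in> L2a P F T (\<lambda>x. (norm x)\<^sup>2)"
  using sq_integrable_zero[of "time_prod P T"] by (simp add: L2a_iff case_prod_beta')

lemma L2a_add:
  fixes v w :: "real \<Rightarrow> 'w \<Rightarrow> 'b :: euclidean_space"
  assumes "v \<in> L2a P F T (\<lambda>x. (norm x)\<^sup>2)" "w \<in> L2a P F T (\<lambda>x. (norm x)\<^sup>2)"
  shows "(\<lambda>t \<omega>. v t \<omega> + w t \<omega>) \<in> L2a P F T (\<lambda>x. (norm x)\<^sup>2)"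
  using assms sq_integrable_add[of "time_prod P T" "case_prod v" "case_prod w"]
  by (auto simp: L2a_iff case_prod_beta' intro!: borel_measurable_add)

lemma L2a_scaleR:
  fixes v :: "real \<Rightarrow> 'w \<Rightarrow> 'b :: euclidean_space"
  assumes "v \<in> L2a P F T (\<lambda>x. (norm x)\<^sup>2)"
  shows "(\<lambda>t \<omega>. c *\<^sub>R v t \<omega>) \<in> L2a P F T (\<lambda>x. (norm x)\<^sup>2)"
  using assms sq_integrable_scaleR[of "time_prod P T" "case_prod v" c]
  by (auto simp: L2a_iff case_prod_beta' intro!: borel_measurable_scaleR)

lemma L2a_rel_iff:
  fixes v w :: "real \<Rightarrow> 'w \<Rightarrow> 'b :: euclidean_space"
  shows "(v, w) \<in> L2a_rel P F T q \<longleftrightarrow> v \<in> L2a P F T q \<and> w \<in> L2a P F T q \<and>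
    (AE p in time_prod P T. case_prod v p = case_prod w p)"
  by (simp add: L2a_rel_def case_prod_beta')

sublocale L2a: process_quotient "L2a P F T (\<lambda>x. (norm x)\<^sup>2)"
  "L2a_rel P F T (\<lambda>x :: 'b :: euclidean_space. (norm x)\<^sup>2)" for T
proof
  let ?S = "L2a P F T (\<lambda>x :: 'b. (norm x)\<^sup>2)" and ?R = "L2a_rel P F T (\<lambda>x :: 'b. (norm x)\<^sup>2)"
  show "(\<lambda>t \<omega>. 0) \<in> ?S" by (rule L2a_zero)
  show "(\<lambda>t \<omega>. x t \<omega> + y t \<omega>) \<in> ?S" if "x \<in> ?S" "y \<in> ?S" for x y using that by (rule L2a_add)
  show "(\<lambda>t \<omega>. c *\<^sub>R x t \<omega>) \<in> ?S" if "x \<in> ?S" for x c using that by (rule L2a_scaleR)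
  show "equiv ?S ?R"
  proof (rule equivI)
    show "refl_on ?S ?R" by (auto simp: refl_on_def L2a_rel_iff)
    show "?R \<subseteq> ?S \<times> ?S" by (auto simp: L2a_rel_iff)
    show "sym ?R" unfolding sym_def L2a_rel_iff by (auto elim!: eventually_mono)
    show "trans ?R"
    proof (rule transI)
      fix x y z assume xy: "(x, y) \<in> ?R" and yz: "(y, z) \<in> ?R"
      have "AE p in time_prod P T. case_prod x p = case_prod y p"
        "AE p in time_prod P T. case_prod y p = case_prod z p"
        using xy yz unfolding L2a_rel_iff by blast+
      then have "AE p in time_prod P T. case_prod x p = case_prod z p" by eventually_elim simp
      then show "(x, z) \<in> ?R" using xy yz unfolding L2a_rel_iff by blast
    qed
  qed
  show "(\<lambda>t \<omega>. x t \<omega> + y t \<omega>, \<lambda>t \<omega>. x' t \<omega> + y' t \<omega>) \<in> ?R"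
    if xx: "(x, x') \<in> ?R" and yy: "(y, y') \<in> ?R" for x x' y y'
  proof -
    have "AE p in time_prod P T. case_prod x p = case_prod x' p"
      "AE p in time_prod P T. case_prod y p = case_prod y' p"
      using xx yy unfolding L2a_rel_iff by blast+
    then have "AE p in time_prod P T.
        case_prod (\<lambda>t \<omega>. x t \<omega> + y t \<omega>) p = case_prod (\<lambda>t \<omega>. x' t \<omega> + y' t \<omega>) p"
      by eventually_elim (auto simp: case_prod_beta')
    then show ?thesis using xx yy L2a_add unfolding L2a_rel_iff by blast
  qed
  show "(\<lambda>t \<omega>. c *\<^sub>R x t \<omega>, \<lambda>t \<omega>. c *\<^sub>R x' t \<omega>) \<in> ?R" if xx: "(x, x') \<in> ?R" for x x' c
  proof -
    have "AE p in time_prod P T. case_prod x p = case_prod x' p"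
      using xx unfolding L2a_rel_iff by blast
    then have "AE p in time_prod P T.
        case_prod (\<lambda>t \<omega>. c *\<^sub>R x t \<omega>) p = case_prod (\<lambda>t \<omega>. c *\<^sub>R x' t \<omega>) p"
      by eventually_elim (auto simp: case_prod_beta')
    then show ?thesis using xx L2a_scaleR unfolding L2a_rel_iff by blast
  qed
qed

lemma L2a_inner_cong:
  fixes v w v' w' :: "real \<Rightarrow> 'w \<Rightarrow> 'b :: euclidean_space"
  assumes "(v, v') \<in> L2a_rel P F T (\<lambda>x. (norm x)\<^sup>2)" "(w, w') \<in> L2a_rel P F T (\<lambda>x. (norm x)\<^sup>2)"
  shows "(\<integral>p. case_prod v p \<bullet> case_prod w p \<partial>time_prod P T)
    = (\<integral>p. case_prod v' p \<bullet> case_prod w' p \<partial>time_prod P T)"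
proof -
  have [measurable]: "case_prod v \<in> borel_measurable (time_prod P T)" "case_prod w
      \<in> borel_measurable (time_prod P T)"
    "case_prod v' \<in> borel_measurable (time_prod P T)" "case_prod w'
        \<in> borel_measurable (time_prod P T)"
    using assms unfolding L2a_rel_iff L2a_iff sq_integrable_def by blast+
  have "AE p in time_prod P T. case_prod v p = case_prod v' p"
    "AE p in time_prod P T. case_prod w p = case_prod w' p"
    using assms unfolding L2a_rel_iff by blast+
  then have "AE p in time_prod P T. case_prod v p \<bullet> case_prod w p = case_prod v' p \<bullet> case_prod w' p"
    by eventually_elim simp
  then show ?thesis by (intro integral_cong_AE borel_measurable_inner) simp_all
qed

text \<open>All members of a class have the same square integral, so the \<open>THE\<close> can be
  evaluated at any of them.\<close>

lemma L2a_norm_class: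
  fixes v :: "real \<Rightarrow> 'w \<Rightarrow> 'b :: euclidean_space"
  assumes v: "v \<in> L2a P F T (\<lambda>x. (norm x)\<^sup>2)"
  shows "L2a_norm P T (\<lambda>x. (norm x)\<^sup>2) (L2a_rel P F T (\<lambda>x. (norm x)\<^sup>2) `` {v})
    = sqrt (\<integral>p. (norm (case_prod v p))\<^sup>2 \<partial>time_prod P T)"
proof -
  have eq: "sqrt (enn2real (expect_int P T (\<lambda>t \<omega>. (norm (w t \<omega>))\<^sup>2)))
      = sqrt (\<integral>p. (norm (case_prod v p))\<^sup>2 \<partial>time_prod P T)"
    if "(v, w) \<in> L2a_rel P F T (\<lambda>x. (norm x)\<^sup>2)" for w
  proof -
    have "w \<in> L2a P F T (\<lambda>x. (norm x)\<^sup>2)" using that by (simp add: L2a_rel_iff)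
    from expect_int_L2a[OF this] show ?thesis using L2a_inner_cong[OF that that]
        by (simp add: power2_norm_eq_inner)
  qed
  show ?thesis
    unfolding L2a_norm_def
    by (rule the_equality) (use eq L2a.rel_refl[OF v] in auto)
qed

text \<open>The representatives of a Cauchy sequence converge almost everywhere along a subsequence, and
  the pointwise limit (\<^const>\<open>lim\<close>, hence total) is again adapted at every time.\<close>

lemma L2a_complete:
  fixes x :: "nat \<Rightarrow> real \<Rightarrow> 'w \<Rightarrow> 'b :: euclidean_space"
  assumes x: "\<And>n. x n \<in> L2a P F T (\<lambda>x. (norm x)\<^sup>2)"
    and C: "L2_Cauchy (time_prod P T) (\<lambda>n. case_prod (x n))"
  shows "\<exists>v\<in>L2a P F T (\<lambda>x. (norm x)\<^sup>2). \<exists>r. strict_mono r \<and>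
    L2_lim (time_prod P T) (\<lambda>n. case_prod (x (r n))) (case_prod v)"
proof -
  have sq: "sq_integrable (time_prod P T) (case_prod (x n))"
      and ad: "\<And>t. t \<in> {0..T} \<Longrightarrow> x n t \<in> borel_measurable (F t)" for n
    using x[of n] by (simp_all add: L2a_iff)
  obtain r where r: "strict_mono r"
    and rapid: "\<And>j. (\<integral>p. (norm (case_prod (x (r (Suc j))) p
        - case_prod (x (r j)) p))\<^sup>2 \<partial>time_prod P T) \<le> (1 / 8) ^ j"
    using L2_Cauchy_rapid_subseq[OF C] by blast
  define v where "v = (\<lambda>t \<omega>. lim (\<lambda>n. x (r n) t \<omega>))"
  have v_eq: "case_prod v = (\<lambda>p. lim (\<lambda>n. case_prod (x (r n)) p))" by (auto simp: v_def)
  have [measurable]: "case_prod (x n) \<in> borel_measurable (time_prod P T)" for n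
      by (rule sq_integrableD[OF sq])
  have "AE p in time_prod P T. convergent (\<lambda>n. case_prod (x (r n)) p)"
    by (rule AE_convergent_rapid[OF finite_measure_time_prod sq rapid])
  then have ae: "AE p in time_prod P T. (\<lambda>n. case_prod (x (r n)) p) \<longlonglongrightarrow> case_prod v p"
    unfolding v_eq convergent_LIMSEQ_iff .
  have "L2_Cauchy (time_prod P T) (\<lambda>n. case_prod (x (r n)))"
    using C seq_suble[OF r] unfolding L2_Cauchy_def by (meson le_trans)
  moreover have "case_prod v \<in> borel_measurable (time_prod P T)" unfolding v_eq by measurable
  ultimately have lim: "L2_lim (time_prod P T) (\<lambda>n. case_prod (x (r n))) (case_prod v)"
    using ae by (rule L2_lim_Cauchy_AE)
  moreover have "v t \<in> borel_measurable (F t)" if "t \<in> {0..T}" for t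
    unfolding v_def using ad[OF that] by (intro borel_measurable_lim_metric)
  ultimately have "v \<in> L2a P F T (\<lambda>x. (norm x)\<^sup>2)" by (simp add: L2a_iff L2_lim_def)
  then show ?thesis using lim r by blast
qed

lemma hilbert_space_L2a:
  "hilbert_space (L2a_space P F T (\<lambda>x :: 'b :: euclidean_space. (norm x)\<^sup>2)) (L2a_norm P T (\<lambda>x. (norm
      x)\<^sup>2))"
proof -
  let ?q = "\<lambda>x :: 'b. (norm x)\<^sup>2" and ?M = "time_prod P T"
  let ?S = "L2a P F T ?q" and ?R = "L2a_rel P F T ?q" and ?n = "L2a_norm P T ?q"
  let ?V = "process_space ?S ?R"
  \<comment> \<open>Evaluated at arbitrarily chosen representatives; \<open>L2a_inner_cong\<close>
    makes the choice immaterial.\<close>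
  define ip where "ip X Y = (\<integral>p. case_prod (SOME x. x \<in> X) p \<bullet> case_prod (SOME y. y \<in> Y) p \<partial>?M)"
    for X Y :: "(real \<Rightarrow> 'w \<Rightarrow> 'b) set"
  have some: "(x, SOME x'. x' \<in> ?R `` {x}) \<in> ?R" if "x \<in> ?S" for x
    using someI[of "\<lambda>x'. x' \<in> ?R `` {x}" x] L2a.rel_refl[OF that] by simp
  have ip: "ip (?R `` {x}) (?R `` {y}) = (\<integral>p. case_prod x p \<bullet> case_prod y p \<partial>?M)"
    if "x \<in> ?S" "y \<in> ?S" for x y
    unfolding ip_def using L2a_inner_cong[OF some some, OF that] by simp
  have sq: "sq_integrable ?M (case_prod x)" if "x \<in> ?S" for x using that by (simp add: L2a_iff)
  have "hilbert_space ?V ?n"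
  proof (rule hilbert_spaceI[OF L2a.real_vector_space_process, where ip = ip])
    show "inner_product_on ?V ip"
      unfolding inner_product_on_def
    proof (intro conjI ballI allI impI)
      fix X Y Z c assume X: "X \<in> carrier ?V"
      from X obtain x where x: "x \<in> ?S" "X = ?R `` {x}" by (rule L2a.classE)
      show "0 \<le> ip X X" using ip[OF x(1) x(1)] by (simp add: x(2))
      show "X = \<zero>\<^bsub>?V\<^esub>" if "ip X X = 0"
      proof -
        have "(\<integral>p. (norm (case_prod x p))\<^sup>2 \<partial>?M) = 0"
          using that ip[OF x(1) x(1)] by (simp add: x(2) power2_norm_eq_inner)
        then have "AE p in ?M. case_prod x p = 0" using sq_integral_eq_0_iff[OF sq[OF x(1)]] by simp
        then have "(x, \<lambda>t \<omega>. 0) \<in> ?R" using x(1) L2a_zero by (simp add: L2a_rel_iff case_prod_beta')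
        then show ?thesis unfolding x(2) L2a.zero_class by (rule L2a.class_eqI)
      qed
      assume Y: "Y \<in> carrier ?V"
      from Y obtain y where y: "y \<in> ?S" "Y = ?R `` {y}" by (rule L2a.classE)
      show "ip X Y = ip Y X" using ip x y by (simp add: inner_commute)
      show "ip (c \<odot>\<^bsub>?V\<^esub> X) Y = c * ip X Y"
        using ip[OF L2a_scaleR[OF x(1)] y(1), of c] ip[OF x(1) y(1)] x y
        by (simp add: L2a.scale_class case_prod_beta')
      assume Z: "Z \<in> carrier ?V"
      from Z obtain z where z: "z \<in> ?S" "Z = ?R `` {z}" by (rule L2a.classE)
      have "integrable ?M (\<lambda>p. case_prod x p \<bullet> case_prod z p)" "integrable ?M (\<lambda>p. case_prod y p \<bullet>
          case_prod z p)"
        using x y z by (auto intro!: integrable_inner_sq sq)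
      then show "ip (X \<oplus>\<^bsub>?V\<^esub> Y) Z = ip X Z + ip Y Z"
        using ip[OF L2a_add[OF x(1) y(1)] z(1)] ip[OF x(1) z(1)] ip[OF y(1) z(1)] x y z
        by (simp add: L2a.add_class case_prod_beta' inner_add_left)
    qed
    show "?n X = sqrt (ip X X)" if X: "X \<in> carrier ?V" for X
    proof -
      from X obtain x where x: "x \<in> ?S" "X = ?R `` {x}" by (rule L2a.classE)
      show ?thesis using ip[OF x(1) x(1)] L2a_norm_class[OF x(1)]
          by (simp add: x(2) power2_norm_eq_inner)
    qed
    fix \<sigma> assume \<sigma>: "norm_Cauchy ?V ?n \<sigma>"
    then have "\<exists>x. x \<in> ?S \<and> \<sigma> n = ?R `` {x}" for n
      using L2a.classE[of "\<sigma> n"] unfolding norm_Cauchy_def by (metis range_subsetD)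
    then obtain x where x: "\<And>n. x n \<in> ?S" and \<sigma>x: "\<And>n. \<sigma> n = ?R `` {x n}" by metis
    have nrm: "?n (?R `` {v} \<ominus>\<^bsub>?V\<^esub> ?R `` {w})
        = sqrt (\<integral>p. (norm (case_prod v p - case_prod w p))\<^sup>2 \<partial>?M)"
      if v: "v \<in> ?S" and w: "w \<in> ?S" for v w
    proof -
      have "(\<lambda>t \<omega>. v t \<omega> - w t \<omega>) \<in> ?S" using L2a_add[OF v L2a_scaleR[OF w, of "-1"]] by simp
      then show ?thesis using L2a_norm_class by (simp add: L2a.minus_class[OF v w] case_prod_beta')
    qed
    have "L2_Cauchy ?M (\<lambda>n. case_prod (x n))"
      unfolding L2_Cauchy_def
    proof (intro conjI allI impI)
      fix e :: real assume "e > 0"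
      then have "sqrt e > 0" by simp
      then obtain N where N: "\<And>j k. j \<ge> N \<Longrightarrow> k \<ge> N \<Longrightarrow> ?n (\<sigma> j \<ominus>\<^bsub>?V\<^esub> \<sigma> k) < sqrt e"
        using \<sigma> unfolding norm_Cauchy_def by meson
      have "(\<integral>p. (norm (case_prod (x j) p - case_prod (x k) p))\<^sup>2 \<partial>?M) < e" if "j \<ge> N" "k \<ge> N"
          for j k
        using N[OF that] unfolding \<sigma>x nrm[OF x x] real_sqrt_less_iff .
      then show "\<exists>N. \<forall>j\<ge>N. \<forall>k\<ge>N. (\<integral>p. (norm (case_prod (x j) p - case_prod (x k) p))\<^sup>2 \<partial>?M) < e"
        by auto
    qed (use sq x in auto)
    from L2a_complete[OF x this] obtain v r where v: "v \<in> ?S" and r: "strict_mono r"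
      and lim: "L2_lim ?M (\<lambda>n. case_prod (x (r n))) (case_prod v)" by blast
    have "(\<lambda>n. sqrt (\<integral>p. (norm (case_prod (x (r n)) p - case_prod v p))\<^sup>2 \<partial>?M)) \<longlonglongrightarrow> 0"
      using lim tendsto_real_sqrt by (fastforce simp: L2_lim_def)
    then show "\<exists>X\<in>carrier ?V. \<exists>r. strict_mono r \<and> (\<lambda>n. ?n (\<sigma> (r n) \<ominus>\<^bsub>?V\<^esub> X)) \<longlonglongrightarrow> 0"
      using r by (intro bexI[OF _ L2a.class_mem[OF v]] exI[of _ r]) (simp add: \<sigma>x nrm[OF x v])
  qed
  then show ?thesis by (simp add: L2a_space_def)
qed

end

section \<open>Brownian increments\<close>

text \<open>Fubini's theorem for a product of functions of single coordinates. \<open>lborel\<close>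
  on \<open>real ^ 'm\<close> is the image of a product measure indexed by the basis vectors, so the
  factors are re-indexed along the bijection \<open>e\<close> from coordinates to axes.\<close>

lemma has_bochner_integral_lborel_vec_prod:
  fixes g :: "'m :: finite \<Rightarrow> real \<Rightarrow> real"
  assumes g: "\<And>i. integrable lborel (g i)"
  shows "has_bochner_integral lborel (\<lambda>x :: real ^ 'm. \<Prod>i\<in>UNIV. g i (x $ i)) (\<Prod>i\<in>UNIV. integral\<^sup>L
      lborel (g i))"
proof -
  let ?B = "Basis :: (real ^ 'm) set"
  define e where "e = (\<lambda>i. axis i 1 :: real ^ 'm)"
  have inj: "inj e" by (auto simp: inj_on_def e_def axis_eq_axis)
  have Basis: "?B = range e" by (auto simp: Basis_vec_def e_def)
  have prodB: "(\<Prod>b\<in>?B. h b) = (\<Prod>i\<in>UNIV. h (e i))" for h :: "real ^ 'm \<Rightarrow> real"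
    unfolding Basis by (simp add: prod.reindex[OF inj])
  define G where "G b = g (inv_into UNIV e b)" for b
  have G: "integrable lborel (G b)" for b by (simp add: G_def g)
  have nth: "(\<Sum>b\<in>?B. f b *\<^sub>R b) $ i = f (e i)" for f :: "real ^ 'm \<Rightarrow> real" and i
  proof -
    have "(\<Sum>b\<in>?B. f b *\<^sub>R b) $ i = (\<Sum>j\<in>UNIV. f (e j) * (e j $ i))"
      unfolding Basis by (simp add: sum.reindex[OF inj])
    also have "\<dots> = (\<Sum>j\<in>UNIV. if j = i then f (e j) else 0)"
      by (intro sum.cong) (auto simp: e_def axis_def)
    finally show ?thesis by simp
  qed
  interpret product_sigma_finite "\<lambda>b :: real ^ 'm. lborel :: real measure" by standard
  have eq: "(\<Prod>i\<in>UNIV. g i ((\<Sum>b\<in>?B. f b *\<^sub>R b) $ i)) = (\<Prod>b\<in>?B. G b (f b))" for f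
    unfolding prodB nth G_def by (simp add: inv_f_f[OF inj])
  have [measurable]: "g i \<in> borel_measurable borel" for i using g[of i] by auto
  have meas: "(\<lambda>f. \<Sum>b\<in>?B. f b *\<^sub>R b) \<in> measurable (\<Pi>\<^sub>M b\<in>?B. lborel) borel" by measurable
  have meas2: "(\<lambda>x :: real ^ 'm. \<Prod>i\<in>UNIV. g i (x $ i)) \<in> borel_measurable borel" by measurable
  have "integrable (\<Pi>\<^sub>M b\<in>?B. lborel) (\<lambda>f. \<Prod>b\<in>?B. G b (f b))"
    by (rule product_integrable_prod) (simp_all add: G)
  moreover have "(\<integral>f. (\<Prod>b\<in>?B. G b (f b)) \<partial>(\<Pi>\<^sub>M b\<in>?B. lborel)) = (\<Prod>b\<in>?B. integral\<^sup>L lborel (G b))"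
    by (rule product_integral_prod) (simp_all add: G)
  ultimately have "has_bochner_integral (\<Pi>\<^sub>M b\<in>?B. lborel) (\<lambda>f. \<Prod>b\<in>?B. G b (f b)) (\<Prod>b\<in>?B. integral\<^sup>L
      lborel (G b))"
    by (simp add: has_bochner_integral_iff)
  moreover have "(\<Prod>b\<in>?B. integral\<^sup>L lborel (G b)) = (\<Prod>i\<in>UNIV. integral\<^sup>L lborel (g i))"
    unfolding prodB G_def by (simp add: inv_f_f[OF inj])
  ultimately show ?thesis
    by (subst lborel_eq)
      (simp only: has_bochner_integral_iff integrable_distr_eq[OF meas meas2] integral_distr[OF meas
          meas2] eq)
qed

lemma gaussian_monomial:
  fixes k :: "'m :: finite \<Rightarrow> nat"
  assumes "0 < \<sigma>"
  shows "has_bochner_integral lborel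
    (\<lambda>x :: real ^ 'm. (\<Prod>i\<in>UNIV. normal_density 0 \<sigma> (x $ i)) * (\<Prod>i\<in>UNIV. (x $ i) ^ k i))
    (\<Prod>i\<in>UNIV. \<integral>x. normal_density 0 \<sigma> x * x ^ k i \<partial>lborel)"
  unfolding prod.distrib[symmetric]
  by (rule has_bochner_integral_lborel_vec_prod) (use integrable_normal_moment[OF assms, of 0] in
      simp)

context filtered_prob_space begin

lemma space_F [simp]: "0 \<le> t \<Longrightarrow> space (F t) = space P"
  using subalgebra_F by (auto simp: subalgebra_def)

lemma F_measurable: "0 \<le> t \<Longrightarrow> f \<in> measurable (F t) N \<Longrightarrow> f \<in> measurable P N"
  using measurable_from_subalg[OF subalgebra_F] .

lemma F_measurable_mono: "0 \<le> s \<Longrightarrow> s \<le> t \<Longrightarrow> f \<in> measurable (F s) N \<Longrightarrow> f \<in> measurable (F t) N"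
  using measurable_from_subalg[of "F t" "F s"] F_mono by (simp add: subalgebra_def)

end

section \<open>Independence and moments of the increments of \<open>W\<close>\<close>

context brownian_motion begin

lemma measurable_W: "0 \<le> t \<Longrightarrow> W t \<in> borel_measurable P"
  by (rule F_measurable[OF _ W_adapted])

text \<open>Turns \<open>W_indep\<close>, a statement about families of sets, into a factorisation
  of expectations. The sigma-algebra generated by \<open>Z\<close> lies in \<open>F s\<close>, and
  that generated by \<open>g\<close> of the increment lies in the preimages under the
  increment.\<close>

lemma increment_indep:
  fixes Z :: "'w \<Rightarrow> real" and g :: "real ^ 'm \<Rightarrow> real"
  assumes st: "0 \<le> s" "s < t" and Z: "Z \<in> borel_measurable (F s)" "integrable P Z"
    and g: "g \<in> borel_measurable borel" "integrable P (\<lambda>\<omega>. g (W t \<omega> - W s \<omega>))"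
  shows "integrable P (\<lambda>\<omega>. Z \<omega> * g (W t \<omega> - W s \<omega>))"
    and "(\<integral>\<omega>. Z \<omega> * g (W t \<omega> - W s \<omega>) \<partial>P) = (\<integral>\<omega>. Z \<omega> \<partial>P) * (\<integral>\<omega>. g (W t \<omega> - W s \<omega>) \<partial>P)"
proof -
  let ?X = "\<lambda>\<omega>. W t \<omega> - W s \<omega>"
  have [measurable]: "?X \<in> borel_measurable P" using measurable_W st by simp
  note [measurable] = g(1) F_measurable[OF st(1) Z(1)]
  let ?G = "{?X -` A \<inter> space P | A. A \<in> sets borel}"
  \<comment> \<open>The preimages already form a sigma-algebra, so generating one from them adds
    nothing.\<close>
  have "?G = sets (vimage_algebra (space P) ?X borel)" by (auto simp: sets_vimage_algebra2)
  then have sigma_G: "sigma_sets (space P) ?G = ?G"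
    using sets.sigma_sets_eq[of "vimage_algebra (space P) ?X borel"] by simp
  have "{(\<lambda>\<omega>. g (?X \<omega>)) -` A \<inter> space P | A. A \<in> sets borel} \<subseteq> ?G"
  proof clarify
    fix A :: "real set" assume "A \<in> sets borel"
    then have "g -` A \<in> sets borel" using measurable_sets[OF g(1)] by simp
    then show "\<exists>B. (\<lambda>\<omega>. g (?X \<omega>)) -` A \<inter> space P = ?X -` B \<inter> space P \<and> B \<in> sets borel" by blast
  qed
  from sigma_sets_mono'[OF this, of "space P"]
  have G: "sigma_sets (space P) {(\<lambda>\<omega>. g (?X \<omega>)) -` A \<inter> space P | A. A \<in> sets borel} \<subseteq> ?G"
    unfolding sigma_G .
  have "{Z -` A \<inter> space P | A. A \<in> sets borel} \<subseteq> sets (F s)"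
    using measurable_sets[OF Z(1)] st(1) by auto
  then have Z_sets: "sigma_sets (space P) {Z -` A \<inter> space P | A. A \<in> sets borel} \<subseteq> sets (F s)"
    using sets.sigma_sets_subset[of _ "F s"] st(1) by simp
  have ind: "indep_var borel Z borel (\<lambda>\<omega>. g (?X \<omega>))"
    unfolding indep_var_eq
  proof (intro conjI)
    have "indep_set (sets (F s)) ?G" by (rule W_indep[OF st])
    then show "indep_set (sigma_sets (space P) {Z -` A \<inter> space P | A. A \<in> sets borel})
        (sigma_sets (space P) {(\<lambda>\<omega>. g (?X \<omega>)) -` A \<inter> space P | A. A \<in> sets borel})"
      unfolding indep_sets2_eq using G Z_sets by (meson subset_iff)
  qed measurable
  show "integrable P (\<lambda>\<omega>. Z \<omega> * g (W t \<omega> - W s \<omega>))"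
    by (rule indep_var_integrable[OF ind Z(2) g(2)])
  show "(\<integral>\<omega>. Z \<omega> * g (W t \<omega> - W s \<omega>) \<partial>P) = (\<integral>\<omega>. Z \<omega> \<partial>P) * (\<integral>\<omega>. g (W t \<omega> - W s \<omega>) \<partial>P)"
    by (rule indep_var_lebesgue_integral[OF ind Z(2) g(2)])
qed

text \<open>The density is a product, so every mixed moment is a product of one-dimensional normal
  moments, with exponent \<open>k i\<close> for coordinate \<open>i\<close>. The means and
  covariances below are instances.\<close>

lemma increment_monomial:
  fixes k :: "'m \<Rightarrow> nat"
  assumes st: "0 \<le> s" "s < t"
  shows "has_bochner_integral P (\<lambda>\<omega>. \<Prod>i\<in>UNIV. ((W t \<omega> - W s \<omega>) $ i) ^ k i)
    (\<Prod>i\<in>UNIV. \<integral>x. normal_density 0 (sqrt (t - s)) x * x ^ k i \<partial>lborel)"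
proof -
  have g: "(\<lambda>x :: real ^ 'm. \<Prod>i\<in>UNIV. (x $ i) ^ k i) \<in> borel_measurable lborel" by measurable
  have pos: "0 \<le> (\<Prod>i\<in>UNIV. normal_density 0 (sqrt (t - s)) (x $ i))" for x :: "real ^ 'm"
    by (intro prod_nonneg) simp
  have "0 < sqrt (t - s)" using st by simp
  note H = gaussian_monomial[OF this, of k]
  show ?thesis
    using H distributed_integral[OF W_gaussian[OF st] g pos] distributed_integrable[OF W_gaussian[OF
        st] g pos]
    by (simp add: has_bochner_integral_iff)
qed

lemma increment_mean:
  assumes st: "0 \<le> s" "s < t"
  shows "has_bochner_integral P (\<lambda>\<omega>. (W t \<omega> - W s \<omega>) $ b) 0"
proof -
  define k where "k i = (if i = b then 1 else 0 :: nat)" for i :: 'm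
  have pos: "0 < sqrt (t - s)" using st by simp
  have "(\<Prod>i\<in>UNIV. (x $ i) ^ k i) = x $ b" for x :: "real ^ 'm"
    unfolding k_def by (simp add: if_distrib[of "\<lambda>n. _ ^ n"] prod.delta cong: if_cong)
  moreover have "(\<Prod>i\<in>UNIV. \<integral>x. normal_density 0 (sqrt (t - s)) x * x ^ k i \<partial>lborel) = 0"
    using integral_normal_moment_nz_1[OF pos, of 0]
        by (intro prod_zero) (auto simp: k_def intro!: exI[of _ b])
  ultimately show ?thesis using increment_monomial[OF st, of k] by (simp only:)
qed

lemma increment_second_moment:
  assumes st: "0 \<le> s" "s < t"
  shows "has_bochner_integral P (\<lambda>\<omega>. (W t \<omega> - W s \<omega>) $ b * (W t \<omega> - W s \<omega>) $ c) (if b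
      = c then t - s else 0)"
proof -
  \<comment> \<open>Adding two indicators treats both cases at once: exponent \<open>2\<close> at
    \<open>b\<close> if \<open>b = c\<close>, and exponent \<open>1\<close> at each of them
    otherwise, when an odd moment makes the product vanish.\<close>
  define k where "k i = (if i = b then 1 else 0) + (if i = c then 1 else 0 :: nat)" for i :: 'm
  have pos: "0 < sqrt (t - s)" using st by simp
  have "(\<Prod>i\<in>UNIV. (x $ i) ^ k i) = x $ b * x $ c" for x :: "real ^ 'm"
    unfolding k_def power_add prod.distrib
    by (simp add: if_distrib[of "\<lambda>n. _ ^ n"] prod.delta cong: if_cong)
  moreover have "(\<Prod>i\<in>UNIV. \<integral>x. normal_density 0 (sqrt (t - s)) x * x ^ k i \<partial>lborel) = (if b
      = c then t - s else 0)"
  proof (cases "b = c")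
    case True
    have "(\<Prod>i\<in>UNIV. \<integral>x. normal_density 0 (sqrt (t - s)) x * x ^ k i \<partial>lborel) = (\<Prod>i\<in>UNIV.
        if i = b then t - s else 1)"
      using integral_normal_moment_even[OF pos, of 0 1] integral_normal_density[OF pos, of 0] st
      by (intro prod.cong) (auto simp: k_def True power2_eq_square)
    then show ?thesis using True by (simp add: prod.delta)
  next
    case False
    have "(\<Prod>i\<in>UNIV. \<integral>x. normal_density 0 (sqrt (t - s)) x * x ^ k i \<partial>lborel) = 0"
      using integral_normal_moment_nz_1[OF pos, of 0] False
      by (intro prod_zero) (auto simp: k_def intro!: exI[of _ b])
    then show ?thesis using False by simp
  qed
  ultimately show ?thesis using increment_monomial[OF st, of k] by (simp only:)
qed

text \<open>A weight from the past leaves the mean of an increment zero; all orthogonality relations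
  for simple integrals come from this. The case \<open>s = t\<close> is separate because the
  assumptions on \<open>W\<close> concern proper increments.\<close>

lemma weighted_increment_mean:
  fixes Z :: "'w \<Rightarrow> real"
  assumes st: "0 \<le> s" "s \<le> t" and Z: "Z \<in> borel_measurable (F s)" "integrable P Z"
  shows "has_bochner_integral P (\<lambda>\<omega>. Z \<omega> * (W t \<omega> - W s \<omega>) $ b) 0"
proof (cases "s = t")
  case False
  then have "s < t" using st by simp
  note inc = increment_mean[OF st(1) this, of b, unfolded has_bochner_integral_iff]
  have "(\<lambda>x :: real ^ 'm. x $ b) \<in> borel_measurable borel" by measurable
  then show ?thesis
    using increment_indep[OF st(1) \<open>s < t\<close> Z, of "\<lambda>x. x $ b"] inc
        by (simp add: has_bochner_integral_iff)
qed (simp add: has_bochner_integral_zero)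

lemma weighted_increment_second_moment:
  fixes Z :: "'w \<Rightarrow> real"
  assumes st: "0 \<le> s" "s \<le> t" and Z: "Z \<in> borel_measurable (F s)" "integrable P Z"
  shows "has_bochner_integral P (\<lambda>\<omega>. Z \<omega> * ((W t \<omega> - W s \<omega>) $ b * (W t \<omega> - W s \<omega>) $ c))
    (if b = c then (\<integral>\<omega>. Z \<omega> \<partial>P) * (t - s) else 0)"
proof (cases "s = t")
  case False
  then have "s < t" using st by simp
  note inc = increment_second_moment[OF st(1) this, of b c, unfolded has_bochner_integral_iff]
  have "(\<lambda>x :: real ^ 'm. x $ b * x $ c) \<in> borel_measurable borel" by measurable
  then show ?thesis
    using increment_indep[OF st(1) \<open>s < t\<close> Z, of "\<lambda>x. x $ b * x $ c"] inc
        by (simp add: has_bochner_integral_iff)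
qed (simp add: has_bochner_integral_zero)

lemma sq_integrable_increment:
  assumes "0 \<le> s" "s \<le> t"
  shows "sq_integrable P (\<lambda>\<omega>. (W t \<omega> - W s \<omega>) $ b)"
proof (cases "s = t")
  case True
  then show ?thesis using sq_integrable_zero[of P, where 'b = real] by simp
next
  case False
  then have st: "s < t" using assms by simp
  have "(\<lambda>\<omega>. W t \<omega> - W s \<omega>) \<in> borel_measurable P" using measurable_W assms by simp
  moreover have "(\<lambda>x :: real ^ 'm. x $ b) \<in> borel_measurable borel" by measurable
  ultimately have "(\<lambda>\<omega>. (W t \<omega> - W s \<omega>) $ b) \<in> borel_measurable P" by (rule measurable_compose)
  moreover have "integrable P (\<lambda>\<omega>. (norm ((W t \<omega> - W s \<omega>) $ b))\<^sup>2)"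
    using increment_second_moment[OF assms(1) st, of b b]
    by (simp only: has_bochner_integral_iff power2_eq_square real_norm_def abs_mult_self_eq)
  ultimately show ?thesis unfolding sq_integrable_def by blast
qed

text \<open>Overlapping increments are split at the left end point \<open>c\<close> of the later one and at the smaller
  of the two right end points.\<close>

lemma increment_covariance_ordered:
  fixes H K :: "'w \<Rightarrow> real"
  assumes abcd: "0 \<le> a" "a \<le> b" "c \<le> d" "a \<le> c"
    and H: "H \<in> borel_measurable (F a)" "\<And>\<omega>. \<omega> \<in> space P \<Longrightarrow> \<bar>H \<omega>\<bar> \<le> C"
    and K: "K \<in> borel_measurable (F c)" "\<And>\<omega>. \<omega> \<in> space P \<Longrightarrow> \<bar>K \<omega>\<bar> \<le> C'"
  shows "has_bochner_integral P
    (\<lambda>\<omega>. H \<omega> * (W b \<omega> - W a \<omega>) $ y * (K \<omega> * (W d \<omega> - W c \<omega>) $ z))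
    (if y = z then (\<integral>\<omega>. H \<omega> * K \<omega> \<partial>P) * max 0 (min b d - max a c) else 0)"
proof -
  define D where "D s t u = (\<lambda>\<omega>. (W t \<omega> - W s \<omega>) $ u)" for s t u
  have c0: "0 \<le> c" using abcd by simp
  have DF: "D s t u \<in> borel_measurable (F r)" if "0 \<le> s" "s \<le> t" "t \<le> r" for s t r u
  proof -
    have [measurable]: "W s \<in> borel_measurable (F r)" "W t \<in> borel_measurable (F r)"
      using that W_adapted F_measurable_mono by (meson order_trans)+
    have "(\<lambda>\<omega>. W t \<omega> - W s \<omega>) \<in> borel_measurable (F r)" by measurable
    moreover have "(\<lambda>x :: real ^ 'm. x $ u) \<in> borel_measurable borel" by measurable
    ultimately show ?thesis unfolding D_def by (rule measurable_compose)
  qed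
  have HF: "H \<in> borel_measurable (F r)" if "a \<le> r" for r
      using F_measurable_mono[OF abcd(1) that H(1)] .
  have KF: "K \<in> borel_measurable (F r)" if "c \<le> r" for r using F_measurable_mono[OF c0 that K(1)] .
  have [measurable]: "H \<in> borel_measurable P" "K \<in> borel_measurable P"
    using F_measurable[OF abcd(1) H(1)] F_measurable[OF c0 K(1)] by auto
  have HK: "\<bar>H \<omega> * K \<omega>\<bar> \<le> C * C'" if "\<omega> \<in> space P" for \<omega>
    unfolding abs_mult using H(2)[OF that] K(2)[OF that] by (intro mult_mono) auto
  have iHK: "integrable P (\<lambda>\<omega>. H \<omega> * K \<omega>)"
    by (rule integrable_const_bound[where B = "C * C'"]) (auto intro!: AE_I2 HK)
  have iHKD: "integrable P (\<lambda>\<omega>. H \<omega> * K \<omega> * D s t u \<omega>)" if "0 \<le> s" "s \<le> t" for s t u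
  proof (rule Bochner_Integration.integrable_bound)
    show "integrable P (\<lambda>\<omega>. C * C' * D s t u \<omega>)"
      unfolding D_def
      using sq_integrable_integrable[OF finite_measure_axioms sq_integrable_increment[OF that]]
          by simp
    show "(\<lambda>\<omega>. H \<omega> * K \<omega> * D s t u \<omega>) \<in> borel_measurable P"
      using F_measurable[OF _ DF[OF that order_refl]] that by simp
    show "AE \<omega> in P. norm (H \<omega> * K \<omega> * D s t u \<omega>) \<le> norm (C * C' * D s t u \<omega>)"
    proof (rule AE_I2)
      fix \<omega> assume "\<omega> \<in> space P"
      then have "\<bar>H \<omega> * K \<omega>\<bar> \<le> \<bar>C * C'\<bar>" using HK[of \<omega>] by linarith
      then show "norm (H \<omega> * K \<omega> * D s t u \<omega>) \<le> norm (C * C' * D s t u \<omega>)"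
        by (simp add: abs_mult mult_right_mono)
    qed
  qed
  \<comment> \<open>All factors but the last increment are known at its starting time
    \<open>r\<close>, so together they act as a weight from the past.\<close>
  have disj: "has_bochner_integral P (\<lambda>\<omega>. H \<omega> * K \<omega> * D s t u \<omega> * D r q x \<omega>) 0"
    if "0 \<le> s" "s \<le> t" "t \<le> r" "r \<le> q" "c \<le> r" for s t u r q x
    unfolding D_def[of r q]
    using that abcd HF[of r] KF[of r] DF[of s t r u] iHKD[of s t u]
    by (intro weighted_increment_mean borel_measurable_times) auto
  have same: "has_bochner_integral P (\<lambda>\<omega>. H \<omega> * K \<omega> * D c q y \<omega> * D c q z \<omega>)
      (if y = z then (\<integral>\<omega>. H \<omega> * K \<omega> \<partial>P) * (q - c) else 0)" if "c \<le> q" for q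
    using weighted_increment_second_moment[OF c0 that _ iHK, of y z] HF[OF abcd(4)] K(1)
    unfolding D_def by (simp add: mult.assoc borel_measurable_times)
  have split: "D s t u \<omega> = D s r u \<omega> + D r t u \<omega>" for s t r u \<omega> by (simp add: D_def)
  have "has_bochner_integral P (\<lambda>\<omega>. H \<omega> * K \<omega> * D a b y \<omega> * D c d z \<omega>)
      (if y = z then (\<integral>\<omega>. H \<omega> * K \<omega> \<partial>P) * max 0 (min b d - max a c) else 0)"
  proof (cases "b \<le> c")
    case True
    then have "max 0 (min b d - max a c) = 0" by auto
    then have "(if y = z then (\<integral>\<omega>. H \<omega> * K \<omega> \<partial>P) * max 0 (min b d - max a c) else 0) = 0" by simp
    then show ?thesis using disj[of a b c d y z] True abcd by (simp only: order_refl)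
  next
    case False
    define q where "q = min b d"
    have q: "c \<le> q" "q \<le> b" "q \<le> d" "q = b \<or> q = d" using False abcd by (auto simp: q_def)
    have z1: "has_bochner_integral P (\<lambda>\<omega>. H \<omega> * K \<omega> * D a c y \<omega> * D c d z \<omega>) 0"
      using abcd by (intro disj) auto
    have z2: "has_bochner_integral P (\<lambda>\<omega>. H \<omega> * K \<omega> * D c q y \<omega> * D q d z \<omega>) 0"
      using q c0 by (intro disj) auto
    have z3: "has_bochner_integral P (\<lambda>\<omega>. H \<omega> * K \<omega> * D q b y \<omega> * D c d z \<omega>) 0"
    \<comment> \<open>Either the piece from \<open>q\<close> to \<open>b\<close> is empty, or
      \<open>q = d\<close> and it follows the whole increment from \<open>c\<close> to
      \<open>d\<close>.\<close>
    proof (cases "q = b")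
      case True
      then show ?thesis by (simp add: D_def has_bochner_integral_zero)
    next
      case False
      then have "q = d" using q by simp
      then have "has_bochner_integral P (\<lambda>\<omega>. H \<omega> * K \<omega> * D c d z \<omega> * D q b y \<omega>) 0"
        using q c0 abcd by (intro disj) auto
      then show ?thesis by (simp add: mult.commute mult.left_commute)
    qed
    \<comment> \<open>The increment from \<open>c\<close> to \<open>d\<close> is split only against
      the middle piece of the other one. Three of the four terms have mean zero, and the product
      over the common interval from \<open>c\<close> to \<open>q\<close> supplies the
      length.\<close>
    have "(\<lambda>\<omega>. H \<omega> * K \<omega> * D a b y \<omega> * D c d z \<omega>) = (\<lambda>\<omega>. H \<omega> * K \<omega> * D c q y \<omega> * D c q z \<omega>
        + H \<omega> * K \<omega> * D c q y \<omega> * D q d z \<omega> + H \<omega> * K \<omega> * D a c y \<omega> * D c d z \<omega>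
        + H \<omega> * K \<omega> * D q b y \<omega> * D c d z \<omega>)"
    proof
      fix \<omega>
      have "D a b y \<omega> = D a c y \<omega> + (D c q y \<omega> + D q b y \<omega>)"
        unfolding split[of a b y \<omega> c] split[of c b y \<omega> q] ..
      then show "H \<omega> * K \<omega> * D a b y \<omega> * D c d z \<omega> = H \<omega> * K \<omega> * D c q y \<omega> * D c q z \<omega>
        + H \<omega> * K \<omega> * D c q y \<omega> * D q d z \<omega> + H \<omega> * K \<omega> * D a c y \<omega> * D c d z \<omega>
        + H \<omega> * K \<omega> * D q b y \<omega> * D c d z \<omega>"
        using split[of c d z \<omega> q] by (simp add: algebra_simps)
    qed
    moreover have "max 0 (min b d - max a c) = q - c" using q abcd by (auto simp: q_def)
    ultimately show ?thesis
      using has_bochner_integral_add[OF has_bochner_integral_add[OF has_bochner_integral_add[OF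
          same[OF q(1)] z2] z1] z3]
      by (simp only: add_0_right)
  qed
  then show ?thesis by (simp add: D_def mult_ac)
qed

text \<open>Follows from the ordered case by exchanging the two increments. The factor is the length
  of the overlap of the two time intervals, which is also the time integral of the product of their
  indicators; this coincidence is the core of the isometry.\<close>

lemma increment_covariance:
  fixes H K :: "'w \<Rightarrow> real"
  assumes "0 \<le> a" "a \<le> b" "0 \<le> c" "c \<le> d"
    and H: "H \<in> borel_measurable (F a)" "\<And>\<omega>. \<omega> \<in> space P \<Longrightarrow> \<bar>H \<omega>\<bar> \<le> C"
    and K: "K \<in> borel_measurable (F c)" "\<And>\<omega>. \<omega> \<in> space P \<Longrightarrow> \<bar>K \<omega>\<bar> \<le> C'"
  shows "has_bochner_integral P
    (\<lambda>\<omega>. H \<omega> * (W b \<omega> - W a \<omega>) $ y * (K \<omega> * (W d \<omega> - W c \<omega>) $ z))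
    (if y = z then (\<integral>\<omega>. H \<omega> * K \<omega> \<partial>P) * max 0 (min b d - max a c) else 0)"
proof (cases "a \<le> c")
  case True
  then show ?thesis using assms by (intro increment_covariance_ordered[where C = C
      and C' = C']) auto
next
  case False
  then have "has_bochner_integral P (\<lambda>\<omega>. K \<omega> * (W d \<omega> - W c \<omega>) $ z * (H \<omega> * (W b \<omega> - W a \<omega>) $ y))
    (if z = y then (\<integral>\<omega>. K \<omega> * H \<omega> \<partial>P) * max 0 (min d b - max c a) else 0)"
    using assms by (intro increment_covariance_ordered[where C = C' and C' = C]) auto
  then show ?thesis by (simp add: mult_ac min.commute max.commute eq_commute[of z y] cong: if_cong)
qed

end

section \<open>Square integrable martingales\<close>

lemma borel_measurable_vec_nth:
  fixes f :: "'a \<Rightarrow> 'b :: euclidean_space ^ 'n :: finite"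
  assumes "f \<in> borel_measurable M"
  shows "(\<lambda>x. f x $ i) \<in> borel_measurable M"
proof -
  have "(\<lambda>x :: 'b ^ 'n. x $ i) \<in> borel_measurable borel"
    by (intro borel_measurable_continuous_onI continuous_intros)
  then show ?thesis by (rule measurable_compose[OF assms])
qed

lemma borel_measurable_vecI:
  fixes f :: "'a \<Rightarrow> real ^ 'n :: finite"
  assumes "\<And>i. (\<lambda>x. f x $ i) \<in> borel_measurable M"
  shows "f \<in> borel_measurable M"
  unfolding borel_measurable_euclidean_space[of f]
  using assms by (auto simp: Basis_vec_def inner_axis)

lemma borel_measurable_matrix_vector:
  fixes A :: "'a \<Rightarrow> real ^ 'm :: finite ^ 'n :: finite" and x :: "'a \<Rightarrow> real ^ 'm"
  assumes "A \<in> borel_measurable M" "x \<in> borel_measurable M"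
  shows "(\<lambda>\<omega>. A \<omega> *v x \<omega>) \<in> borel_measurable M"
proof (rule borel_measurable_vecI)
  fix i
  show "(\<lambda>\<omega>. (A \<omega> *v x \<omega>) $ i) \<in> borel_measurable M"
    by (simp add: matrix_vector_mult_def)
      (intro borel_measurable_sum borel_measurable_times borel_measurable_vec_nth assms)
qed

lemma sq_integrable_vecI:
  fixes f :: "'a \<Rightarrow> real ^ 'n :: finite"
  assumes "\<And>i. sq_integrable M (\<lambda>x. f x $ i)"
  shows "sq_integrable M f"
proof -
  have "(norm y)\<^sup>2 = (\<Sum>i\<in>UNIV. (y $ i)\<^sup>2)" for y :: "real ^ 'n"
    unfolding power2_norm_eq_inner by (simp add: inner_vec_def power2_eq_square)
  then show ?thesis
    using assms by (auto simp: sq_integrable_def intro: borel_measurable_vecI)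
qed

lemma sq_integrable_vec_nth:
  fixes f :: "'a \<Rightarrow> real ^ 'n :: finite"
  assumes f: "sq_integrable M f"
  shows "sq_integrable M (\<lambda>x. f x $ i)"
proof -
  have m: "(\<lambda>x. f x $ i) \<in> borel_measurable M"
      by (rule borel_measurable_vec_nth[OF sq_integrableD(1)[OF f]])
  have "integrable M (\<lambda>x. (norm (f x $ i))\<^sup>2)"
  proof (rule Bochner_Integration.integrable_bound[OF sq_integrableD(2)[OF f]])
    have "(norm (f x $ i))\<^sup>2 \<le> (norm (f x))\<^sup>2" for x
      using component_le_norm_cart[of "f x" i] by (intro power_mono) auto
    then show "AE x in M. norm ((norm (f x $ i))\<^sup>2) \<le> norm ((norm (f x))\<^sup>2)" by simp
  qed (use m in measurable)
  then show ?thesis using m by (simp add: sq_integrable_def)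
qed

lemma sq_integrable_bounded_scaleR:
  fixes f :: "'a \<Rightarrow> 'b :: euclidean_space"
  assumes f: "sq_integrable M f" and Z: "Z \<in> borel_measurable M" "\<And>x. x \<in> space M \<Longrightarrow> \<bar>Z x\<bar> \<le> C"
  shows "sq_integrable M (\<lambda>x. Z x *\<^sub>R f x)"
proof -
  note [measurable] = sq_integrableD(1)[OF f] Z(1)
  have "integrable M (\<lambda>x. (norm (Z x *\<^sub>R f x))\<^sup>2)"
  proof (rule Bochner_Integration.integrable_bound)
    show "integrable M (\<lambda>x. C\<^sup>2 * (norm (f x))\<^sup>2)" using f by (simp add: sq_integrable_def)
    show "AE x in M. norm ((norm (Z x *\<^sub>R f x))\<^sup>2) \<le> norm (C\<^sup>2 * (norm (f x))\<^sup>2)"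
    proof (rule AE_I2)
      fix x assume "x \<in> space M"
      then have "(Z x)\<^sup>2 \<le> C\<^sup>2" using Z(2)[of x] by (metis abs_ge_zero power2_abs power_mono)
      then show "norm ((norm (Z x *\<^sub>R f x))\<^sup>2) \<le> norm (C\<^sup>2 * (norm (f x))\<^sup>2)"
        by (simp add: power_mult_distrib mult_right_mono)
    qed
  qed simp
  then show ?thesis by (simp add: sq_integrable_def)
qed

section \<open>Martingales through orthogonality of increments\<close>

context filtered_prob_space begin

text \<open>The second clause says that an increment after \<open>r\<close> is orthogonal to all
  square integrable functions of the past up to \<open>r\<close>. For adapted square integrable
  processes this is the martingale property, in a form that speaks of inner products only.\<close>

definition l2_martingale :: "real \<Rightarrow> (real \<Rightarrow> 'w \<Rightarrow> 'b :: euclidean_space) \<Rightarrow> bool" where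
  "l2_martingale T X \<longleftrightarrow>
     (\<forall>t. 0 \<le> t \<longrightarrow> t \<le> T \<longrightarrow> X t \<in> borel_measurable (F t) \<and> sq_integrable P (X t)) \<and>
     (\<forall>r t Y. 0 \<le> r \<longrightarrow> r \<le> t \<longrightarrow> t \<le> T \<longrightarrow> Y \<in> borel_measurable (F r) \<longrightarrow> sq_integrable P Y \<longrightarrow>
        (\<integral>\<omega>. Y \<omega> \<bullet> (X t \<omega> - X r \<omega>) \<partial>P) = 0)"

lemma l2_martingaleD:
  assumes "l2_martingale T X"
  shows "\<And>t. 0 \<le> t \<Longrightarrow> t \<le> T \<Longrightarrow> X t \<in> borel_measurable (F t)"
    and "\<And>t. 0 \<le> t \<Longrightarrow> t \<le> T \<Longrightarrow> sq_integrable P (X t)"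
    and "\<And>r t Y. 0 \<le> r \<Longrightarrow> r \<le> t \<Longrightarrow> t \<le> T \<Longrightarrow> Y \<in> borel_measurable (F r) \<Longrightarrow> sq_integrable P Y \<Longrightarrow>
      (\<integral>\<omega>. Y \<omega> \<bullet> (X t \<omega> - X r \<omega>) \<partial>P) = 0"
  using assms unfolding l2_martingale_def by blast+

lemma l2_martingale_zero: "l2_martingale T (\<lambda>t \<omega>. 0)"
  by (auto simp: l2_martingale_def sq_integrable_zero)

lemma l2_martingale_add:
  fixes X X' :: "real \<Rightarrow> 'w \<Rightarrow> 'b :: euclidean_space"
  assumes X: "l2_martingale T X" and X': "l2_martingale T X'"
  shows "l2_martingale T (\<lambda>t \<omega>. X t \<omega> + X' t \<omega>)"
  unfolding l2_martingale_def
proof (intro conjI allI impI)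
  fix t assume t: "0 \<le> t" "t \<le> T"
  show "(\<lambda>\<omega>. X t \<omega> + X' t \<omega>) \<in> borel_measurable (F t)"
    using l2_martingaleD(1)[OF X t] l2_martingaleD(1)[OF X' t] by simp
  show "sq_integrable P (\<lambda>\<omega>. X t \<omega> + X' t \<omega>)"
    by (intro sq_integrable_add l2_martingaleD(2)[OF X t] l2_martingaleD(2)[OF X' t])
next
  fix r t and Y :: "'w \<Rightarrow> 'b" assume rt: "0 \<le> r" "r \<le> t" "t \<le> T"
      and Y: "Y \<in> borel_measurable (F r)" "sq_integrable P Y"
  have r: "r \<le> T" and t: "0 \<le> t" using rt by auto
  have "integrable P (\<lambda>\<omega>. Y \<omega> \<bullet> (X t \<omega> - X r \<omega>))" "integrable P (\<lambda>\<omega>. Y \<omega> \<bullet> (X' t \<omega> - X' r \<omega>))"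
    by (intro integrable_inner_sq sq_integrable_diff Y(2) l2_martingaleD(2)[OF X]
        l2_martingaleD(2)[OF X'] rt r t)+
  from Bochner_Integration.integral_add[OF this]
  have "(\<integral>\<omega>. Y \<omega> \<bullet> (X t \<omega> - X r \<omega>) + Y \<omega> \<bullet> (X' t \<omega> - X' r \<omega>) \<partial>P) = 0"
    using l2_martingaleD(3)[OF X rt Y] l2_martingaleD(3)[OF X' rt Y] by simp
  then show "(\<integral>\<omega>. Y \<omega> \<bullet> (X t \<omega> + X' t \<omega> - (X r \<omega> + X' r \<omega>)) \<partial>P) = 0"
    by (simp add: algebra_simps)
qed

lemma l2_martingale_scaleR:
  fixes X :: "real \<Rightarrow> 'w \<Rightarrow> 'b :: euclidean_space"
  assumes X: "l2_martingale T X"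
  shows "l2_martingale T (\<lambda>t \<omega>. c *\<^sub>R X t \<omega>)"
  unfolding l2_martingale_def
proof (intro conjI allI impI)
  fix t assume t: "0 \<le> t" "t \<le> T"
  show "(\<lambda>\<omega>. c *\<^sub>R X t \<omega>) \<in> borel_measurable (F t)" using l2_martingaleD(1)[OF X t] by simp
  show "sq_integrable P (\<lambda>\<omega>. c *\<^sub>R X t \<omega>)" by (intro sq_integrable_scaleR l2_martingaleD(2)[OF X t])
next
  fix r t and Y :: "'w \<Rightarrow> 'b" assume rt: "0 \<le> r" "r \<le> t" "t \<le> T"
      and Y: "Y \<in> borel_measurable (F r)" "sq_integrable P Y"
  show "(\<integral>\<omega>. Y \<omega> \<bullet> (c *\<^sub>R X t \<omega> - c *\<^sub>R X r \<omega>) \<partial>P) = 0"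
    using l2_martingaleD(3)[OF X rt Y] by (simp add: scaleR_diff_right[symmetric])
qed

lemma l2_martingale_diff:
  assumes "l2_martingale T X" "l2_martingale T X'"
  shows "l2_martingale T (\<lambda>t \<omega>. X t \<omega> - X' t \<omega>)"
  using l2_martingale_add[OF assms(1) l2_martingale_scaleR[OF assms(2), of "-1"]] by simp

lemma l2_martingale_sum:
  assumes "\<And>i. i \<in> I \<Longrightarrow> l2_martingale T (X i)"
  shows "l2_martingale T (\<lambda>t \<omega>. \<Sum>i\<in>I. X i t \<omega>)"
  using assms by (induction I rule: infinite_finite_induct) (auto intro: l2_martingale_zero
      l2_martingale_add)

text \<open>Orthogonality to a fixed \<open>Z\<close> persists because the inner product is
  continuous.\<close>

lemma l2_martingale_L2_lim:
  fixes X :: "nat \<Rightarrow> real \<Rightarrow> 'w \<Rightarrow> 'b :: euclidean_space"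
  assumes X: "\<And>j. l2_martingale T (X j)"
    and Y: "\<And>t. 0 \<le> t \<Longrightarrow> t \<le> T \<Longrightarrow> Y t \<in> borel_measurable (F t)"
    and lim: "\<And>t. 0 \<le> t \<Longrightarrow> t \<le> T \<Longrightarrow> L2_lim P (\<lambda>j. X j t) (Y t)"
  shows "l2_martingale T Y"
  unfolding l2_martingale_def
proof (intro conjI allI impI)
  fix t assume t: "0 \<le> t" "t \<le> T"
  show "Y t \<in> borel_measurable (F t)" by (rule Y[OF t])
  show "sq_integrable P (Y t)" using lim[OF t] by (simp add: L2_lim_def)
next
  fix r t and Z :: "'w \<Rightarrow> 'b" assume rt: "0 \<le> r" "r \<le> t" "t \<le> T"
      and Z: "Z \<in> borel_measurable (F r)" "sq_integrable P Z"
  have "L2_lim P (\<lambda>j \<omega>. X j t \<omega> - X j r \<omega>) (\<lambda>\<omega>. Y t \<omega> - Y r \<omega>)"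
    using rt by (intro L2_lim_diff lim) auto
  from L2_lim_inner[OF L2_lim_const[OF Z(2)] this]
  have "(\<lambda>j. \<integral>\<omega>. Z \<omega> \<bullet> (X j t \<omega> - X j r \<omega>) \<partial>P) \<longlonglongrightarrow> (\<integral>\<omega>. Z \<omega> \<bullet> (Y t \<omega> - Y r \<omega>) \<partial>P)" .
  then show "(\<integral>\<omega>. Z \<omega> \<bullet> (Y t \<omega> - Y r \<omega>) \<partial>P) = 0"
    using l2_martingaleD(3)[OF X rt Z] LIMSEQ_unique[OF _ tendsto_const] by fastforce
qed

text \<open>Pythagoras: \<open>X r\<close> is itself an admissible test function, hence orthogonal
  to the increment that follows it.\<close>

lemma l2_martingale_sq_increment:
  assumes X: "l2_martingale T X" and rt: "0 \<le> r" "r \<le> t" "t \<le> T"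
  shows "(\<integral>\<omega>. (norm (X t \<omega>))\<^sup>2 \<partial>P) = (\<integral>\<omega>. (norm (X r \<omega>))\<^sup>2 \<partial>P) + (\<integral>\<omega>. (norm (X t \<omega> - X r \<omega>))\<^sup>2 \<partial>P)"
proof -
  have r: "r \<le> T" and t: "0 \<le> t" using rt by auto
  have sq: "sq_integrable P (X t)" "sq_integrable P (X r)" using l2_martingaleD(2)[OF X] rt r t
      by auto
  show ?thesis
    using sq_integral_add[OF sq(2) sq_integrable_diff[OF sq]]
      l2_martingaleD(3)[OF X rt l2_martingaleD(1)[OF X rt(1) r] sq(2)] by simp
qed

lemma l2_martingale_sq_mono:
  assumes "l2_martingale T X" "0 \<le> r" "r \<le> t" "t \<le> T"
  shows "(\<integral>\<omega>. (norm (X r \<omega>))\<^sup>2 \<partial>P) \<le> (\<integral>\<omega>. (norm (X t \<omega>))\<^sup>2 \<partial>P)"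
  using l2_martingale_sq_increment[OF assms] by simp

text \<open>Kolmogorov's maximal inequality: split according to the first index at which the bound is exceeded.\<close>

lemma l2_martingale_maximal_discrete:
  fixes X :: "real \<Rightarrow> 'w \<Rightarrow> 'b :: euclidean_space"
  assumes X: "l2_martingale T X" and e: "0 < e"
    and \<tau>: "\<And>k :: nat. k \<le> N \<Longrightarrow> 0 \<le> \<tau> k \<and> \<tau> k \<le> T" "\<And>j k. j \<le> k \<Longrightarrow> k \<le> N \<Longrightarrow> \<tau> j \<le> \<tau> k"
  shows "e\<^sup>2 * measure P {\<omega>\<in>space P. \<exists>k\<le>N. e < norm (X (\<tau> k) \<omega>)} \<le> (\<integral>\<omega>. (norm (X T \<omega>))\<^sup>2 \<partial>P)"
proof -
  have T: "0 \<le> T" using \<tau>(1)[of 0] by auto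
  define A where "A k = {\<omega>\<in>space P. e < norm (X (\<tau> k) \<omega>) \<and> (\<forall>j<k. norm (X (\<tau> j) \<omega>) \<le> e)}" for k
  have XF: "X (\<tau> j) \<in> borel_measurable (F (\<tau> k))" if "j \<le> k" "k \<le> N" for j k
    using F_measurable_mono[of "\<tau> j" "\<tau> k"] l2_martingaleD(1)[OF X, of "\<tau> j"] \<tau>(1)[of j] \<tau>(2)[OF
        that] that by auto
  have AF: "A k \<in> sets (F (\<tau> k))" if k: "k \<le> N" for k
  proof -
    have [measurable]: "X (\<tau> k) \<in> borel_measurable (F (\<tau> k))" by (rule XF[OF order_refl k])
    have "{\<omega>\<in>space (F (\<tau> k)). norm (X (\<tau> j) \<omega>) \<le> e} \<in> sets (F (\<tau> k))" if "j < k" for j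
    proof -
      have [measurable]: "X (\<tau> j) \<in> borel_measurable (F (\<tau> k))" using that k by (intro XF) auto
      show ?thesis by measurable
    qed
    then have "{\<omega>\<in>space (F (\<tau> k)). \<forall>j\<in>{..<k}. norm (X (\<tau> j) \<omega>) \<le> e} \<in> sets (F (\<tau> k))"
      by (intro sets.sets_Collect_finite_All) auto
    moreover have "{\<omega>\<in>space (F (\<tau> k)). e < norm (X (\<tau> k) \<omega>)} \<in> sets (F (\<tau> k))" by measurable
    ultimately have "{\<omega>\<in>space (F (\<tau> k)). e
        < norm (X (\<tau> k) \<omega>)} \<inter> {\<omega>\<in>space (F (\<tau> k)). \<forall>j\<in>{..<k}. norm (X (\<tau> j) \<omega>) \<le> e} \<in> sets (F (\<tau> k))"
      by (rule sets.Int[rotated])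
    moreover have "A k = {\<omega>\<in>space (F (\<tau> k)). e
        < norm (X (\<tau> k) \<omega>)} \<inter> {\<omega>\<in>space (F (\<tau> k)). \<forall>j\<in>{..<k}. norm (X (\<tau> j) \<omega>) \<le> e}"
      using \<tau>(1)[OF k] by (auto simp: A_def)
    ultimately show ?thesis by (simp only:)
  qed
  have AP [measurable]: "A k \<in> sets P" if "k \<le> N" for k
    using AF[OF that] subalgebra_F[of "\<tau> k"] \<tau>(1)[OF that] by (auto simp: subalgebra_def)
  have disj: "disjoint_family_on A {..N}"
    unfolding disjoint_family_on_def
  proof (intro ballI impI)
    fix i j :: nat assume "i \<noteq> j"
    then show "A i \<inter> A j = {}" by (auto simp: A_def) (metis linorder_neqE_nat not_le)
  qed
  have Un: "{\<omega>\<in>space P. \<exists>k\<le>N. e < norm (X (\<tau> k) \<omega>)} = (\<Union>k\<le>N. A k)"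
  proof (intro equalityI subsetI)
    fix \<omega> assume "\<omega> \<in> {\<omega>\<in>space P. \<exists>k\<le>N. e < norm (X (\<tau> k) \<omega>)}"
    then obtain k where k: "\<omega> \<in> space P" "k \<le> N" "e < norm (X (\<tau> k) \<omega>)" by auto
    define l where "l = (LEAST k. e < norm (X (\<tau> k) \<omega>))"
    have "e < norm (X (\<tau> l) \<omega>)" "l \<le> k" "\<forall>j<l. norm (X (\<tau> j) \<omega>) \<le> e"
      unfolding l_def using k(3) by (auto intro: LeastI Least_le dest: not_less_Least simp:
          not_less)
    then show "\<omega> \<in> (\<Union>k\<le>N. A k)" using k by (auto simp: A_def intro!: bexI[of _ l])
  qed (auto simp: A_def)
  have XT: "sq_integrable P (X T)" using l2_martingaleD(2)[OF X] T by simp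
  have intA: "integrable P (\<lambda>\<omega>. indicator (A k) \<omega> * (norm (X T \<omega>))\<^sup>2)" if "k \<le> N" for k
    using integrable_mult_indicator[OF AP[OF that] sq_integrableD(2)[OF XT]] by simp
  have step: "e\<^sup>2 * measure P (A k) \<le> (\<integral>\<omega>. indicator (A k) \<omega> * (norm (X T \<omega>))\<^sup>2 \<partial>P)" if k: "k \<le> N"
      for k
  proof -
    have \<tau>k: "0 \<le> \<tau> k" "\<tau> k \<le> T" using \<tau>(1)[OF k] by auto
    have Xk: "sq_integrable P (X (\<tau> k))" by (rule l2_martingaleD(2)[OF X \<tau>k])
    have ind: "sq_integrable P (\<lambda>\<omega>. indicator (A k) \<omega> *\<^sub>R f \<omega>)" if "sq_integrable P f"
        for f :: "'w \<Rightarrow> 'b"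
      by (rule sq_integrable_bounded_scaleR[OF that borel_measurable_indicator[OF AP[OF k]], where C
          = 1])
        (simp add: indicator_def)
    \<comment> \<open>On \<open>A k\<close> the terminal value is the value at
      \<open>\<tau> k\<close> plus the later increment. They are orthogonal because
      \<open>A k\<close> belongs to \<open>F (\<tau> k)\<close>, so the second moment over
      \<open>A k\<close> can only grow up to time \<open>T\<close>.\<close>
    let ?f = "\<lambda>\<omega>. indicator (A k) \<omega> *\<^sub>R X (\<tau> k) \<omega>"
        and ?g = "\<lambda>\<omega>. indicator (A k) \<omega> *\<^sub>R (X T \<omega> - X (\<tau> k) \<omega>)"
    have f: "sq_integrable P ?f" by (rule ind[OF Xk])
    have g: "sq_integrable P ?g" by (rule ind[OF sq_integrable_diff[OF XT Xk]])
    have "?f \<in> borel_measurable (F (\<tau> k))"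
      using AF[OF k] l2_martingaleD(1)[OF X \<tau>k] by simp
    from l2_martingaleD(3)[OF X \<tau>k order_refl this f]
    have "(\<integral>\<omega>. ?f \<omega> \<bullet> (X T \<omega> - X (\<tau> k) \<omega>) \<partial>P) = 0" .
    moreover have "?f \<omega> \<bullet> ?g \<omega> = ?f \<omega> \<bullet> (X T \<omega> - X (\<tau> k) \<omega>)" for \<omega> by (simp add: indicator_def)
    ultimately have "(\<integral>\<omega>. ?f \<omega> \<bullet> ?g \<omega> \<partial>P) = 0" by presburger
    then have "(\<integral>\<omega>. (norm (?f \<omega>))\<^sup>2 \<partial>P) \<le> (\<integral>\<omega>. (norm (?f \<omega> + ?g \<omega>))\<^sup>2 \<partial>P)"
      unfolding sq_integral_add[OF f g] by simp
    moreover have "(norm (?f \<omega> + ?g \<omega>))\<^sup>2 = indicator (A k) \<omega> * (norm (X T \<omega>))\<^sup>2" for \<omega>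
      by (simp add: indicator_def)
    ultimately have 1: "(\<integral>\<omega>. (norm (?f \<omega>))\<^sup>2 \<partial>P) \<le> (\<integral>\<omega>. indicator (A k) \<omega> * (norm (X T \<omega>))\<^sup>2 \<partial>P)"
      by (simp only:)
    have "e\<^sup>2 * measure P (A k) = (\<integral>\<omega>. e\<^sup>2 * indicator (A k) \<omega> \<partial>P)" using AP[OF k] by simp
    also have "\<dots> \<le> (\<integral>\<omega>. (norm (?f \<omega>))\<^sup>2 \<partial>P)"
    proof (rule integral_mono)
      show "integrable P (\<lambda>\<omega>. e\<^sup>2 * indicator (A k) \<omega>)" using AP[OF k]
          by (simp add: less_top[symmetric])
      show "integrable P (\<lambda>\<omega>. (norm (?f \<omega>))\<^sup>2)" by (rule sq_integrableD(2)[OF f])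
      show "e\<^sup>2 * indicator (A k) \<omega> \<le> (norm (?f \<omega>))\<^sup>2" for \<omega>
        using e by (auto simp: indicator_def A_def intro!: power_mono less_imp_le)
    qed
    finally show ?thesis using 1 by simp
  qed
  have "e\<^sup>2 * measure P (\<Union>k\<le>N. A k) = (\<Sum>k\<le>N. e\<^sup>2 * measure P (A k))"
  proof -
    have "A ` {..N} \<subseteq> sets P" using AP by blast
    then show ?thesis using finite_measure_finite_Union[OF _ _ disj] by (simp add: sum_distrib_left)
  qed
  also have "\<dots> \<le> (\<Sum>k\<le>N. \<integral>\<omega>. indicator (A k) \<omega> * (norm (X T \<omega>))\<^sup>2 \<partial>P)"
    by (intro sum_mono step) simp
  also have "\<dots> = (\<integral>\<omega>. (\<Sum>k\<le>N. indicator (A k) \<omega> * (norm (X T \<omega>))\<^sup>2) \<partial>P)"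
    using intA by (intro Bochner_Integration.integral_sum[symmetric]) auto
  also have "\<dots> \<le> (\<integral>\<omega>. (norm (X T \<omega>))\<^sup>2 \<partial>P)"
  proof (rule integral_mono)
    show "integrable P (\<lambda>\<omega>. \<Sum>k\<le>N. indicator (A k) \<omega> * (norm (X T \<omega>))\<^sup>2)"
      by (rule Bochner_Integration.integrable_sum) (use intA in simp)
    show "integrable P (\<lambda>\<omega>. (norm (X T \<omega>))\<^sup>2)" by (rule sq_integrableD(2)[OF XT])
    have "(\<Sum>k\<le>N. indicator (A k) \<omega> :: real) = indicator (\<Union>k\<le>N. A k) \<omega>" for \<omega>
      by (rule indicator_UN_disjoint[OF _ disj, symmetric]) simp
    then show "(\<Sum>k\<le>N. indicator (A k) \<omega> * (norm (X T \<omega>))\<^sup>2) \<le> (norm (X T \<omega>))\<^sup>2" for \<omega>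
      by (simp add: sum_distrib_right[symmetric] indicator_def)
  qed
  finally show ?thesis unfolding Un .
qed

text \<open>Dyadic grids are nested, so the exceedance events increase and the bound for each grid
  passes to their union. Off the union the path is bounded at all grid points, hence everywhere if
  it is continuous. Phrasing the result with a measurable set \<open>A\<close> avoids measuring a
  supremum over an interval.\<close>

lemma l2_martingale_maximal:
  fixes X :: "real \<Rightarrow> 'w \<Rightarrow> 'b :: euclidean_space"
  assumes T: "0 < T" and X: "l2_martingale T X"
      and cont: "AE \<omega> in P. continuous_on {0..T} (\<lambda>t. X t \<omega>)" and e: "0 < e"
  obtains A where "A \<in> sets P" "measure P A \<le> (\<integral>\<omega>. (norm (X T \<omega>))\<^sup>2 \<partial>P) / e\<^sup>2"
    "AE \<omega> in P. \<omega> \<notin> A \<longrightarrow> (\<forall>t\<in>{0..T}. norm (X t \<omega>) \<le> e)"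
proof -
  define \<tau> where "\<tau> n k = real k * T / 2 ^ n" for n k :: nat
  have \<tau>: "0 \<le> \<tau> n k \<and> \<tau> n k \<le> T" if "k \<le> 2 ^ n" for n k
  proof -
    have "real k \<le> 2 ^ n" using that by (metis of_nat_le_iff of_nat_numeral of_nat_power)
    then show ?thesis using T by (auto simp: \<tau>_def field_simps)
  qed
  define A where "A n = {\<omega>\<in>space P. \<exists>k\<le>2 ^ n. e < norm (X (\<tau> n k) \<omega>)}" for n
  have XP [measurable]: "X (\<tau> n k) \<in> borel_measurable P" if "k \<le> 2 ^ n" for n k
    using sq_integrableD(1)[OF l2_martingaleD(2)[OF X]] \<tau>[OF that] by blast
  have AP: "A n \<in> sets P" for n
  proof -
    have "{\<omega>\<in>space P. e < norm (X (\<tau> n k) \<omega>)} \<in> sets P" if "k \<in> {..2 ^ n}" for k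
    proof -
      have [measurable]: "X (\<tau> n k) \<in> borel_measurable P" using that by (intro XP) simp
      show ?thesis by measurable
    qed
    then have "{\<omega>\<in>space P. \<exists>k\<in>{..2 ^ n}. e < norm (X (\<tau> n k) \<omega>)} \<in> sets P"
      by (intro sets.sets_Collect_finite_Ex) auto
    moreover have "A n = {\<omega>\<in>space P. \<exists>k\<in>{..2 ^ n}. e < norm (X (\<tau> n k) \<omega>)}" by (auto simp: A_def)
    ultimately show ?thesis by simp
  qed
  have "incseq A"
  proof (rule incseq_SucI)
    fix n
    \<comment> \<open>Nestedness of the grids: point \<open>k\<close> of one level is point
      \<open>2 * k\<close> of the next.\<close>
    have "\<tau> n k = \<tau> (Suc n) (2 * k)" for k :: nat by (simp add: \<tau>_def)
    moreover have "2 * k \<le> 2 ^ Suc n" if "k \<le> 2 ^ n" for k :: nat using that by simp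
    ultimately show "A n \<subseteq> A (Suc n)" unfolding A_def by fastforce
  qed
  have bound: "measure P (A n) \<le> (\<integral>\<omega>. (norm (X T \<omega>))\<^sup>2 \<partial>P) / e\<^sup>2" for n
  proof -
    have "\<tau> n j \<le> \<tau> n k" if "j \<le> k" for j k using that T by (simp add: \<tau>_def divide_right_mono)
    then have "e\<^sup>2 * measure P (A n) \<le> (\<integral>\<omega>. (norm (X T \<omega>))\<^sup>2 \<partial>P)"
      unfolding A_def by (intro l2_martingale_maximal_discrete[OF X e] \<tau>)
    then show ?thesis using e by (simp add: field_simps)
  qed
  have lim: "(\<lambda>n. measure P (A n)) \<longlonglongrightarrow> measure P (\<Union>n. A n)"
    by (rule finite_Lim_measure_incseq) (use AP \<open>incseq A\<close> in auto)
  show ?thesis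
  proof (rule that[of "\<Union>n. A n"])
    show "(\<Union>n. A n) \<in> sets P" using AP by auto
    show "measure P (\<Union>n. A n) \<le> (\<integral>\<omega>. (norm (X T \<omega>))\<^sup>2 \<partial>P) / e\<^sup>2"
      by (rule LIMSEQ_le_const2[OF lim]) (use bound in auto)
    show "AE \<omega> in P. \<omega> \<notin> (\<Union>n. A n) \<longrightarrow> (\<forall>t\<in>{0..T}. norm (X t \<omega>) \<le> e)"
    proof -
      have "norm (X t \<omega>) \<le> e" if \<omega>: "\<omega> \<in> space P" and c: "continuous_on {0..T} (\<lambda>t. X t \<omega>)"
        and A: "\<omega> \<notin> (\<Union>n. A n)" and t: "t \<in> {0..T}" for t \<omega>
      proof -
        \<comment> \<open>The last grid point of level \<open>n\<close> that is not after
          \<open>t\<close>; it is less than one mesh \<open>T / 2 ^ n\<close> away from it.\<close>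
        define k where "k n = nat \<lfloor>t * 2 ^ n / T\<rfloor>" for n :: nat
        have nn: "0 \<le> t * 2 ^ n / T" for n :: nat using t T by auto
        have le: "real (k n) \<le> t * 2 ^ n / T" for n
          unfolding k_def using nn[of n] by (simp add: of_nat_nat)
        have gt: "t * 2 ^ n / T < real (k n) + 1" for n
          unfolding k_def using nn[of n] by (simp add: of_nat_nat)
        have "real (k n) \<le> 2 ^ n" for n
        proof -
          have "t * 2 ^ n / T \<le> 2 ^ n" using t T by (simp add: field_simps)
          then show ?thesis using le[of n] by linarith
        qed
        then have k: "k n \<le> 2 ^ n" for n
          by (metis of_nat_le_iff of_nat_numeral of_nat_power)
        have b: "\<tau> n (k n) \<le> t" "t \<le> \<tau> n (k n) + T * (1 / 2) ^ n" for n
          using le[of n] gt[of n] T by (auto simp: \<tau>_def field_simps power_one_over)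
        have "(\<lambda>n. (1 / 2 :: real) ^ n) \<longlonglongrightarrow> 0" by (rule LIMSEQ_power_zero) simp
        then have "(\<lambda>n. T * (1 / 2) ^ n) \<longlonglongrightarrow> T * 0" by (rule tendsto_mult[OF tendsto_const])
        then have "(\<lambda>n. t - T * (1 / 2) ^ n) \<longlonglongrightarrow> t - T * 0" by (rule tendsto_diff[OF tendsto_const])
        then have l: "(\<lambda>n. t - T * (1 / 2) ^ n) \<longlonglongrightarrow> t" by simp
        have "t - T * (1 / 2) ^ n \<le> \<tau> n (k n)" for n using b(2)[of n] by linarith
        then have "(\<lambda>n. \<tau> n (k n)) \<longlonglongrightarrow> t"
          by (intro tendsto_sandwich[OF _ _ l tendsto_const] always_eventually allI b(1))
        then have "(\<lambda>n. X (\<tau> n (k n)) \<omega>) \<longlonglongrightarrow> X t \<omega>"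
          by (rule continuous_on_tendsto_compose[OF c]) (use t \<tau>[OF k] in auto)
        then have l: "(\<lambda>n. norm (X (\<tau> n (k n)) \<omega>)) \<longlonglongrightarrow> norm (X t \<omega>)" by (rule tendsto_norm)
        have "norm (X (\<tau> n (k n)) \<omega>) \<le> e" for n using A \<omega> k[of n] by (auto simp: A_def not_less)
        then show ?thesis by (intro LIMSEQ_le_const2[OF l]) auto
      qed
      note bound_on = this
      show ?thesis
        using cont AE_space
      proof eventually_elim
        case (elim \<omega>)
        then show ?case by (intro impI ballI bound_on)
      qed
    qed
  qed
qed

text \<open>The maximal inequality with right-hand side \<open>0\<close>, applied at the levels
  \<open>1 / (n + 1)\<close>. It upgrades information about the terminal time to the whole path, and
  so identifies martingales up to indistinguishability.\<close>

lemma l2_martingale_eq_0: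
  assumes T: "0 < T" and X: "l2_martingale T X"
      and cont: "AE \<omega> in P. continuous_on {0..T} (\<lambda>t. X t \<omega>)"
    and z: "(\<integral>\<omega>. (norm (X T \<omega>))\<^sup>2 \<partial>P) = 0"
  shows "AE \<omega> in P. \<forall>t\<in>{0..T}. X t \<omega> = 0"
proof -
  have "AE \<omega> in P. \<forall>t\<in>{0..T}. norm (X t \<omega>) \<le> inverse (real (Suc n))" for n
  proof -
    obtain A where A: "A \<in> sets P" "measure P A \<le> 0"
      "AE \<omega> in P. \<omega> \<notin> A \<longrightarrow> (\<forall>t\<in>{0..T}. norm (X t \<omega>) \<le> inverse (real (Suc n)))"
      using l2_martingale_maximal[OF T X cont, of "inverse (real (Suc n))"] z by auto
    then have "A \<in> null_sets P" by (simp add: null_sets_def emeasure_eq_measure measure_le_0_iff)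
    then have "AE \<omega> in P. \<omega> \<notin> A" by (rule AE_not_in)
    with A(3) show ?thesis by eventually_elim simp
  qed
  then have "AE \<omega> in P. \<forall>n. \<forall>t\<in>{0..T}. norm (X t \<omega>) \<le> inverse (real (Suc n))"
    by (simp add: AE_all_countable)
  then show ?thesis
  proof eventually_elim
    case (elim \<omega>)
    have "X t \<omega> = 0" if "t \<in> {0..T}" for t
    proof (rule ccontr)
      assume "X t \<omega> \<noteq> 0"
      then obtain n where "inverse (real (Suc n)) < norm (X t \<omega>)"
        using reals_Archimedean[of "norm (X t \<omega>)"] by auto
      then show False using elim that by (meson not_le)
    qed
    then show ?case by simp
  qed
qed

end

section \<open>Stochastic integrals of simple processes\<close>

lemma simple_adapted_times:
  assumes s: "simple_adapted P F T s"
  shows "\<And>i j. i \<le> j \<Longrightarrow> j \<le> steps s \<Longrightarrow> time s i \<le> time s j"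
    and "\<And>i. i \<le> steps s \<Longrightarrow> 0 \<le> time s i" and "\<And>i. i \<le> steps s \<Longrightarrow> time s i \<le> T"
proof -
  show mono: "time s i \<le> time s j" if "i \<le> j" "j \<le> steps s" for i j
    using that
  proof (induction j rule: dec_induct)
    case (step j)
    then have "time s j \<le> time s (Suc j)" using s by (simp add: simple_adapted_def)
    then show ?case using step by simp
  qed simp
  fix i assume i: "i \<le> steps s"
  show "0 \<le> time s i" using mono[of 0 i] i s by (simp add: simple_adapted_def)
  show "time s i \<le> T" using mono[of i "steps s"] i s by (simp add: simple_adapted_def)
qed

context filtered_prob_space begin

text \<open>The counterpart of \<open>increment_covariance\<close> on the side of the integrands,
  with the same overlap length.\<close>

lemma has_bochner_integral_time_prod:
  assumes abcd: "0 \<le> a" "a \<le> b" "b \<le> T" "0 \<le> c" "c \<le> d" "d \<le> T"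
    and Z: "Z \<in> borel_measurable P" "\<And>\<omega>. \<omega> \<in> space P \<Longrightarrow> \<bar>Z \<omega>\<bar> \<le> C"
  shows "has_bochner_integral (time_prod P T)
    (\<lambda>p. indicator {a<..b} (fst p) * indicator {c<..d} (fst p) * Z (snd p))
    ((\<integral>\<omega>. Z \<omega> \<partial>P) * max 0 (min b d - max a c))"
proof -
  interpret pair_sigma_finite "restrict_space lborel {0..T}" P by (rule pair_sigma_finite_time)
  interpret MT: finite_measure "time_prod P T" by (rule finite_measure_time_prod)
  note [measurable] = Z(1)
  let ?f = "\<lambda>p :: real \<times> 'w. indicator {a<..b} (fst p) * indicator {c<..d} (fst p) * Z (snd p)"
  have fst [measurable]: "fst \<in> borel_measurable (time_prod P T)"
    using measurable_compose[OF measurable_fst measurable_restrict_space1[of "\<lambda>x. x" lborel borel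
        "{0..T}"]] by simp
  have [measurable]: "?f \<in> borel_measurable (time_prod P T)" by measurable
  have int: "integrable (time_prod P T) ?f"
  proof (rule MT.integrable_const_bound[where B = "\<bar>C\<bar>"])
    show "AE p in time_prod P T. norm (?f p) \<le> \<bar>C\<bar>"
    proof (rule AE_I2)
      fix p assume "p \<in> space (time_prod P T)"
      then have "snd p \<in> space P" by (auto simp: space_pair_measure)
      then show "norm (?f p) \<le> \<bar>C\<bar>" using Z(2)[of "snd p"] by (auto simp: indicator_def)
    qed
  qed measurable
  have "(\<integral>p. ?f p \<partial>time_prod P T) = (\<integral>t. (\<integral>\<omega>. ?f (t, \<omega>) \<partial>P) \<partial>restrict_space lborel {0..T})"
    by (rule integral_fst'[OF int, symmetric])
  also have "\<dots> = (\<integral>t. indicator {a<..b} t * indicator {c<..d} t * (\<integral>\<omega>. Z \<omega> \<partial>P)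
      \<partial>restrict_space lborel {0..T})"
    by simp
  also have "\<dots> = (\<integral>t. indicator {a<..b} t * indicator {c<..d} t \<partial>restrict_space lborel {0..T})
      * (\<integral>\<omega>. Z \<omega> \<partial>P)"
    by simp
  also have "(\<integral>t. (indicator {a<..b} t * indicator {c<..d} t :: real) \<partial>restrict_space lborel {0..T})
      = (\<integral>t. indicator {0..T} t *\<^sub>R (indicator {a<..b} t * indicator {c<..d} t) \<partial>lborel)"
    by (rule integral_restrict_space) simp
  also have "\<dots> = (\<integral>t. indicator {max a c<..min b d} t \<partial>lborel)"
    using abcd by (intro Bochner_Integration.integral_cong) (auto simp: indicator_def)
  also have "\<dots> = max 0 (min b d - max a c)"
    by (cases "max a c \<le> min b d") (auto simp del: max.bounded_iff min.bounded_iff simp: max_def)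
  finally show ?thesis using int by (simp add: has_bochner_integral_iff mult.commute)
qed

lemma simple_process_L2a:
  fixes s :: "('w, 'b :: euclidean_space) simple_integrand"
  assumes s: "simple_adapted P F T s"
  shows "simple_process s \<in> L2a P F T (\<lambda>x. (norm x)\<^sup>2)"
  unfolding L2a_iff
proof (intro conjI ballI)
  have fst [measurable]: "fst \<in> borel_measurable (time_prod P T)"
    using measurable_compose[OF measurable_fst measurable_restrict_space1[of "\<lambda>x. x" lborel borel
        "{0..T}"]] by simp
  have H: "height s i \<in> borel_measurable (F (time s i))" "\<exists>C. \<forall>\<omega>\<in>space P. norm (height s i \<omega>) \<le> C"
    if "i < steps s" for i using s that by (auto simp: simple_adapted_def)
  have "sq_integrable (time_prod P T) (\<lambda>p. indicator {time s i<..time s (Suc i)} (fst p)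
      *\<^sub>R height s i (snd p))"
    if i: "i < steps s" for i
  proof -
    obtain C where C: "\<And>\<omega>. \<omega> \<in> space P \<Longrightarrow> norm (height s i \<omega>) \<le> C" using H(2)[OF i] by blast
    have "height s i \<in> borel_measurable P"
      using F_measurable[OF _ H(1)[OF i]] simple_adapted_times(2)[OF s] i by simp
    then have [measurable]: "(\<lambda>p. height s i (snd p)) \<in> borel_measurable (time_prod P T)"
      by (rule measurable_compose[OF measurable_snd])
    have ind: "(\<lambda>p. indicator {time s i<..time s (Suc i)} (fst p) :: real)
        \<in> borel_measurable (time_prod P T)"
      by (rule measurable_compose[OF fst]) simp
    have "sq_integrable (time_prod P T) (\<lambda>p. height s i (snd p))"
      by (rule sq_integrable_bounded[OF finite_measure_time_prod, where C = C])
        (auto simp: space_pair_measure intro: C)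
    then show ?thesis
      by (rule sq_integrable_bounded_scaleR[where C = 1, OF _ ind]) (simp add: indicator_def)
  qed
  then have "sq_integrable (time_prod P T)
      (\<lambda>p. \<Sum>i<steps s. indicator {time s i<..time s (Suc i)} (fst p) *\<^sub>R height s i (snd p))"
    by (intro sq_integrable_sum) simp
  then show "sq_integrable (time_prod P T) (case_prod (simple_process s))"
    by (simp add: simple_process_def case_prod_beta')
  fix t assume t: "t \<in> {0..T}"
  have "(\<lambda>\<omega>. indicator {time s i<..time s (Suc i)} t *\<^sub>R height s i \<omega>) \<in> borel_measurable (F t)"
    if i: "i < steps s" for i
  \<comment> \<open>Before \<open>time s i\<close> the indicator removes the summand; from then on
    the height is known.\<close>
  proof (cases "time s i \<le> t")
    case True
    then show ?thesis
      using F_measurable_mono[OF _ True H(1)[OF i]] simple_adapted_times(2)[OF s, of i] i by simp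
  qed simp
  then show "simple_process s t \<in> borel_measurable (F t)"
    unfolding simple_process_def[abs_def] by (intro borel_measurable_sum) simp
qed

end

context brownian_motion begin

text \<open>One summand of a simple integral. Unless its increment from \<open>r\<close> to
  \<open>t\<close> vanishes, it is \<open>H\<close> applied to the increment of \<open>W\<close>
  from \<open>max r a\<close> to \<open>min t b\<close>. At \<open>max r a\<close> both
  \<open>H\<close> and a test function of the past up to \<open>r\<close> are known, so their
  product is a weight from the past.\<close>

lemma l2_martingale_elementary:
  fixes H :: "'w \<Rightarrow> real ^ 'm ^ 'n"
  assumes ab: "0 \<le> a" "a \<le> b"
    and H: "H \<in> borel_measurable (F a)" "\<And>\<omega>. \<omega> \<in> space P \<Longrightarrow> norm (H \<omega>) \<le> C"
  shows "l2_martingale T (\<lambda>t \<omega>. H \<omega> *v (W (min t b) \<omega> - W (min t a) \<omega>))"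
proof -
  have H_nth: "\<bar>H \<omega> $ x $ y\<bar> \<le> C" if "\<omega> \<in> space P" for \<omega> x y
    using component_le_norm_cart[of "H \<omega> $ x" y] Finite_Cartesian_Product.norm_nth_le[of "H \<omega>" x]
        H(2)[OF that]
    by linarith
  have HF: "H \<in> borel_measurable (F r)" if "a \<le> r" for r
      by (rule F_measurable_mono[OF ab(1) that H(1)])
  have HF_nth: "(\<lambda>\<omega>. H \<omega> $ x $ y) \<in> borel_measurable (F r)" if "a \<le> r" for r x y
    by (intro borel_measurable_vec_nth HF that)
  have HP_nth: "(\<lambda>\<omega>. H \<omega> $ x $ y) \<in> borel_measurable P" for x y
    by (rule F_measurable[OF ab(1) HF_nth[OF order_refl]])
  have sq: "sq_integrable P (\<lambda>\<omega>. H \<omega> *v (W q \<omega> - W s \<omega>))" if "0 \<le> s" "s \<le> q" for s q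
  proof (rule sq_integrable_vecI)
    fix x
    have "sq_integrable P (\<lambda>\<omega>. \<Sum>y\<in>UNIV. H \<omega> $ x $ y *\<^sub>R ((W q \<omega> - W s \<omega>) $ y))"
      by (intro sq_integrable_sum sq_integrable_bounded_scaleR[OF sq_integrable_increment[OF that]
          HP_nth H_nth])
    then show "sq_integrable P (\<lambda>\<omega>. (H \<omega> *v (W q \<omega> - W s \<omega>)) $ x)"
      by (simp add: matrix_vector_mult_def)
  qed
  have orth: "(\<integral>\<omega>. Y \<omega> \<bullet> (H \<omega> *v (W q \<omega> - W s \<omega>)) \<partial>P) = 0"
    if sq: "0 \<le> s" "s \<le> q" "a \<le> s" and Y: "Y \<in> borel_measurable (F s)" "sq_integrable P Y" for s q Y
  proof -
    have "has_bochner_integral P (\<lambda>\<omega>. Y \<omega> $ x * H \<omega> $ x $ y * (W q \<omega> - W s \<omega>) $ y) 0" for x y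
    proof (rule weighted_increment_mean[OF sq(1,2)])
      show "(\<lambda>\<omega>. Y \<omega> $ x * H \<omega> $ x $ y) \<in> borel_measurable (F s)"
        by (intro borel_measurable_times HF_nth sq borel_measurable_vec_nth Y)
      have "sq_integrable P (\<lambda>\<omega>. H \<omega> $ x $ y *\<^sub>R (Y \<omega> $ x))"
        by (intro sq_integrable_bounded_scaleR[OF sq_integrable_vec_nth[OF Y(2)] HP_nth H_nth])
      from sq_integrable_integrable[OF finite_measure_axioms this]
      show "integrable P (\<lambda>\<omega>. Y \<omega> $ x * H \<omega> $ x $ y)" by (simp add: mult.commute)
    qed
    then have "has_bochner_integral P (\<lambda>\<omega>. \<Sum>x\<in>UNIV. \<Sum>y\<in>UNIV. Y \<omega> $ x * H \<omega> $ x $ y * (W q \<omega>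
        - W s \<omega>) $ y)
        (\<Sum>x\<in>(UNIV :: 'n set). \<Sum>y\<in>(UNIV :: 'm set). 0)"
      by (intro has_bochner_integral_sum)
    moreover have "Y \<omega> \<bullet> (H \<omega> *v (W q \<omega> - W s \<omega>))
        = (\<Sum>x\<in>UNIV. \<Sum>y\<in>UNIV. Y \<omega> $ x * H \<omega> $ x $ y * (W q \<omega> - W s \<omega>) $ y)" for \<omega>
      by (simp add: inner_vec_def matrix_vector_mult_def sum_distrib_left mult.assoc)
    ultimately show ?thesis by (simp add: has_bochner_integral_iff)
  qed
  show ?thesis
    unfolding l2_martingale_def
  proof (intro conjI allI impI)
    fix t assume t: "0 \<le> t" "t \<le> T"
    show "sq_integrable P (\<lambda>\<omega>. H \<omega> *v (W (min t b) \<omega> - W (min t a) \<omega>))"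
      using t ab by (intro sq) auto
    show "(\<lambda>\<omega>. H \<omega> *v (W (min t b) \<omega> - W (min t a) \<omega>)) \<in> borel_measurable (F t)"
    \<comment> \<open>Up to time \<open>a\<close> the height is not yet known, but the integral is
      still zero.\<close>
    proof (cases "t \<le> a")
      case True
      then have "min t b = min t a" using ab by auto
      then show ?thesis by simp
    next
      case False
      have Wm: "W (min t c) \<in> borel_measurable (F t)" if "0 \<le> c" for c
        using that t F_measurable_mono[OF _ _ W_adapted, of "min t c" t] by auto
      then show ?thesis
        using False ab by (intro borel_measurable_matrix_vector HF borel_measurable_diff Wm) auto
    qed
  next
    fix r t and Y :: "'w \<Rightarrow> real ^ 'n"
    assume rt: "0 \<le> r" "r \<le> t" "t \<le> T" and Y: "Y \<in> borel_measurable (F r)" "sq_integrable P Y"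
    let ?X = "\<lambda>t \<omega>. H \<omega> *v (W (min t b) \<omega> - W (min t a) \<omega>)"
    show "(\<integral>\<omega>. Y \<omega> \<bullet> (?X t \<omega> - ?X r \<omega>) \<partial>P) = 0"
    proof (cases "t \<le> a \<or> b \<le> r")
      case True
      then consider "min t b = min t a" "min r b = min r a" | "min t b = min r b" "min t a
          = min r a"
        using rt ab by fastforce
      then have "?X t \<omega> = ?X r \<omega>" for \<omega> by cases simp_all
      then show ?thesis by simp
    next
      case False
      have Ys: "Y \<in> borel_measurable (F (max r a))" using F_measurable_mono[OF rt(1) _ Y(1)] by simp
      have "?X t \<omega> - ?X r \<omega> = H \<omega> *v (W (min t b) \<omega> - W (max r a) \<omega>)" for \<omega>
        using False rt ab
        by (cases "r \<le> a") (simp_all add: min_def max_def matrix_vector_mult_diff_distrib)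
      then show ?thesis using orth[OF _ _ _ Ys Y(2), of "min t b"] False rt ab by simp
    qed
  qed
qed

lemma l2_martingale_simple:
  fixes s :: "('w, real ^ 'm ^ 'n) simple_integrand"
  assumes s: "simple_adapted P F T s"
  shows "l2_martingale T (simple_integral W s)"
proof -
  have "l2_martingale T (\<lambda>t \<omega>. \<Sum>i<steps s. height s i \<omega> *v
      (W (min t (time s (Suc i))) \<omega> - W (min t (time s i)) \<omega>))"
  proof (rule l2_martingale_sum)
    fix i assume i: "i \<in> {..<steps s}"
    then obtain C where "\<forall>\<omega>\<in>space P. norm (height s i \<omega>) \<le> C" "height s i
        \<in> borel_measurable (F (time s i))"
      using s by (auto simp: simple_adapted_def)
    then show "l2_martingale T (\<lambda>t \<omega>. height s i \<omega> *v (W (min t (time s (Suc i))) \<omega>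
        - W (min t (time s i)) \<omega>))"
      using i simple_adapted_times[OF s] by (intro l2_martingale_elementary) auto
  qed
  moreover have "simple_integral W s = (\<lambda>t \<omega>. \<Sum>i<steps s. height s i \<omega> *v
      (W (min t (time s (Suc i))) \<omega> - W (min t (time s i)) \<omega>))"
    by (simp add: fun_eq_iff simple_integral_def)
  ultimately show ?thesis by simp
qed

lemma continuous_simple_integral:
  fixes s :: "('w, real ^ 'm ^ 'n) simple_integrand"
  assumes s: "simple_adapted P F T s"
  shows "AE \<omega> in P. continuous_on {0..T} (\<lambda>t. simple_integral W s t \<omega>)"
  using W_continuous
proof eventually_elim
  case (elim \<omega>)
  have "continuous_on {0..T} (\<lambda>t. W (min t c) \<omega>)" if "0 \<le> c" for c
    by (rule continuous_on_compose2[OF elim]) (use that in \<open>auto intro!: continuous_intros\<close>)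
  then show ?case
    unfolding simple_integral_def using simple_adapted_times[OF s]
    by (intro continuous_on_sum bounded_linear.continuous_on[OF matrix_vector_mul_bounded_linear]
        continuous_on_diff) auto
qed

lemma simple_height:
  fixes s :: "('w, real ^ 'm ^ 'n) simple_integrand"
  assumes s: "simple_adapted P F T s" and i: "i < steps s"
  obtains C where "\<And>x y. (\<lambda>\<omega>. height s i \<omega> $ x $ y) \<in> borel_measurable (F (time s i))"
    "\<And>\<omega> x y. \<omega> \<in> space P \<Longrightarrow> \<bar>height s i \<omega> $ x $ y\<bar> \<le> C"
proof -
  obtain C where C: "\<forall>\<omega>\<in>space P. norm (height s i \<omega>) \<le> C"
      and H: "height s i \<in> borel_measurable (F (time s i))"
    using s i by (auto simp: simple_adapted_def)
  show ?thesis
  proof (rule that)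
    show "(\<lambda>\<omega>. height s i \<omega> $ x $ y) \<in> borel_measurable (F (time s i))" for x y
      by (intro borel_measurable_vec_nth H)
    show "\<bar>height s i \<omega> $ x $ y\<bar> \<le> C" if "\<omega> \<in> space P" for \<omega> x y
      using component_le_norm_cart[of "height s i \<omega> $ x" y]
        Finite_Cartesian_Product.norm_nth_le[of "height s i \<omega>" x] C that by force
  qed
qed

text \<open>The two partitions need not be related, and no common refinement is formed: both sides
  are expanded into the same sum over matrix entries and pairs of cells, where the overlaps do the
  work of a refinement.\<close>

lemma simple_integral_isometry:
  fixes s s' :: "('w, real ^ 'm ^ 'n) simple_integrand"
  assumes s: "simple_adapted P F T s" and s': "simple_adapted P F T s'"
  shows "(\<integral>\<omega>. simple_integral W s T \<omega> \<bullet> simple_integral W s' T \<omega> \<partial>P)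
    = (\<integral>p. case_prod (simple_process s) p \<bullet> case_prod (simple_process s') p \<partial>time_prod P T)"
proof -
  let ?H = "height s" and ?K = "height s'" and ?N = "{..<steps s}" and ?N' = "{..<steps s'}"
  let ?D = "\<lambda>i \<omega>. W (time s (Suc i)) \<omega> - W (time s i) \<omega>"
  let ?D' = "\<lambda>i \<omega>. W (time s' (Suc i)) \<omega> - W (time s' i) \<omega>"
  let ?L = "\<lambda>i k. max 0 (min (time s (Suc i)) (time s' (Suc k)) - max (time s i) (time s' k))"
  \<comment> \<open>The common contribution of the entry in row \<open>x\<close> and column
    \<open>y\<close> for the cells \<open>i\<close> and \<open>k\<close> to both sides.\<close>
  define E where "E x y i k = (\<integral>\<omega>. ?H i \<omega> $ x $ y * ?K k \<omega> $ x $ y \<partial>P) * ?L i k" for x y i k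
  note t = simple_adapted_times[OF s] and t' = simple_adapted_times[OF s']
  have nth: "simple_integral W s T \<omega> $ x = (\<Sum>y\<in>UNIV. \<Sum>i\<in>?N. ?H i \<omega> $ x $ y * ?D i \<omega> $ y)" for \<omega> x
  proof -
    have "simple_integral W s T \<omega> = (\<Sum>i\<in>?N. ?H i \<omega> *v ?D i \<omega>)"
      unfolding simple_integral_def using t by (intro sum.cong) (auto simp: min_absorb2)
    then have "simple_integral W s T \<omega> $ x = (\<Sum>i\<in>?N. \<Sum>y\<in>UNIV. ?H i \<omega> $ x $ y * ?D i \<omega> $ y)"
      by (simp add: matrix_vector_mult_def)
    then show ?thesis by (subst sum.swap)
  qed
  have nth': "simple_integral W s' T \<omega> $ x = (\<Sum>y\<in>UNIV. \<Sum>i\<in>?N'. ?K i \<omega> $ x $ y * ?D' i \<omega> $ y)"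
      for \<omega> x
  proof -
    have "simple_integral W s' T \<omega> = (\<Sum>i\<in>?N'. ?K i \<omega> *v ?D' i \<omega>)"
      unfolding simple_integral_def using t' by (intro sum.cong) (auto simp: min_absorb2)
    then have "simple_integral W s' T \<omega> $ x = (\<Sum>i\<in>?N'. \<Sum>y\<in>UNIV. ?K i \<omega> $ x $ y * ?D' i \<omega> $ y)"
      by (simp add: matrix_vector_mult_def)
    then show ?thesis by (subst sum.swap)
  qed
  \<comment> \<open>Different coordinates \<open>y\<close> and \<open>z\<close> of \<open>W\<close>
    are uncorrelated even with these weights, so only the diagonal survives.\<close>
  have "has_bochner_integral P (\<lambda>\<omega>. ?H i \<omega> $ x $ y * ?D i \<omega> $ y * (?K k \<omega> $ x $ z * ?D' k \<omega> $ z))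
      (if y = z then E x y i k else 0)" if i: "i \<in> ?N" and k: "k \<in> ?N'" for x y z i k
  proof -
    obtain C where C: "\<And>x y. (\<lambda>\<omega>. ?H i \<omega> $ x $ y) \<in> borel_measurable (F (time s i))"
      "\<And>\<omega> x y. \<omega> \<in> space P \<Longrightarrow> \<bar>?H i \<omega> $ x $ y\<bar> \<le> C" using simple_height[OF s, of i] i by auto
    obtain C' where C': "\<And>x y. (\<lambda>\<omega>. ?K k \<omega> $ x $ y) \<in> borel_measurable (F (time s' k))"
      "\<And>\<omega> x y. \<omega> \<in> space P \<Longrightarrow> \<bar>?K k \<omega> $ x $ y\<bar> \<le> C'" using simple_height[OF s', of k] k by auto
    have ab: "0 \<le> time s i" "time s i \<le> time s (Suc i)" "0 \<le> time s' k" "time s' k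
        \<le> time s' (Suc k)"
      using t t' i k by auto
    show ?thesis
      using increment_covariance[OF ab C(1)[of x y] C(2)[of _ x y] C'(1)[of x z] C'(2)[of _ x z], of
          y z] unfolding E_def
      by (cases "y = z") simp_all
  qed
  then have "has_bochner_integral P
      (\<lambda>\<omega>. \<Sum>x\<in>UNIV. \<Sum>y\<in>UNIV. \<Sum>z\<in>UNIV. \<Sum>i\<in>?N. \<Sum>k\<in>?N'.
        ?H i \<omega> $ x $ y * ?D i \<omega> $ y * (?K k \<omega> $ x $ z * ?D' k \<omega> $ z))
      (\<Sum>x\<in>UNIV. \<Sum>y\<in>UNIV. \<Sum>z\<in>UNIV. \<Sum>i\<in>?N. \<Sum>k\<in>?N'. if y = z then E x y i k else 0)"
    by (intro has_bochner_integral_sum)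
  moreover have "(\<Sum>z\<in>UNIV. \<Sum>i\<in>?N. \<Sum>k\<in>?N'.
      if y = z then E x y i k else 0) = (\<Sum>i\<in>?N. \<Sum>k\<in>?N'. E x y i k)" for x y
  proof -
    have "(\<Sum>z\<in>UNIV. \<Sum>i\<in>?N. \<Sum>k\<in>?N'. if y = z then E x y i k else 0)
        = (\<Sum>z\<in>UNIV. if y = z then \<Sum>i\<in>?N. \<Sum>k\<in>?N'. E x y i k else 0)"
      by (intro sum.cong) auto
    then show ?thesis by simp
  qed
  moreover have "simple_integral W s T \<omega> \<bullet> simple_integral W s' T \<omega>
      = (\<Sum>x\<in>UNIV. \<Sum>y\<in>UNIV. \<Sum>z\<in>UNIV. \<Sum>i\<in>?N. \<Sum>k\<in>?N'.
        ?H i \<omega> $ x $ y * ?D i \<omega> $ y * (?K k \<omega> $ x $ z * ?D' k \<omega> $ z))" for \<omega>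
    unfolding inner_vec_def[of "simple_integral W s T \<omega>"] nth nth' inner_real_def sum_product ..
  ultimately have P: "(\<integral>\<omega>. simple_integral W s T \<omega> \<bullet> simple_integral W s' T \<omega> \<partial>P)
      = (\<Sum>x\<in>UNIV. \<Sum>y\<in>UNIV. \<Sum>i\<in>?N. \<Sum>k\<in>?N'. E x y i k)"
    unfolding has_bochner_integral_iff by presburger
  have "has_bochner_integral (time_prod P T)
      (\<lambda>p. indicator {time s i<..time s (Suc i)} (fst p)
          * indicator {time s' k<..time s' (Suc k)} (fst p)
        * (?H i (snd p) $ x $ y * ?K k (snd p) $ x $ y)) (E x y i k)" if i: "i \<in> ?N"
            and k: "k \<in> ?N'" for x y i k
  proof -
    obtain C where C: "\<And>x y. (\<lambda>\<omega>. ?H i \<omega> $ x $ y) \<in> borel_measurable (F (time s i))"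
      "\<And>\<omega> x y. \<omega> \<in> space P \<Longrightarrow> \<bar>?H i \<omega> $ x $ y\<bar> \<le> C" using simple_height[OF s, of i] i by auto
    obtain C' where C': "\<And>x y. (\<lambda>\<omega>. ?K k \<omega> $ x $ y) \<in> borel_measurable (F (time s' k))"
      "\<And>\<omega> x y. \<omega> \<in> space P \<Longrightarrow> \<bar>?K k \<omega> $ x $ y\<bar> \<le> C'" using simple_height[OF s', of k] k by auto
    have ab: "0 \<le> time s i" "time s i \<le> time s (Suc i)" "time s (Suc i) \<le> T"
      "0 \<le> time s' k" "time s' k \<le> time s' (Suc k)" "time s' (Suc k) \<le> T"
      using t t' i k by auto
    show ?thesis
      unfolding E_def
    proof (rule has_bochner_integral_time_prod[OF ab, where C = "C * C'"])
      show "(\<lambda>\<omega>. ?H i \<omega> $ x $ y * ?K k \<omega> $ x $ y) \<in> borel_measurable P"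
        by (intro borel_measurable_times F_measurable[OF ab(1) C(1)] F_measurable[OF ab(4) C'(1)])
      show "\<bar>?H i \<omega> $ x $ y * ?K k \<omega> $ x $ y\<bar> \<le> C * C'" if "\<omega> \<in> space P" for \<omega>
        unfolding abs_mult using order_trans[OF abs_ge_zero C(2)[OF that]]
        by (intro mult_mono C(2) C'(2) that) auto
    qed
  qed
  then have "has_bochner_integral (time_prod P T)
      (\<lambda>p. \<Sum>x\<in>UNIV. \<Sum>y\<in>UNIV. \<Sum>i\<in>?N. \<Sum>k\<in>?N'.
        indicator {time s i<..time s (Suc i)} (fst p)
            * indicator {time s' k<..time s' (Suc k)} (fst p)
        * (?H i (snd p) $ x $ y * ?K k (snd p) $ x $ y))
      (\<Sum>x\<in>UNIV. \<Sum>y\<in>UNIV. \<Sum>i\<in>?N. \<Sum>k\<in>?N'. E x y i k)"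
    by (intro has_bochner_integral_sum)
  moreover have "case_prod (simple_process s) p \<bullet> case_prod (simple_process s') p
      = (\<Sum>x\<in>UNIV. \<Sum>y\<in>UNIV. \<Sum>i\<in>?N. \<Sum>k\<in>?N'.
        indicator {time s i<..time s (Suc i)} (fst p)
            * indicator {time s' k<..time s' (Suc k)} (fst p)
        * (?H i (snd p) $ x $ y * ?K k (snd p) $ x $ y))" for p
  proof -
    have sp: "case_prod (simple_process s) p $ x $ y
        = (\<Sum>i\<in>?N. indicator {time s i<..time s (Suc i)} (fst p) * ?H i (snd p) $ x $ y)"
      "case_prod (simple_process s') p $ x $ y
        = (\<Sum>i\<in>?N'. indicator {time s' i<..time s' (Suc i)} (fst p) * ?K i (snd p) $ x $ y)" for x y
      by (simp_all add: simple_process_def case_prod_beta')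
    have "case_prod (simple_process s) p \<bullet> case_prod (simple_process s') p
        = (\<Sum>x\<in>UNIV. \<Sum>y\<in>UNIV. case_prod (simple_process s) p $ x $ y
            * case_prod (simple_process s') p $ x $ y)"
      by (simp add: inner_vec_def)
    also have "\<dots> = (\<Sum>x\<in>UNIV. \<Sum>y\<in>UNIV. \<Sum>i\<in>?N. \<Sum>k\<in>?N'.
        indicator {time s i<..time s (Suc i)} (fst p)
            * indicator {time s' k<..time s' (Suc k)} (fst p)
        * (?H i (snd p) $ x $ y * ?K k (snd p) $ x $ y))"
      unfolding sp sum_product by (intro sum.cong refl) (simp add: mult_ac)
    finally show ?thesis .
  qed
  ultimately have "(\<integral>p. case_prod (simple_process s) p \<bullet> case_prod (simple_process s') p
      \<partial>time_prod P T)
      = (\<Sum>x\<in>UNIV. \<Sum>y\<in>UNIV. \<Sum>i\<in>?N. \<Sum>k\<in>?N'. E x y i k)"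
    unfolding has_bochner_integral_iff by presburger
  then show ?thesis using P by simp
qed

end

section \<open>Density of the simple processes\<close>

text \<open>\<open>measurable_on\<close> provides continuous functions that converge off a
  negligible set. Composing them with the nearest-point projection onto the ball of radius
  \<open>C\<close> keeps continuity and limit, and imposes the bound that dominated convergence
  requires.\<close>

lemma bounded_measurable_limit_continuous:
  fixes f :: "real \<Rightarrow> 'b :: euclidean_space"
  assumes f: "f \<in> borel_measurable borel" and C: "\<And>x. norm (f x) \<le> C"
  obtains g where "\<And>n :: nat. continuous_on UNIV (g n)" "\<And>n x. norm (g n x) \<le> C"
    "AE x in lborel. (\<lambda>n. g n x) \<longlonglongrightarrow> f x"
proof -
  have C0: "0 \<le> C" using order_trans[OF norm_ge_zero C] .
  have "f \<in> borel_measurable lebesgue" using f by (auto intro: measurable_completion)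
  then have "f measurable_on UNIV" by (rule lebesgue_measurable_imp_measurable_on) simp
  then obtain N h where N: "negligible N" and h: "\<And>n :: nat. continuous_on UNIV (h n)"
    and lim: "\<And>x. x \<notin> N \<Longrightarrow> (\<lambda>n. h n x) \<longlonglongrightarrow> f x"
    unfolding measurable_on_def by auto
  let ?p = "closest_point (cball (0 :: 'b) C)"
  have p: "convex (cball (0 :: 'b) C)" "closed (cball (0 :: 'b) C)" "cball (0 :: 'b) C \<noteq> {}"
      using C0 by auto
  have pc: "continuous_on UNIV ?p" by (rule continuous_on_closest_point[OF p])
  show ?thesis
  proof (rule that[of "\<lambda>n x. ?p (h n x)"])
    show "continuous_on UNIV (\<lambda>x. ?p (h n x))" for n
      by (rule continuous_on_compose2[OF pc h]) simp
    show "norm (?p (h n x)) \<le> C" for n x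
      using closest_point_in_set[OF p(2,3), of "h n x"] by simp
    have "(\<lambda>n. ?p (h n x)) \<longlonglongrightarrow> f x" if "x \<notin> N" for x
    proof -
      have "(\<lambda>n. ?p (h n x)) \<longlonglongrightarrow> ?p (f x)"
        by (rule continuous_on_tendsto_compose[OF pc lim[OF that]]) auto
      then show ?thesis using C[of x] by (simp add: closest_point_self)
    qed
    moreover have "AE x in lborel. x \<notin> N"
    proof -
      have "AE x in lebesgue. x \<notin> N"
        using N by (intro AE_not_in) (simp add: negligible_iff_null_sets)
      then show ?thesis by (simp add: AE_completion_iff)
    qed
    ultimately show "AE x in lborel. (\<lambda>n. ?p (h n x)) \<longlonglongrightarrow> f x" by (auto elim: eventually_mono)
  qed
qed

lemma norm_diff_sq_le:
  assumes "norm x \<le> C" "norm (y :: 'a :: real_normed_vector) \<le> C"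
  shows "(norm (x - y))\<^sup>2 \<le> (2 * C)\<^sup>2"
  using norm_triangle_ineq4[of x y] assms by (intro power_mono) auto

text \<open>For the continuous bounded approximants \<open>g m\<close> the claim is dominated
  convergence. The replacement of \<open>f\<close> by \<open>g m\<close> costs an error
  \<open>e m\<close> at the original and at the shifted times, uniformly in the shift.\<close>

lemma translation_L2_continuous:
  fixes f :: "real \<Rightarrow> 'b :: euclidean_space"
  assumes f [measurable]: "f \<in> borel_measurable borel" and C: "\<And>x. norm (f x) \<le> C"
    and u: "u \<longlonglongrightarrow> 0" "\<And>n. 0 \<le> u n" "\<And>n. u n \<le> 1"
  shows "(\<lambda>n. \<integral>\<^sup>+ t\<in>{0..T}. ennreal ((norm (f t - f (t - u n)))\<^sup>2) \<partial>lborel) \<longlonglongrightarrow> 0"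
proof -
  obtain g where g: "\<And>n :: nat. continuous_on UNIV (g n)" and gC: "\<And>n x. norm (g n x) \<le> C"
    and lim: "AE x in lborel. (\<lambda>n. g n x) \<longlonglongrightarrow> f x"
    using bounded_measurable_limit_continuous[OF f C] by blast
  have [measurable]: "g n \<in> borel_measurable borel" for n
      by (rule borel_measurable_continuous_onI[OF g])
  \<comment> \<open>The interval begins at \<open>-1\<close> because the shifted times
    \<open>t - u n\<close> with \<open>u n \<le> 1\<close> range over
    \<open>{-1..T}\<close>.\<close>
  define e where "e m = (\<integral>\<^sup>+ t\<in>{-1..T}. ennreal ((norm (f t - g m t))\<^sup>2) \<partial>lborel)" for m
  define D where "D m n = (\<integral>\<^sup>+ t\<in>{0..T}. ennreal ((norm (g m t - g m (t - u n)))\<^sup>2) \<partial>lborel)" for m n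
  have fin: "(\<integral>\<^sup>+ t. ennreal ((2 * C)\<^sup>2) * indicator {a..T} t \<partial>lborel) < \<infinity>" for a
    by (simp add: nn_integral_cmult emeasure_lborel_Icc_eq ennreal_mult_less_top)
  have e: "e \<longlonglongrightarrow> 0"
  proof -
    have "e \<longlonglongrightarrow> (\<integral>\<^sup>+ (t :: real). 0 \<partial>lborel)"
      unfolding e_def
    proof (rule nn_integral_dominated_convergence[where w
        = "\<lambda>t. ennreal ((2 * C)\<^sup>2) * indicator {-1..T} t"])
      show "AE t in lborel. ennreal ((norm (f t - g m t))\<^sup>2) * indicator {- 1..T} t
          \<le> ennreal ((2 * C)\<^sup>2) * indicator {- 1..T} t" for m
        by (intro AE_I2 mult_right_mono ennreal_leI norm_diff_sq_le C gC) simp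
      show "AE t in lborel. (\<lambda>m. ennreal ((norm (f t - g m t))\<^sup>2) * indicator {- 1..T} t) \<longlonglongrightarrow> 0"
        using lim
      proof eventually_elim
        case (elim t)
        then have "(\<lambda>m. ennreal ((norm (f t - g m t))\<^sup>2)) \<longlonglongrightarrow> ennreal ((norm (f t - f t))\<^sup>2)"
          by (intro tendsto_intros)
        then show ?case by (cases "t \<in> {-1..T}") auto
      qed
    qed (use fin in auto)
    then show ?thesis by simp
  qed
  have D: "(\<lambda>n. D m n) \<longlonglongrightarrow> 0" for m
  proof -
    have "(\<lambda>n. D m n) \<longlonglongrightarrow> (\<integral>\<^sup>+ (t :: real). 0 \<partial>lborel)"
      unfolding D_def
    proof (rule nn_integral_dominated_convergence[where w
        = "\<lambda>t. ennreal ((2 * C)\<^sup>2) * indicator {0..T} t"])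
      show "AE t in lborel. ennreal ((norm (g m t - g m (t - u n)))\<^sup>2) * indicator {0..T} t
          \<le> ennreal ((2 * C)\<^sup>2) * indicator {0..T} t" for n
        by (intro AE_I2 mult_right_mono ennreal_leI norm_diff_sq_le gC) simp
      have "(\<lambda>n. g m (t - u n)) \<longlonglongrightarrow> g m t" for t
      proof -
        have "(\<lambda>n. t - u n) \<longlonglongrightarrow> t" using tendsto_diff[OF tendsto_const u(1), of t] by simp
        then show ?thesis by (rule continuous_on_tendsto_compose[OF g]) auto
      qed
      then have "(\<lambda>n. ennreal ((norm (g m t - g m (t - u n)))\<^sup>2))
          \<longlonglongrightarrow> ennreal ((norm (g m t - g m t))\<^sup>2)" for t
        by (intro tendsto_intros)
      then have "(\<lambda>n. ennreal ((norm (g m t - g m (t - u n)))\<^sup>2) * indicator {0..T} t) \<longlonglongrightarrow> 0" for t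
        by (cases "t \<in> {0..T}") auto
      then show "AE t in lborel. (\<lambda>n. ennreal ((norm (g m t - g m (t
          - u n)))\<^sup>2) * indicator {0..T} t) \<longlonglongrightarrow> 0"
        by simp
    qed (use fin in auto)
    then show ?thesis by simp
  qed
  \<comment> \<open>The errors at \<open>t\<close> and at \<open>t - u n\<close> contribute
    \<open>4 * e m\<close> each, the second after a substitution. The shape
    \<open>- u n + 1 * t\<close> is the one expected by the affine substitution rule.\<close>
  have bound: "(\<integral>\<^sup>+ t\<in>{0..T}. ennreal ((norm (f t - f (t - u n)))\<^sup>2) \<partial>lborel) \<le> 8 * e m + 4 * D m n"
      for m n
  proof -
    let ?F = "\<lambda>t. ennreal ((norm (f t - g m t))\<^sup>2)"
    have "(\<integral>\<^sup>+ t\<in>{0..T}. ennreal ((norm (f t - f (t - u n)))\<^sup>2) \<partial>lborel)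
        \<le> (\<integral>\<^sup>+ t. 4 * (?F t * indicator {-1..T} t) + (4 * (ennreal ((norm (g m t - g m (t
            - u n)))\<^sup>2) * indicator {0..T} t)
            + 4 * (?F (- u n + 1 * t) * indicator {-1..T} (- u n + 1 * t))) \<partial>lborel)"
    proof (rule nn_integral_mono)
      fix t
      show "ennreal ((norm (f t - f (t - u n)))\<^sup>2) * indicator {0..T} t
        \<le> 4 * (?F t * indicator {-1..T} t) + (4 * (ennreal ((norm (g m t - g m (t
            - u n)))\<^sup>2) * indicator {0..T} t)
            + 4 * (?F (- u n + 1 * t) * indicator {-1..T} (- u n + 1 * t)))"
      proof (cases "t \<in> {0..T}")
        case True
        define a b c where "a = f t - g m t" and "b = g m t - g m (t - u n)"
            and "c = g m (t - u n) - f (t - u n)"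
        have "f t - f (t - u n) = a + (b + c)" by (simp add: a_def b_def c_def)
        then have "(norm (f t - f (t - u n)))\<^sup>2
            \<le> 2 * (norm a)\<^sup>2 + 2 * (2 * (norm b)\<^sup>2 + 2 * (norm c)\<^sup>2)"
          using norm_add_sq_le[of a "b + c"] norm_add_sq_le[of b c] by simp
        also have "\<dots> \<le> 4 * (norm a)\<^sup>2 + (4 * (norm b)\<^sup>2 + 4 * (norm c)\<^sup>2)" by simp
        finally have "ennreal ((norm (f t - f (t - u n)))\<^sup>2)
            \<le> ennreal (4 * (norm a)\<^sup>2 + (4 * (norm b)\<^sup>2 + 4 * (norm c)\<^sup>2))"
          by (rule ennreal_leI)
        also have "\<dots> = 4 * ennreal ((norm a)\<^sup>2) + (4 * ennreal ((norm b)\<^sup>2)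
            + 4 * ennreal ((norm c)\<^sup>2))"
          by (simp add: ennreal_plus ennreal_mult')
        finally show ?thesis
          using True u(2,3)[of n] by (simp add: a_def b_def c_def norm_minus_commute)
      qed simp
    qed
    also have "\<dots> = 4 * e m + (4 * D m n + 4 * (\<integral>\<^sup>+ t. ?F (- u n + 1 * t) * indicator {-1..T} (- u n
        + 1 * t) \<partial>lborel))"
      unfolding e_def D_def by (simp add: nn_integral_add nn_integral_cmult)
    also have "(\<integral>\<^sup>+ t. ?F (- u n + 1 * t) * indicator {-1..T} (- u n + 1 * t) \<partial>lborel) = e m"
      unfolding e_def by (subst (2) nn_integral_real_affine[where c = 1 and t = "- u n"]) auto
    also have "4 * e m + (4 * D m n + 4 * e m) = (4 + 4) * e m + 4 * D m n"
      unfolding distrib_right by (simp only: ac_simps)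
    finally show ?thesis by simp
  qed
  show ?thesis
  proof (rule order_tendstoI)
    fix a :: ennreal assume "0 < a"
    have "(\<lambda>m. 8 * e m) \<longlonglongrightarrow> 8 * 0" by (intro ennreal_tendsto_cmult e) simp
    then have "eventually (\<lambda>m. 8 * e m < a) sequentially" using order_tendstoD(2)[of _ 0] \<open>0 < a\<close>
        by fastforce
    then obtain m where m: "8 * e m < a" by (auto simp: eventually_sequentially)
    have "(\<lambda>n. 8 * e m + 4 * D m n) \<longlonglongrightarrow> 8 * e m + 4 * 0"
      by (intro tendsto_add tendsto_const ennreal_tendsto_cmult D) simp
    then have "(\<lambda>n. 8 * e m + 4 * D m n) \<longlonglongrightarrow> 8 * e m" by simp
    from order_tendstoD(2)[OF this m]
    show "eventually (\<lambda>n. (\<integral>\<^sup>+ t\<in>{0..T}. ennreal ((norm (f t - f (t - u n)))\<^sup>2) \<partial>lborel)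
        < a) sequentially"
      by eventually_elim (rule le_less_trans[OF bound])
  qed simp
qed

context filtered_prob_space begin

text \<open>If no \<open>d\<close> worked, there would be shifts \<open>u n\<close> tending to
  \<open>0\<close> with errors above \<open>e\<close>. Continuity of translations on every path and
  dominated convergence over the sample space exclude this; passing to a sequence is what makes
  dominated convergence applicable.\<close>

lemma translation_process_continuous:
  fixes V :: "real \<Rightarrow> 'w \<Rightarrow> 'b :: euclidean_space"
  assumes V [measurable]: "case_prod V \<in> borel_measurable (lborel \<Otimes>\<^sub>M P)"
    and C: "\<And>t \<omega>. \<omega> \<in> space P \<Longrightarrow> norm (V t \<omega>) \<le> C" and e: "0 < (e :: ennreal)"
  obtains d where "0 < d"
    "\<And>u. 0 < u \<Longrightarrow> u < d \<Longrightarrow>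
      (\<integral>\<^sup>+ \<omega>. (\<integral>\<^sup>+ t\<in>{0..T}. ennreal ((norm (V t \<omega> - V (t - u) \<omega>))\<^sup>2) \<partial>lborel) \<partial>P) \<le> e"
proof (rule ccontr)
  assume none: "\<not> thesis"
  define G where "G u = (\<integral>\<^sup>+ \<omega>. (\<integral>\<^sup>+ t\<in>{0..T}. ennreal ((norm (V t \<omega> - V (t - u) \<omega>))\<^sup>2) \<partial>lborel) \<partial>P)"
      for u
  have VM [measurable (raw)]: "(\<lambda>x. V (a x) (b x)) \<in> borel_measurable M"
    if "a \<in> borel_measurable M" "b \<in> measurable M P" for a b and M :: "'c measure"
    using measurable_compose[OF measurable_Pair[of a M lborel b P] V] that by simp
  have "\<exists>u. 0 < u \<and> u < 1 / real (Suc n) \<and> \<not> G u \<le> e" for n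
    using none that[of "1 / real (Suc n)"] unfolding G_def by auto
  then obtain u where u: "\<And>n. 0 < u n" "\<And>n. u n < 1 / real (Suc n)" and G: "\<And>n. \<not> G (u n) \<le> e"
      by metis
  have u0: "u \<longlonglongrightarrow> 0"
    by (rule tendsto_sandwich[OF _ _ tendsto_const LIMSEQ_Suc[OF lim_1_over_n]])
      (use u in \<open>auto intro!: always_eventually less_imp_le\<close>)
  have u1: "u n \<le> 1" for n
  proof -
    have "1 / real (Suc n) \<le> 1" by simp
    then show ?thesis using u(2)[of n] by linarith
  qed
  have "(\<lambda>n. G (u n)) \<longlonglongrightarrow> (\<integral>\<^sup>+ \<omega>. 0 \<partial>P)"
    unfolding G_def
  proof (rule nn_integral_dominated_convergence[where w
      = "\<lambda>\<omega>. \<integral>\<^sup>+ t. ennreal ((2 * C)\<^sup>2) * indicator {0..T} t \<partial>lborel"])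
    show "(\<lambda>\<omega>. \<integral>\<^sup>+ t\<in>{0..T}. ennreal ((norm (V t \<omega> - V (t - u n) \<omega>))\<^sup>2) \<partial>lborel) \<in> borel_measurable P"
        for n
      by measurable
    show "AE \<omega> in P. (\<integral>\<^sup>+ t\<in>{0..T}. ennreal ((norm (V t \<omega> - V (t - u n) \<omega>))\<^sup>2) \<partial>lborel)
        \<le> (\<integral>\<^sup>+ t. ennreal ((2 * C)\<^sup>2) * indicator {0..T} t \<partial>lborel)" for n
      by (intro AE_I2 nn_integral_mono mult_right_mono ennreal_leI norm_diff_sq_le C) auto
    show "(\<integral>\<^sup>+ \<omega>. (\<integral>\<^sup>+ t. ennreal ((2 * C)\<^sup>2) * indicator {0..T} t \<partial>lborel) \<partial>P) < \<infinity>"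
      by (simp add: nn_integral_cmult emeasure_lborel_Icc_eq ennreal_mult_less_top emeasure_space_1)
    show "AE \<omega> in P. (\<lambda>n. \<integral>\<^sup>+ t\<in>{0..T}. ennreal ((norm (V t \<omega> - V (t - u n) \<omega>))\<^sup>2) \<partial>lborel) \<longlonglongrightarrow> 0"
    proof (rule AE_I2)
      fix \<omega> assume \<omega>: "\<omega> \<in> space P"
      have "(\<lambda>t. V t \<omega>) \<in> borel_measurable borel" using \<omega> by (intro VM) auto
      then show "(\<lambda>n. \<integral>\<^sup>+ t\<in>{0..T}. ennreal ((norm (V t \<omega> - V (t - u n) \<omega>))\<^sup>2) \<partial>lborel) \<longlonglongrightarrow> 0"
        by (rule translation_L2_continuous[OF _ C[OF \<omega>] u0 less_imp_le[OF u(1)] u1])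
    qed
  qed auto
  then have "(\<lambda>n. G (u n)) \<longlonglongrightarrow> 0" by simp
  from order_tendstoD(2)[OF this e] obtain n where "G (u n) < e"
      by (auto simp: eventually_sequentially)
  then show False using G[of n] by simp
qed

end

text \<open>Some value of a function does not exceed its mean, since otherwise integration would
  give the mean strictly more than itself. It supplies the sampling points of the simple
  approximation.\<close>

lemma nn_integral_mean_choice:
  fixes h :: "real \<Rightarrow> ennreal"
  assumes h [measurable]: "h \<in> borel_measurable borel" and ab: "a < b"
  obtains r where "r \<in> {a<..b}" "ennreal (b - a) * h r \<le> (\<integral>\<^sup>+ x\<in>{a<..b}. h x \<partial>lborel)"
proof (rule ccontr)
  assume none: "\<not> thesis"
  note choice = that
  define c where "c = (\<integral>\<^sup>+ x\<in>{a<..b}. h x \<partial>lborel)"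
  have gt: "c < ennreal (b - a) * h r" if "r \<in> {a<..b}" for r
    using none choice[OF that] unfolding c_def by (meson not_le)
  have "c \<noteq> \<infinity>" using gt[of b] ab by auto
  have "(\<integral>\<^sup>+ x. c * indicator {a<..b} x \<partial>lborel)
      < (\<integral>\<^sup>+ x. ennreal (b - a) * h x * indicator {a<..b} x \<partial>lborel)"
  proof (rule nn_integral_less)
    show "(\<integral>\<^sup>+ x. c * indicator {a<..b} x \<partial>lborel) \<noteq> \<infinity>"
      using \<open>c \<noteq> \<infinity>\<close> ab by (simp add: nn_integral_cmult ennreal_mult_eq_top_iff)
    show "AE x in lborel. c * indicator {a<..b} x \<le> ennreal (b - a) * h x * indicator {a<..b} x"
      using gt by (intro AE_I2) (simp add: indicator_def less_imp_le)
    show "\<not> (AE x in lborel. ennreal (b - a) * h x * indicator {a<..b} x \<le> c * indicator {a<..b} x)"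
    proof
      assume "AE x in lborel. ennreal (b - a) * h x * indicator {a<..b} x \<le> c * indicator {a<..b} x"
      then have "AE x in lborel. x \<notin> {a<..b}"
      proof eventually_elim
        case (elim x)
        then show ?case using gt[of x] by (cases "x \<in> {a<..b}") (auto simp: not_le)
      qed
      then have "{a<..b} \<in> null_sets lborel" by (subst AE_iff_null_sets) auto
      then show False using ab by (simp add: null_sets_def)
    qed
  qed auto
  also have "(\<integral>\<^sup>+ x. ennreal (b - a) * h x * indicator {a<..b} x \<partial>lborel) = ennreal (b - a) * c"
    unfolding c_def by (simp add: mult.assoc nn_integral_cmult)
  also have "(\<integral>\<^sup>+ x. c * indicator {a<..b} x \<partial>lborel) = ennreal (b - a) * c"
    using ab by (simp add: nn_integral_cmult mult.commute)
  finally show False by simp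
qed

context filtered_prob_space begin

text \<open>Measurability is given on the restricted time axis only, so it is composed with the map
  that clamps a time to \<open>{0..T}\<close> before the values outside are set to
  \<open>0\<close>.\<close>

lemma restrict_time_prod_extend:
  fixes v :: "real \<Rightarrow> 'w \<Rightarrow> 'b :: euclidean_space"
  assumes T: "0 \<le> T" and v: "case_prod v \<in> borel_measurable (time_prod P T)"
  shows "case_prod (\<lambda>t \<omega>. if t \<in> {0..T} then v t \<omega> else 0) \<in> borel_measurable (lborel \<Otimes>\<^sub>M P)"
proof -
  have "(\<lambda>t. max 0 (min T t)) \<in> measurable lborel (restrict_space lborel {0..T})"
    using T by (intro measurable_restrict_space2) auto
  then have "(\<lambda>p. (max 0 (min T (fst p)), snd p)) \<in> measurable (lborel \<Otimes>\<^sub>M P) (time_prod P T)"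
    by (intro measurable_Pair measurable_compose[OF measurable_fst] measurable_snd)
  from measurable_compose[OF this v]
  have [measurable]: "(\<lambda>p. v (max 0 (min T (fst p))) (snd p)) \<in> borel_measurable (lborel \<Otimes>\<^sub>M P)"
    by simp
  have "(\<lambda>p. if fst p \<in> {0..T} then v (max 0 (min T (fst p))) (snd p) else 0)
      \<in> borel_measurable (lborel \<Otimes>\<^sub>M P)"
    by measurable
  moreover have "(\<lambda>p. if fst p \<in> {0..T} then v (max 0 (min T (fst p))) (snd p) else 0)
      = case_prod (\<lambda>t \<omega>. if t \<in> {0..T} then v t \<omega> else 0)"
    by (auto simp: fun_eq_iff)
  ultimately show ?thesis by (simp only:)
qed

text \<open>On the cell \<open>(i d, (i + 1) d]\<close> the process is replaced by its value at a point of the preceding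
  cell, chosen so that the error is at most the mean error over all such points. Only the values of the
  process enter, hence no progressive measurability is needed. The mean errors are controlled by the
  continuity of translations in \<open>L\<^sub>2\<close>.\<close>

lemma simple_approx_bounded:
  fixes v :: "real \<Rightarrow> 'w \<Rightarrow> 'b :: euclidean_space"
  assumes T: "0 < T" and v: "v \<in> L2a P F T (\<lambda>x. (norm x)\<^sup>2)"
    and C: "\<And>t \<omega>. \<omega> \<in> space P \<Longrightarrow> norm (v t \<omega>) \<le> C" and e: "0 < (e :: ennreal)"
  obtains s where "simple_adapted P F T s"
    "(\<integral>\<^sup>+ p. ennreal ((norm (case_prod (simple_process s) p - case_prod v p))\<^sup>2) \<partial>time_prod P T)
        \<le> 2 * e"
proof -
  have vm [measurable]: "case_prod v \<in> borel_measurable (time_prod P T)"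
    and va: "\<And>t. t \<in> {0..T} \<Longrightarrow> v t \<in> borel_measurable (F t)"
    using v by (auto simp: L2a_iff sq_integrable_def)
  obtain \<omega>0 where "\<omega>0 \<in> space P" using not_empty by auto
  then have C0: "0 \<le> C" using order_trans[OF norm_ge_zero C] by blast
  define V where "V t \<omega> = (if t \<in> {0..T} then v t \<omega> else 0)" for t \<omega>
  have Vm: "case_prod V \<in> borel_measurable (lborel \<Otimes>\<^sub>M P)"
    unfolding V_def using restrict_time_prod_extend[OF _ vm] T by simp
  have VM [measurable (raw)]: "(\<lambda>x. V (a x) (b x)) \<in> borel_measurable M"
    if "a \<in> borel_measurable M" "b \<in> measurable M P" for a b and M :: "'c measure"
    using measurable_compose[OF measurable_Pair[of a M lborel b P] Vm] that by simp
  \<comment> \<open>The instance for the product of two times and the sample space, on which the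
    integrand of \<open>g\<close> lives.\<close>
  have VM2 [measurable (raw)]: "(\<lambda>x. V (a x) (b x)) \<in> borel_measurable M"
    if "a \<in> borel_measurable M" "b \<in> measurable M P" for a b and M :: "((real \<times> real) \<times> 'w) measure"
    using measurable_compose[OF measurable_Pair[of a M lborel b P] Vm] that by simp
  have VC: "norm (V t \<omega>) \<le> C" if "\<omega> \<in> space P" for t \<omega> using C[OF that] C0 by (simp add: V_def)
  obtain d0 where d0: "0 < d0" and G: "\<And>u. 0 < u \<Longrightarrow> u < d0 \<Longrightarrow>
      (\<integral>\<^sup>+ \<omega>. (\<integral>\<^sup>+ t\<in>{0..T}. ennreal ((norm (V t \<omega> - V (t - u) \<omega>))\<^sup>2) \<partial>lborel) \<partial>P) \<le> e"
    using translation_process_continuous[OF Vm VC e, of T] by blast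
  \<comment> \<open>A point of a cell and a point of the preceding cell are less than two meshes
    apart, and this distance has to stay below \<open>d0\<close>.\<close>
  obtain n where n: "2 * T / d0 < real n" using reals_Archimedean2 by blast
  have n0: "0 < n"
  proof (rule ccontr)
    assume "\<not> 0 < n"
    then show False using n T d0 by (simp add: field_simps)
  qed
  define d where "d = T / real n"
  have d: "0 < d" "2 * d < d0" "real n * d = T"
    using n n0 T d0 by (auto simp: d_def field_simps)
  define J where "J i = {real i * d<..real (Suc i) * d}" for i
  \<comment> \<open>The cell before \<open>J i\<close>. It ends at \<open>real i * d\<close>, so a
    value sampled in it is known when \<open>J i\<close> begins. For \<open>i = 0\<close> it
    consists of \<open>0\<close> and of negative times, at which the extension \<open>V\<close> is
    zero.\<close>
  define J' where "J' i = {(real i - 1) * d<..real i * d}" for i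
  have [measurable]: "J i \<in> sets borel" "J' i \<in> sets borel" for i by (simp_all add: J_def J'_def)
  \<comment> \<open>The mean square distance between the values at two times; \<open>h i r\<close>
    below is then the error of using the value at \<open>r\<close> throughout the cell
    \<open>J i\<close>.\<close>
  define g where "g t r = (\<integral>\<^sup>+ \<omega>. ennreal ((norm (V t \<omega> - V r \<omega>))\<^sup>2) \<partial>P)" for t r
  have gm: "case_prod g \<in> borel_measurable (lborel \<Otimes>\<^sub>M lborel)"
    unfolding g_def by measurable
  have gM [measurable (raw)]: "(\<lambda>x. g (a x) (b x)) \<in> borel_measurable M"
    if "a \<in> borel_measurable M" "b \<in> borel_measurable M" for a b and M :: "'d measure"
    using measurable_compose[OF measurable_Pair[of a M lborel b lborel] gm] that by simp
  have gM2 [measurable (raw)]: "(\<lambda>x. g (a x) (b x)) \<in> borel_measurable M"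
    if "a \<in> borel_measurable M" "b \<in> borel_measurable M" for a b and M :: "(real \<times> real) measure"
    using measurable_compose[OF measurable_Pair[of a M lborel b lborel] gm] that by simp
  have gM3 [measurable (raw)]: "(\<lambda>x. g (a x) (b x)) \<in> borel_measurable M"
    if "a \<in> borel_measurable M" "b \<in> borel_measurable M" for a b and M :: "real measure"
    using measurable_compose[OF measurable_Pair[of a M lborel b lborel] gm] that by simp
  define h where "h i r = (\<integral>\<^sup>+ t. g t r * indicator (J i) t \<partial>lborel)" for i r
  have hm [measurable]: "h i \<in> borel_measurable borel" for i unfolding h_def by measurable
  have "\<exists>r. r \<in> J' i \<and> ennreal d * h i r \<le> (\<integral>\<^sup>+ r\<in>J' i. h i r \<partial>lborel)" for i
  proof -
    have "(real i - 1) * d < real i * d" using d by simp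
    from nn_integral_mean_choice[OF hm this, of i]
    show ?thesis unfolding J'_def by (auto simp: algebra_simps)
  qed
  then obtain \<rho> where \<rho>: "\<And>i. \<rho> i \<in> J' i"
      and h\<rho>: "\<And>i. ennreal d * h i (\<rho> i) \<le> (\<integral>\<^sup>+ r\<in>J' i. h i r \<partial>lborel)"
    by metis
  have cell: "\<exists>i<n. \<forall>k. t \<in> J k \<longleftrightarrow> k = i" if t: "0 < t" "t \<le> T" for t
  proof -
    \<comment> \<open>The ceiling minus one, and not the floor, because the cells are closed on the
      right.\<close>
    define i where "i = nat (\<lceil>t / d\<rceil> - 1)"
    have pos: "0 < t / d" using t d by simp
    then have "0 \<le> \<lceil>t / d\<rceil> - 1" by (simp add: less_ceiling_iff[symmetric] int_one_le_iff_zero_less)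
    then have i: "real i = real_of_int \<lceil>t / d\<rceil> - 1" by (simp add: i_def)
    have "real i < t / d" "t / d \<le> real i + 1" using i by linarith+
    then have ti: "real i * d < t" "t \<le> (real i + 1) * d" using d by (simp_all add: field_simps)
    have "real i * d < real n * d" using ti t d by simp
    then have "i < n" using d(1) by (simp only: mult_less_cancel_right_pos of_nat_less_iff)
    moreover have "t \<in> J k \<longleftrightarrow> k = i" for k
    proof
      assume "t \<in> J k"
      then have "real k * d < (real i + 1) * d" "real i * d < (real k + 1) * d"
        using ti unfolding J_def by (auto simp: algebra_simps)
      then have "real k < real i + 1" "real i < real k + 1" using d
          by (simp_all only: mult_less_cancel_right_pos)
      then show "k = i" by linarith
    qed (use ti in \<open>auto simp: J_def algebra_simps\<close>)
    ultimately show ?thesis by blast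
  qed
  have JT: "0 < t \<and> t \<le> T" if "t \<in> J i" "i < n" for t i
  proof -
    have "real (Suc i) * d \<le> real n * d" using that d by (intro mult_right_mono) auto
    moreover have "0 \<le> real i * d" using d by simp
    moreover have "real i * d < t" "t \<le> real (Suc i) * d" using that(1) by (simp_all add: J_def)
    ultimately show ?thesis using d(3) by linarith
  qed
  have ind_sum: "(\<Sum>i<n. f i * indicator (J i) t) = (f i :: ennreal)"
    if "i < n" "\<And>k. t \<in> J k \<longleftrightarrow> k = i" for t i f
  proof -
    have "(\<Sum>k<n. f k * indicator (J k) t) = (\<Sum>k<n. if k = i then f k else 0)"
      by (intro sum.cong) (auto simp: that(2) indicator_def)
    then show ?thesis using that(1) by simp
  qed
  \<comment> \<open>Multiplied by \<open>d\<close>, the errors are at most integrals over pairs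
    \<open>t\<close>, \<open>r\<close> from neighbouring cells, for which
    \<open>0 < t - r < 2 * d\<close>. With \<open>u = t - r\<close> they become translation errors,
    at most \<open>e\<close> for every \<open>u\<close>, integrated over an interval of length
    \<open>2 * d\<close>; cancelling \<open>d\<close> leaves \<open>2 * e\<close>.\<close>
  have total: "(\<Sum>i<n. h i (\<rho> i)) \<le> 2 * e"
  proof -
    have "ennreal d * (\<Sum>i<n. h i (\<rho> i)) \<le> (\<Sum>i<n. \<integral>\<^sup>+ r\<in>J' i. h i r \<partial>lborel)"
      unfolding sum_distrib_left by (intro sum_mono h\<rho>)
    also have "\<dots> = (\<integral>\<^sup>+ r. (\<Sum>i<n. h i r * indicator (J' i) r) \<partial>lborel)"
      by (rule nn_integral_sum[symmetric]) measurable
    also have "\<dots> = (\<integral>\<^sup>+ r. (\<integral>\<^sup>+ t. (\<Sum>i<n. g t r * indicator (J i) t * indicator (J' i) r) \<partial>lborel)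
        \<partial>lborel)"
    proof (rule nn_integral_cong)
      fix r
      have "(\<Sum>i<n. h i r * indicator (J' i) r)
          = (\<Sum>i<n. \<integral>\<^sup>+ t. g t r * indicator (J i) t * indicator (J' i) r \<partial>lborel)"
        unfolding h_def by (intro sum.cong refl nn_integral_multc[symmetric]) measurable
      also have "\<dots> = (\<integral>\<^sup>+ t. (\<Sum>i<n. g t r * indicator (J i) t * indicator (J' i) r) \<partial>lborel)"
        by (rule nn_integral_sum[symmetric]) measurable
      finally show "(\<Sum>i<n. h i r * indicator (J' i) r)
          = (\<integral>\<^sup>+ t. (\<Sum>i<n. g t r * indicator (J i) t * indicator (J' i) r) \<partial>lborel)" .
    qed
    also have "\<dots> \<le> (\<integral>\<^sup>+ r. (\<integral>\<^sup>+ t. g t r * indicator {0<..T} t * indicator {0<..<2 * d} (t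
        - r) \<partial>lborel) \<partial>lborel)"
    proof (intro nn_integral_mono)
      fix r t
      show "(\<Sum>i<n. g t r * indicator (J i) t * indicator (J' i) r)
          \<le> g t r * indicator {0<..T} t * indicator {0<..<2 * d} (t - r)"
      proof (cases "0 < t \<and> t \<le> T")
        case True
        then obtain i where i: "i < n" "\<And>k. t \<in> J k \<longleftrightarrow> k = i" using cell by blast
        have "(\<Sum>k<n. g t r * indicator (J k) t * indicator (J' k) r)
            = (\<Sum>k<n. g t r * indicator (J' k) r * indicator (J k) t)" by (simp add: mult_ac)
        also have "\<dots> = g t r * indicator (J' i) r" by (rule ind_sum[OF i])
        also have "\<dots> \<le> g t r * indicator {0<..T} t * indicator {0<..<2 * d} (t - r)"
        proof (cases "r \<in> J' i")
          case True2: True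
          have "t \<in> J i" using i by simp
          then have "0 < t - r" "t - r < 2 * d" using True2
              by (auto simp: J_def J'_def algebra_simps)
          then show ?thesis using True True2 by simp
        qed simp
        finally show ?thesis .
      next
        case False
        then have "t \<notin> J i" if "i < n" for i using JT that by blast
        then have "(\<Sum>i<n. g t r * indicator (J i) t * indicator (J' i) r) = 0"
          by (intro sum.neutral) auto
        then show ?thesis by (simp only: zero_le)
      qed
    qed
    also have "\<dots> = (\<integral>\<^sup>+ t. (\<integral>\<^sup>+ r. g t r * indicator {0<..T} t * indicator {0<..<2 * d} (t
        - r) \<partial>lborel) \<partial>lborel)"
      by (rule lborel_pair.Fubini') measurable
    also have "\<dots> = (\<integral>\<^sup>+ t. (\<integral>\<^sup>+ u. g t (t
        - u) * indicator {0<..T} t * indicator {0<..<2 * d} u \<partial>lborel) \<partial>lborel)"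
    proof (rule nn_integral_cong)
      fix t :: real
      have "(\<lambda>r. g t r * indicator {0<..T} t * indicator {0<..<2 * d} (t - r))
          \<in> borel_measurable borel" by measurable
      from nn_integral_real_affine[OF this, of "-1" t]
      show "(\<integral>\<^sup>+ r. g t r * indicator {0<..T} t * indicator {0<..<2 * d} (t - r) \<partial>lborel)
          = (\<integral>\<^sup>+ u. g t (t - u) * indicator {0<..T} t * indicator {0<..<2 * d} u \<partial>lborel)" by simp
    qed
    also have "\<dots> = (\<integral>\<^sup>+ u. (\<integral>\<^sup>+ t. g t (t
        - u) * indicator {0<..T} t * indicator {0<..<2 * d} u \<partial>lborel) \<partial>lborel)"
      by (rule lborel_pair.Fubini') measurable
    also have "\<dots> \<le> (\<integral>\<^sup>+ u. e * indicator {0<..<2 * d} u \<partial>lborel)"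
    proof (rule nn_integral_mono)
      fix u :: real
      show "(\<integral>\<^sup>+ t. g t (t - u) * indicator {0<..T} t * indicator {0<..<2 * d} u \<partial>lborel)
          \<le> e * indicator {0<..<2 * d} u"
      proof (cases "u \<in> {0<..<2 * d}")
        case True
        interpret pl: pair_sigma_finite lborel P
          unfolding pair_sigma_finite_def using sigma_finite_measure_axioms sigma_finite_lborel
              by auto
        have "(\<integral>\<^sup>+ t. g t (t - u) * indicator {0<..T} t \<partial>lborel)
            \<le> (\<integral>\<^sup>+ t. (\<integral>\<^sup>+ \<omega>. ennreal ((norm (V t \<omega> - V (t
                - u) \<omega>))\<^sup>2) * indicator {0..T} t \<partial>P) \<partial>lborel)"
          unfolding g_def
          by (intro nn_integral_mono) (auto simp: nn_integral_multc indicator_def)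
        also have "\<dots> = (\<integral>\<^sup>+ \<omega>. (\<integral>\<^sup>+ t\<in>{0..T}. ennreal ((norm (V t \<omega> - V (t - u) \<omega>))\<^sup>2) \<partial>lborel) \<partial>P)"
          by (rule pl.Fubini'[symmetric]) measurable
        also have "\<dots> \<le> e" using True d by (intro G) auto
        finally show ?thesis using True by simp
      qed simp
    qed
    also have "\<dots> = ennreal d * (2 * e)"
      using d by (simp add: nn_integral_cmult ennreal_mult' mult_ac)
    finally show ?thesis using d by (simp add: ennreal_mult_le_mult_iff)
  qed
  define s where "s = \<lparr>steps = n, time = (\<lambda>i. real i * d), height = (\<lambda>i. V (\<rho> i))\<rparr>"
  have s_simps: "steps s = n" "time s i = real i * d" "height s i = V (\<rho> i)" for i
      by (simp_all add: s_def)
  have adapted: "simple_adapted P F T s"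
    unfolding simple_adapted_def s_simps
  proof (intro conjI allI impI)
    show "real i * d \<le> real (Suc i) * d" for i using d by simp
    show "\<exists>C. \<forall>\<omega>\<in>space P. norm (V (\<rho> i) \<omega>) \<le> C" for i using VC by blast
    show "V (\<rho> i) \<in> borel_measurable (F (real i * d))" if "i < n" for i
    proof (cases "\<rho> i \<in> {0..T}")
      case True
      then have "V (\<rho> i) = v (\<rho> i)" by (simp add: V_def fun_eq_iff)
      moreover have "v (\<rho> i) \<in> borel_measurable (F (real i * d))"
        using True \<rho>[of i] by (intro F_measurable_mono[OF _ _ va[OF True]]) (auto simp: J'_def)
      ultimately show ?thesis by simp
    next
      case False
      then have "V (\<rho> i) = (\<lambda>\<omega>. 0)" unfolding V_def by auto
      then show ?thesis by simp
    qed
  qed (use d in auto)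
  have val: "simple_process s t \<omega> = V (\<rho> i) \<omega>" if "i < n" "\<And>k. t \<in> J k \<longleftrightarrow> k = i" for t i \<omega>
  proof -
    have "simple_process s t \<omega> = (\<Sum>k<n. indicator (J k) t *\<^sub>R V (\<rho> k) \<omega>)"
      by (simp add: simple_process_def s_simps J_def)
    also have "\<dots> = (\<Sum>k<n. if k = i then V (\<rho> k) \<omega> else 0)"
      by (intro sum.cong) (auto simp: that(2) indicator_def)
    finally show ?thesis using that(1) by simp
  qed
  show ?thesis
  proof (rule that[OF adapted])
    have "(\<integral>\<^sup>+ p. ennreal ((norm (case_prod (simple_process s) p - case_prod v p))\<^sup>2) \<partial>time_prod P T)
        = (\<integral>\<^sup>+ \<omega>. (\<integral>\<^sup>+ t\<in>{0..T}. ennreal ((norm (simple_process s t \<omega> - v t \<omega>))\<^sup>2) \<partial>lborel) \<partial>P)"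
    proof -
      have [measurable]: "case_prod (simple_process s) \<in> borel_measurable (time_prod P T)"
        using simple_process_L2a[OF adapted] by (simp add: L2a_iff sq_integrable_def)
      show ?thesis by (subst nn_integral_time_prod) simp_all
    qed
    also have "\<dots> = (\<integral>\<^sup>+ \<omega>. (\<integral>\<^sup>+ t. (\<Sum>i<n. ennreal ((norm (V t \<omega>
        - V (\<rho> i) \<omega>))\<^sup>2) * indicator (J i) t) \<partial>lborel) \<partial>P)"
    proof (rule nn_integral_cong, rule nn_integral_cong_AE)
      fix \<omega>
      \<comment> \<open>Time \<open>0\<close> belongs to \<open>{0..T}\<close> but to no cell; a
        single point does not matter.\<close>
      have "AE t in lborel. t \<noteq> (0 :: real)" by (rule AE_lborel_singleton)
      then show "AE t in lborel. ennreal ((norm (simple_process s t \<omega>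
          - v t \<omega>))\<^sup>2) * indicator {0..T} t
          = (\<Sum>i<n. ennreal ((norm (V t \<omega> - V (\<rho> i) \<omega>))\<^sup>2) * indicator (J i) t)"
      proof eventually_elim
        case (elim t)
        show ?case
        proof (cases "0 < t \<and> t \<le> T")
          case True
          then obtain i where i: "i < n" "\<And>k. t \<in> J k \<longleftrightarrow> k = i" using cell by blast
          show ?thesis
            unfolding ind_sum[OF i] val[OF i] using True by (simp add: V_def norm_minus_commute)
        next
          case False
          then have "t \<notin> J i" if "i < n" for i using JT that by blast
          then have "(\<Sum>i<n. ennreal ((norm (V t \<omega> - V (\<rho> i) \<omega>))\<^sup>2) * indicator (J i) t) = 0"
            by (intro sum.neutral) auto
          moreover have "indicator {0..T} t = (0 :: ennreal)" using False elim by auto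
          ultimately show ?thesis by (simp only: mult_zero_right)
        qed
      qed
    qed
    also have "\<dots> = (\<Sum>i<n. \<integral>\<^sup>+ \<omega>. (\<integral>\<^sup>+ t. ennreal ((norm (V t \<omega>
        - V (\<rho> i) \<omega>))\<^sup>2) * indicator (J i) t \<partial>lborel) \<partial>P)"
    proof -
      have "(\<integral>\<^sup>+ \<omega>. (\<integral>\<^sup>+ t. (\<Sum>i<n. ennreal ((norm (V t \<omega>
          - V (\<rho> i) \<omega>))\<^sup>2) * indicator (J i) t) \<partial>lborel) \<partial>P)
          = (\<integral>\<^sup>+ \<omega>. (\<Sum>i<n. \<integral>\<^sup>+ t. ennreal ((norm (V t \<omega>
              - V (\<rho> i) \<omega>))\<^sup>2) * indicator (J i) t \<partial>lborel) \<partial>P)"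
        by (intro nn_integral_cong nn_integral_sum) measurable
      also have "\<dots> = (\<Sum>i<n. \<integral>\<^sup>+ \<omega>. (\<integral>\<^sup>+ t. ennreal ((norm (V t \<omega>
          - V (\<rho> i) \<omega>))\<^sup>2) * indicator (J i) t \<partial>lborel) \<partial>P)"
        by (rule nn_integral_sum) measurable
      finally show ?thesis .
    qed
    also have "\<dots> = (\<Sum>i<n. h i (\<rho> i))"
    proof (rule sum.cong)
      fix i
      interpret pl: pair_sigma_finite lborel P
        unfolding pair_sigma_finite_def using sigma_finite_measure_axioms sigma_finite_lborel
            by auto
      have "(\<integral>\<^sup>+ \<omega>. (\<integral>\<^sup>+ t. ennreal ((norm (V t \<omega> - V (\<rho> i) \<omega>))\<^sup>2) * indicator (J i) t \<partial>lborel) \<partial>P)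
          = (\<integral>\<^sup>+ t. (\<integral>\<^sup>+ \<omega>. ennreal ((norm (V t \<omega> - V (\<rho> i) \<omega>))\<^sup>2) * indicator (J i) t \<partial>P) \<partial>lborel)"
        by (rule pl.Fubini') measurable
      also have "\<dots> = h i (\<rho> i)"
        unfolding h_def g_def by (intro nn_integral_cong) (simp add: nn_integral_multc)
      finally show "(\<integral>\<^sup>+ \<omega>. (\<integral>\<^sup>+ t. ennreal ((norm (V t \<omega>
          - V (\<rho> i) \<omega>))\<^sup>2) * indicator (J i) t \<partial>lborel) \<partial>P) = h i (\<rho> i)" .
    qed simp
    also note total
    finally show "(\<integral>\<^sup>+ p. ennreal ((norm (case_prod (simple_process s) p
        - case_prod v p))\<^sup>2) \<partial>time_prod P T) \<le> 2 * e" .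
  qed
qed

text \<open>Replacing values of norm above \<open>N\<close> by \<open>0\<close> keeps a process
  adapted and reduces the claim to the bounded case. The truncation error is at every point either
  \<open>0\<close> or the process itself, so dominated convergence makes it small.\<close>

lemma simple_approx:
  fixes v :: "real \<Rightarrow> 'w \<Rightarrow> 'b :: euclidean_space"
  assumes T: "0 < T" and v: "v \<in> L2a P F T (\<lambda>x. (norm x)\<^sup>2)"
  obtains s where "\<And>j. simple_adapted P F T (s j)"
    "L2_lim (time_prod P T) (\<lambda>j. case_prod (simple_process (s j))) (case_prod v)"
proof -
  let ?M = "time_prod P T"
  have sq: "sq_integrable ?M (case_prod v)" and va: "\<And>t. t \<in> {0..T} \<Longrightarrow> v t \<in> borel_measurable (F t)"
    using v by (auto simp: L2a_iff)
  note vm [measurable] = sq_integrableD(1)[OF sq]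
  define w where "w N t \<omega> = (if norm (v t \<omega>) \<le> real N then v t \<omega> else 0)" for N :: nat and t \<omega>
  have w_eq: "case_prod (w N) = (\<lambda>p. if norm (case_prod v p) \<le> real N then case_prod v p else 0)"
      for N
    by (auto simp: w_def)
  have wm [measurable]: "case_prod (w N) \<in> borel_measurable ?M" for N unfolding w_eq by measurable
  have w: "w N \<in> L2a P F T (\<lambda>x. (norm x)\<^sup>2)" for N
    unfolding L2a_iff
  proof (intro conjI ballI)
    show "sq_integrable ?M (case_prod (w N))"
      by (rule sq_integrable_bounded[OF finite_measure_time_prod wm, where C
          = "real N"]) (simp add: w_eq)
    fix t assume "t \<in> {0..T}"
    then have [measurable]: "v t \<in> borel_measurable (F t)" by (rule va)
    show "w N t \<in> borel_measurable (F t)" unfolding w_def[abs_def] by measurable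
  qed
  have "(\<lambda>N. \<integral>\<^sup>+ p. ennreal ((norm (case_prod (w N) p - case_prod v p))\<^sup>2) \<partial>?M) \<longlonglongrightarrow> (\<integral>\<^sup>+ p. 0 \<partial>?M)"
  proof (rule nn_integral_dominated_convergence[where w = "\<lambda>p. ennreal ((norm (case_prod v p))\<^sup>2)"])
    show "(\<integral>\<^sup>+ p. ennreal ((norm (case_prod v p))\<^sup>2) \<partial>?M) < \<infinity>"
      using sq by (simp add: sq_integrable_iff_nn_integral[OF vm])
    show "AE p in ?M. ennreal ((norm (case_prod (w N) p - case_prod v p))\<^sup>2)
        \<le> ennreal ((norm (case_prod v p))\<^sup>2)" for N
      by (intro AE_I2 ennreal_leI) (simp add: w_eq)
    have "(\<lambda>N. ennreal ((norm (case_prod (w N) p - case_prod v p))\<^sup>2)) \<longlonglongrightarrow> 0" for p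
    proof (rule tendsto_eventually)
      obtain N0 where "norm (case_prod v p) \<le> real N0" using real_arch_simple by blast
      then show "eventually (\<lambda>N. ennreal ((norm (case_prod (w N) p - case_prod v p))\<^sup>2)
          = 0) sequentially"
        unfolding eventually_sequentially w_eq by (intro exI[of _ N0] allI impI) simp
    qed
    then show "AE p in ?M. (\<lambda>N. ennreal ((norm (case_prod (w N) p - case_prod v p))\<^sup>2)) \<longlonglongrightarrow> 0" by simp
  qed auto
  then have trunc: "(\<lambda>N. \<integral>\<^sup>+ p. ennreal ((norm (case_prod (w N) p - case_prod v p))\<^sup>2) \<partial>?M) \<longlonglongrightarrow> 0"
      by simp
  \<comment> \<open>The factor is \<open>2 * 2 + 2\<close>: twice the approximation error
    \<open>2 * e\<close> and twice the truncation error \<open>e\<close>.\<close>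
  have "\<exists>s. simple_adapted P F T s \<and>
      (\<integral>\<^sup>+ p. ennreal ((norm (case_prod (simple_process s) p - case_prod v p))\<^sup>2) \<partial>?M) \<le> 6 * e"
    if e: "0 < e" for e :: ennreal
  proof -
    obtain N where N: "(\<integral>\<^sup>+ p. ennreal ((norm (case_prod (w N) p - case_prod v p))\<^sup>2) \<partial>?M) < e"
      using order_tendstoD(2)[OF trunc e] by (auto simp: eventually_sequentially)
    have "norm (w N t \<omega>) \<le> real N" for t \<omega> by (simp add: w_def)
    from simple_approx_bounded[OF T w this e] obtain s where s: "simple_adapted P F T s"
      and se: "(\<integral>\<^sup>+ p. ennreal ((norm (case_prod (simple_process s) p - case_prod (w N) p))\<^sup>2) \<partial>?M)
          \<le> 2 * e"
      by blast
    have [measurable]: "case_prod (simple_process s) \<in> borel_measurable ?M"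
      using simple_process_L2a[OF s] by (simp add: L2a_iff sq_integrable_def)
    have "(\<integral>\<^sup>+ p. ennreal ((norm (case_prod (simple_process s) p - case_prod v p))\<^sup>2) \<partial>?M)
        \<le> (\<integral>\<^sup>+ p. 2 * ennreal ((norm (case_prod (simple_process s) p - case_prod (w N) p))\<^sup>2)
            + 2 * ennreal ((norm (case_prod (w N) p - case_prod v p))\<^sup>2) \<partial>?M)"
    proof (rule nn_integral_mono)
      fix p
      define a b where "a = case_prod (simple_process s) p - case_prod (w N) p"
          and "b = case_prod (w N) p - case_prod v p"
      have "case_prod (simple_process s) p - case_prod v p = a + b"
        by (simp add: a_def b_def case_prod_beta')
      then have "ennreal ((norm (case_prod (simple_process s) p - case_prod v p))\<^sup>2)
          \<le> ennreal (2 * (norm a)\<^sup>2 + 2 * (norm b)\<^sup>2)"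
        using norm_add_sq_le[of a b] by (intro ennreal_leI) simp
      also have "\<dots> = 2 * ennreal ((norm a)\<^sup>2) + 2 * ennreal ((norm b)\<^sup>2)"
        by (simp add: ennreal_plus ennreal_mult')
      finally show "ennreal ((norm (case_prod (simple_process s) p - case_prod v p))\<^sup>2)
          \<le> 2 * ennreal ((norm (case_prod (simple_process s) p - case_prod (w N) p))\<^sup>2)
            + 2 * ennreal ((norm (case_prod (w N) p - case_prod v p))\<^sup>2)"
        unfolding a_def b_def .
    qed
    also have "\<dots> = 2 * (\<integral>\<^sup>+ p. ennreal ((norm (case_prod (simple_process s) p
        - case_prod (w N) p))\<^sup>2) \<partial>?M)
        + 2 * (\<integral>\<^sup>+ p. ennreal ((norm (case_prod (w N) p - case_prod v p))\<^sup>2) \<partial>?M)"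
      by (simp add: nn_integral_add nn_integral_cmult)
    also have "\<dots> \<le> 2 * (2 * e) + 2 * e"
      by (intro add_mono mult_left_mono se less_imp_le[OF N]) simp_all
    also have "\<dots> = (2 * 2 + 2) * e" unfolding distrib_right by (simp only: mult.assoc)
    finally show ?thesis using s by auto
  qed
  then have "\<forall>j. \<exists>s. simple_adapted P F T s \<and>
      (\<integral>\<^sup>+ p. ennreal ((norm (case_prod (simple_process s) p - case_prod v p))\<^sup>2) \<partial>?M)
          \<le> 6 * ennreal (1 / real (Suc j))"
    by simp
  from choice[OF this] obtain s where s: "\<And>j. simple_adapted P F T (s j)"
    and err: "\<And>j. (\<integral>\<^sup>+ p. ennreal ((norm (case_prod (simple_process (s j)) p - case_prod v p))\<^sup>2) \<partial>?M)
        \<le> 6 * ennreal (1 / real (Suc j))"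
    by blast
  show ?thesis
  proof (rule that[OF s])
    show "L2_lim ?M (\<lambda>j. case_prod (simple_process (s j))) (case_prod v)"
    proof (rule L2_limI_nn_integral)
      show "sq_integrable ?M (case_prod (simple_process (s j)))" for j
        using simple_process_L2a[OF s] by (simp add: L2a_iff)
      have "(\<lambda>j. ennreal (1 / real (Suc j))) \<longlonglongrightarrow> ennreal 0"
        by (intro tendsto_ennrealI LIMSEQ_Suc[OF lim_1_over_n])
      then have "(\<lambda>j. 6 * ennreal (1 / real (Suc j))) \<longlonglongrightarrow> 6 * ennreal 0"
        by (intro ennreal_tendsto_cmult) simp
      then have z: "(\<lambda>j. 6 * ennreal (1 / real (Suc j))) \<longlonglongrightarrow> 0" by simp
      show "(\<lambda>j. \<integral>\<^sup>+ p. ennreal ((norm (case_prod (simple_process (s j)) p - case_prod v p))\<^sup>2) \<partial>?M)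
          \<longlonglongrightarrow> 0"
        by (rule tendsto_sandwich[OF _ _ tendsto_const z]) (intro always_eventually allI zero_le
            err)+
    qed (rule vm)
  qed
qed

end

section \<open>The stochastic integral\<close>

text \<open>Everything on the right is an inner product. Whenever the inner products of two triples
  agree, so do the left-hand sides, and this is how the isometry is exploited.\<close>

lemma sq_integral_diff2:
  assumes f: "sq_integrable M f" and g: "sq_integrable M g" and h: "sq_integrable M h"
  shows "(\<integral>x. (norm (f x - (a *\<^sub>R g x + b *\<^sub>R h x)))\<^sup>2 \<partial>M)
    = (\<integral>x. f x \<bullet> f x \<partial>M) - 2 * a * (\<integral>x. f x \<bullet> g x \<partial>M) - 2 * b * (\<integral>x. f x \<bullet> h x \<partial>M)
      + a\<^sup>2 * (\<integral>x. g x \<bullet> g x \<partial>M) + 2 * a * b * (\<integral>x. g x \<bullet> h x \<partial>M) + b\<^sup>2 * (\<integral>x. h x \<bullet> h x \<partial>M)"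
proof -
  have e: "(norm (x - (a *\<^sub>R y + b *\<^sub>R z)))\<^sup>2
      = x \<bullet> x - 2 * a * (x \<bullet> y) - 2 * b * (x \<bullet> z) + a\<^sup>2 * (y \<bullet> y) + 2 * a * b * (y \<bullet> z)
          + b\<^sup>2 * (z \<bullet> z)" for x y z :: 'b
    unfolding power2_norm_eq_inner by (simp add: algebra_simps inner_commute power2_eq_square)
  show ?thesis
    unfolding e using integrable_inner_sq[OF f f] integrable_inner_sq[OF f g] integrable_inner_sq[OF
        f h]
      integrable_inner_sq[OF g g] integrable_inner_sq[OF g h] integrable_inner_sq[OF h h]
    by simp
qed

context brownian_motion begin

text \<open>Replaces the extended integrals of the definition by \<open>L2_lim\<close>, which
  includes the square integrability of \<open>M t\<close>.\<close>

lemma has_ito_integral_iff: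
  fixes \<Sigma> :: "real \<Rightarrow> 'w \<Rightarrow> real ^ 'm ^ 'n"
  assumes \<Sigma>: "\<Sigma> \<in> L2a P F T (\<lambda>x. (norm x)\<^sup>2)"
  shows "has_ito_integral P F W T \<Sigma> M \<longleftrightarrow>
     (\<forall>t\<in>{0..T}. M t \<in> borel_measurable (F t)) \<and>
     (AE \<omega> in P. continuous_on {0..T} (\<lambda>t. M t \<omega>)) \<and>
     (\<exists>s. (\<forall>j. simple_adapted P F T (s j)) \<and>
        L2_lim (time_prod P T) (\<lambda>j. case_prod (simple_process (s j))) (case_prod \<Sigma>) \<and>
        (\<forall>t\<in>{0..T}. L2_lim P (\<lambda>j. simple_integral W (s j) t) (M t)))"
proof -
  have \<Sigma>sq: "sq_integrable (time_prod P T) (case_prod \<Sigma>)" using \<Sigma> by (simp add: L2a_iff)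
  have 1: "(\<lambda>j. expect_int P T (\<lambda>t \<omega>. (norm (simple_process (s j) t \<omega> - \<Sigma> t \<omega>))\<^sup>2)) \<longlonglongrightarrow> 0 \<longleftrightarrow>
      L2_lim (time_prod P T) (\<lambda>j. case_prod (simple_process (s j))) (case_prod \<Sigma>)"
    if s: "\<And>j. simple_adapted P F T (s j)" for s :: "nat \<Rightarrow> ('w, real ^ 'm ^ 'n) simple_integrand"
  proof -
    have sq: "sq_integrable (time_prod P T) (case_prod (simple_process (s j)))" for j
      using simple_process_L2a[OF s] by (simp add: L2a_iff)
    have "case_prod (\<lambda>t \<omega>. simple_process (s j) t \<omega> - \<Sigma> t \<omega>) \<in> borel_measurable (time_prod P T)"
        for j
      using sq_integrableD(1)[OF sq_integrable_diff[OF sq \<Sigma>sq], of j] by (simp add: case_prod_beta')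
    from expect_int_sq[OF this]
    have "expect_int P T (\<lambda>t \<omega>. (norm (simple_process (s j) t \<omega> - \<Sigma> t \<omega>))\<^sup>2)
        = (\<integral>\<^sup>+ p. ennreal ((norm (case_prod (simple_process (s j)) p
            - case_prod \<Sigma> p))\<^sup>2) \<partial>time_prod P T)" for j
      by (simp add: case_prod_beta')
    note eq = this
    show ?thesis
      unfolding eq using L2_limI_nn_integral[OF sq sq_integrableD(1)[OF \<Sigma>sq]]
          by (rule iffI[OF _ L2_lim_nn_integral])
  qed
  have 2: "(\<lambda>j. \<integral>\<^sup>+ \<omega>. ennreal ((norm (simple_integral W (s j) t \<omega> - M t \<omega>))\<^sup>2) \<partial>P) \<longlonglongrightarrow> 0 \<longleftrightarrow>
      L2_lim P (\<lambda>j. simple_integral W (s j) t) (M t)"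
    if s: "\<And>j. simple_adapted P F T (s j)" and M: "M t \<in> borel_measurable (F t)" and t: "t \<in> {0..T}"
    for s :: "nat \<Rightarrow> ('w, real ^ 'm ^ 'n) simple_integrand" and t
  proof -
    have sq: "sq_integrable P (simple_integral W (s j) t)" for j
      using l2_martingaleD(2)[OF l2_martingale_simple[OF s]] t by simp
    have "M t \<in> borel_measurable P" using F_measurable[OF _ M] t by simp
    from L2_limI_nn_integral[OF sq this] show ?thesis by (rule iffI[OF _ L2_lim_nn_integral])
  qed
  show ?thesis
    unfolding has_ito_integral_def mat_sq_eq vec_sq_eq
  proof (intro conj_cong refl ex_cong1 ball_cong)
    fix s :: "nat \<Rightarrow> ('w, real ^ 'm ^ 'n) simple_integrand"
    assume M: "\<forall>t\<in>{0..T}. M t \<in> borel_measurable (F t)" and s: "\<forall>j. simple_adapted P F T (s j)"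
    show "(\<lambda>j. expect_int P T (\<lambda>t \<omega>. (norm (simple_process (s j) t \<omega> - \<Sigma> t \<omega>))\<^sup>2)) \<longlonglongrightarrow> 0 \<longleftrightarrow>
        L2_lim (time_prod P T) (\<lambda>j. case_prod (simple_process (s j))) (case_prod \<Sigma>)"
      by (rule 1) (simp add: s)
    show "(\<lambda>j. \<integral>\<^sup>+ \<omega>. ennreal ((norm (simple_integral W (s j) t \<omega> - M t \<omega>))\<^sup>2) \<partial>P) \<longlonglongrightarrow> 0 \<longleftrightarrow>
        L2_lim P (\<lambda>j. simple_integral W (s j) t) (M t)" if "t \<in> {0..T}" for t
      by (rule 2) (use M s that in auto)
  qed
qed

lemma has_ito_integral_martingale:
  fixes \<Sigma> :: "real \<Rightarrow> 'w \<Rightarrow> real ^ 'm ^ 'n"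
  assumes \<Sigma>: "\<Sigma> \<in> L2a P F T (\<lambda>x. (norm x)\<^sup>2)" and M: "has_ito_integral P F W T \<Sigma> M"
  shows "l2_martingale T M" and "AE \<omega> in P. continuous_on {0..T} (\<lambda>t. M t \<omega>)"
proof -
  from M obtain s where s: "\<And>j. simple_adapted P F T (s j)"
      and Mm: "\<And>t. t \<in> {0..T} \<Longrightarrow> M t \<in> borel_measurable (F t)"
    and lim: "\<And>t. t \<in> {0..T} \<Longrightarrow> L2_lim P (\<lambda>j. simple_integral W (s j) t) (M t)"
    unfolding has_ito_integral_iff[OF \<Sigma>] by blast
  show "l2_martingale T M"
    by (rule l2_martingale_L2_lim[where X = "\<lambda>j. simple_integral W (s j)"])
      (simp_all add: Mm lim l2_martingale_simple[OF s])
  show "AE \<omega> in P. continuous_on {0..T} (\<lambda>t. M t \<omega>)" using M unfolding has_ito_integral_iff[OF \<Sigma>]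
      by blast
qed

text \<open>For members of equal index of the two approximating sequences the identity is that of
  simple integrals, and both sides converge by continuity of the inner product. It holds for
  arbitrary versions and witnesses, which is what uniqueness needs.\<close>

lemma ito_isometry:
  fixes \<Sigma> \<Sigma>' :: "real \<Rightarrow> 'w \<Rightarrow> real ^ 'm ^ 'n"
  assumes T: "0 \<le> T"
    and \<Sigma>: "\<Sigma> \<in> L2a P F T (\<lambda>x. (norm x)\<^sup>2)" and M: "has_ito_integral P F W T \<Sigma> M"
    and \<Sigma>': "\<Sigma>' \<in> L2a P F T (\<lambda>x. (norm x)\<^sup>2)" and M': "has_ito_integral P F W T \<Sigma>' M'"
  shows "(\<integral>\<omega>. M T \<omega> \<bullet> M' T \<omega> \<partial>P) = (\<integral>p. case_prod \<Sigma> p \<bullet> case_prod \<Sigma>' p \<partial>time_prod P T)"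
proof -
  from M obtain s where s: "\<And>j. simple_adapted P F T (s j)"
    and p: "L2_lim (time_prod P T) (\<lambda>j. case_prod (simple_process (s j))) (case_prod \<Sigma>)"
    and i: "L2_lim P (\<lambda>j. simple_integral W (s j) T) (M T)"
    unfolding has_ito_integral_iff[OF \<Sigma>] using T by force
  from M' obtain s' where s': "\<And>j. simple_adapted P F T (s' j)"
    and p': "L2_lim (time_prod P T) (\<lambda>j. case_prod (simple_process (s' j))) (case_prod \<Sigma>')"
    and i': "L2_lim P (\<lambda>j. simple_integral W (s' j) T) (M' T)"
    unfolding has_ito_integral_iff[OF \<Sigma>'] using T by force
  show ?thesis
    using L2_lim_inner[OF i i'] L2_lim_inner[OF p p'] unfolding simple_integral_isometry[OF s s']
    by (rule LIMSEQ_unique)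
qed

text \<open>The polarised isometry turned into one for distances, so that integrands close in mean
  square have integrals close at time \<open>T\<close>.\<close>

lemma simple_integral_diff_isometry:
  fixes s s' :: "('w, real ^ 'm ^ 'n) simple_integrand"
  assumes T: "0 \<le> T" and s: "simple_adapted P F T s" and s': "simple_adapted P F T s'"
  shows "(\<integral>\<omega>. (norm (simple_integral W s T \<omega> - simple_integral W s' T \<omega>))\<^sup>2 \<partial>P)
    = (\<integral>p. (norm (case_prod (simple_process s) p
        - case_prod (simple_process s') p))\<^sup>2 \<partial>time_prod P T)"
proof -
  have p: "sq_integrable (time_prod P T) (case_prod (simple_process s))" "sq_integrable (time_prod P
      T) (case_prod (simple_process s'))"
    using simple_process_L2a s s' by (auto simp: L2a_iff)
  have i: "sq_integrable P (simple_integral W s T)" "sq_integrable P (simple_integral W s' T)"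
    using l2_martingaleD(2)[OF l2_martingale_simple] s s' T by auto
  show ?thesis
    using sq_integral_diff2[OF i(1) i(2) i(2), of 1 0] sq_integral_diff2[OF p(1) p(2) p(2), of 1 0]
      simple_integral_isometry[OF s s] simple_integral_isometry[OF s s'] simple_integral_isometry[OF
          s' s']
    by simp
qed

lemma ito_integral_exists:
  fixes \<Sigma> :: "real \<Rightarrow> 'w \<Rightarrow> real ^ 'm ^ 'n"
  assumes T: "0 < T" and \<Sigma>: "\<Sigma> \<in> L2a P F T (\<lambda>x. (norm x)\<^sup>2)"
  obtains M where "has_ito_integral P F W T \<Sigma> M"
proof -
  have T0: "0 \<le> T" using T by simp
  obtain s0 where s0: "\<And>j. simple_adapted P F T (s0 j)"
    and lim0: "L2_lim (time_prod P T) (\<lambda>j. case_prod (simple_process (s0 j))) (case_prod \<Sigma>)"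
    using simple_approx[OF T \<Sigma>] by blast
  obtain r where r: "strict_mono r"
    and rapid0: "\<And>j. (\<integral>p. (norm (case_prod (simple_process (s0 (r (Suc j)))) p
        - case_prod (simple_process (s0 (r j))) p))\<^sup>2
      \<partial>time_prod P T) \<le> (1 / 8) ^ j"
    using L2_Cauchy_rapid_subseq[OF L2_lim_Cauchy[OF lim0]] by blast
  define s where "s j = s0 (r j)" for j
  have s: "simple_adapted P F T (s j)" for j by (simp add: s_def s0)
  have lim: "L2_lim (time_prod P T) (\<lambda>j. case_prod (simple_process (s j))) (case_prod \<Sigma>)"
    unfolding s_def by (rule L2_lim_subseq[OF lim0 r])
  define X where "X j = simple_integral W (s j)" for j
  have X: "l2_martingale T (X j)" for j unfolding X_def by (rule l2_martingale_simple[OF s])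
  have dist: "(\<integral>\<omega>. (norm (X j T \<omega> - X k T \<omega>))\<^sup>2 \<partial>P)
      = (\<integral>p. (norm (case_prod (simple_process (s j)) p
          - case_prod (simple_process (s k)) p))\<^sup>2 \<partial>time_prod P T)" for j k
    unfolding X_def by (rule simple_integral_diff_isometry[OF T0 s s])
  define D where "D j t \<omega> = X (Suc j) t \<omega> - X j t \<omega>" for j t \<omega>
  have D: "l2_martingale T (D j)" for j unfolding D_def[abs_def]
      by (rule l2_martingale_diff[OF X X])
  have Xc: "AE \<omega> in P. continuous_on {0..T} (\<lambda>t. X j t \<omega>)" for j
    unfolding X_def by (rule continuous_simple_integral[OF s])
  have Dc: "AE \<omega> in P. continuous_on {0..T} (\<lambda>t. D j t \<omega>)" for j
    using Xc[of j] Xc[of "Suc j"] by eventually_elim (simp add: D_def continuous_on_diff)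
  have rapid: "(\<integral>\<omega>. (norm (D j T \<omega>))\<^sup>2 \<partial>P) \<le> (1 / 8) ^ j" for j
    using rapid0[of j] dist[of "Suc j" j] by (simp add: D_def s_def)
  have "\<exists>A. A \<in> sets P \<and> measure P A \<le> (1 / 2) ^ j \<and>
      (AE \<omega> in P. \<omega> \<notin> A \<longrightarrow> (\<forall>t\<in>{0..T}. norm (D j t \<omega>) \<le> (1 / 2) ^ j))" for j
  proof -
    \<comment> \<open>Second moments of order \<open>8 ^ (- j)\<close> against squared thresholds
      \<open>4 ^ (- j)\<close> leave probabilities of order \<open>2 ^ (- j)\<close>. Summable
      probabilities serve Borel-Cantelli, and summable thresholds the uniform convergence.\<close>
    have "(0 :: real) < (1 / 2) ^ j" by simp
    from l2_martingale_maximal[OF T D Dc this, of j] obtain A where A: "A \<in> sets P"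
      "measure P A \<le> (\<integral>\<omega>. (norm (D j T \<omega>))\<^sup>2 \<partial>P) / ((1 / 2) ^ j)\<^sup>2"
      "AE \<omega> in P. \<omega> \<notin> A \<longrightarrow> (\<forall>t\<in>{0..T}. norm (D j t \<omega>) \<le> (1 / 2) ^ j)" by blast
    note A(2)
    also have "(\<integral>\<omega>. (norm (D j T \<omega>))\<^sup>2 \<partial>P) / ((1 / 2) ^ j)\<^sup>2 \<le> (1 / 8) ^ j / ((1 / 2) ^ j)\<^sup>2"
      by (intro divide_right_mono rapid) simp
    also have "\<dots> = (1 / 2) ^ j"
      by (simp add: power2_eq_square power_mult_distrib[symmetric] power_divide[symmetric] flip:
          power_mult_distrib)
    finally show ?thesis using A by blast
  qed
  then have "\<forall>j. \<exists>A. A \<in> sets P \<and> measure P A \<le> (1 / 2) ^ j \<and>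
      (AE \<omega> in P. \<omega> \<notin> A \<longrightarrow> (\<forall>t\<in>{0..T}. norm (D j t \<omega>) \<le> (1 / 2) ^ j))" by (rule allI)
  from choice[OF this] obtain A where "\<forall>j. A j \<in> sets P \<and> measure P (A j) \<le> (1 / 2) ^ j \<and>
      (AE \<omega> in P. \<omega> \<notin> A j \<longrightarrow> (\<forall>t\<in>{0..T}. norm (D j t \<omega>) \<le> (1 / 2) ^ j))" by (rule exE)
  then have A: "\<And>j. A j \<in> sets P" "\<And>j. measure P (A j) \<le> (1 / 2) ^ j"
    and AD: "\<And>j. AE \<omega> in P. \<omega> \<notin> A j \<longrightarrow> (\<forall>t\<in>{0..T}. norm (D j t \<omega>) \<le> (1 / 2) ^ j)"
    by simp_all
  have "summable (\<lambda>j. measure P (A j))"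
    by (rule summable_comparison_test'[of "\<lambda>j. (1 / 2 :: real) ^ j" 0]) (simp_all add: A
        summable_geometric)
  then have BC: "AE \<omega> in P. eventually (\<lambda>j. \<omega> \<in> space P - A j) sequentially"
    by (intro borel_cantelli_AE1) (simp_all add: A emeasure_eq_measure)
  \<comment> \<open>\<open>lim\<close> is total, so \<open>M t\<close> is measurable for
    \<open>F t\<close> without any modification on an exceptional set; almost surely it is the
    uniform limit.\<close>
  define M where "M t \<omega> = lim (\<lambda>j. X j t \<omega>)" for t \<omega>
  have unif: "AE \<omega> in P. uniform_limit {0..T} (\<lambda>j t. X j t \<omega>) (\<lambda>t. M t \<omega>) sequentially"
  proof -
    have "AE \<omega> in P. \<forall>j. \<omega> \<notin> A j \<longrightarrow> (\<forall>t\<in>{0..T}. norm (D j t \<omega>) \<le> (1 / 2) ^ j)"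
      using AD by (simp add: AE_all_countable)
    with BC show ?thesis
    proof eventually_elim
      case (elim \<omega>)
      \<comment> \<open>Borel-Cantelli bounds all but finitely many terms, hence the eventual form
        of the Weierstrass test.\<close>
      have "eventually (\<lambda>j. \<forall>t\<in>{0..T}. norm (D j t \<omega>) \<le> (1 / 2) ^ j) sequentially"
        using elim(1) by eventually_elim (use elim(2) in blast)
      then have "uniform_limit {0..T} (\<lambda>j t. \<Sum>i<j. D i t \<omega>) (\<lambda>t. \<Sum>i. D i t \<omega>) sequentially"
        by (rule Weierstrass_m_test_ev) (simp add: summable_geometric)
      then have "uniform_limit {0..T} (\<lambda>j t. X 0 t \<omega> + (\<Sum>i<j. D i t \<omega>)) (\<lambda>t. X 0 t \<omega>
          + (\<Sum>i. D i t \<omega>)) sequentially"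
        by (intro uniform_limit_add uniform_limit_const)
      moreover have "X 0 t \<omega> + (\<Sum>i<j. D i t \<omega>) = X j t \<omega>" for j t
        unfolding D_def by (simp add: sum_lessThan_telescope[of "\<lambda>j. X j t \<omega>"])
      ultimately have U: "uniform_limit {0..T} (\<lambda>j t. X j t \<omega>) (\<lambda>t. X 0 t \<omega>
          + (\<Sum>i. D i t \<omega>)) sequentially"
        by simp
      have "M t \<omega> = X 0 t \<omega> + (\<Sum>i. D i t \<omega>)" if "t \<in> {0..T}" for t
        unfolding M_def by (rule limI[OF tendsto_uniform_limitI[OF U that]])
      then show ?case using U by (subst uniform_limit_cong'[where g = "\<lambda>j t. X j t \<omega>"]) auto
    qed
  qed
  have Mm: "M t \<in> borel_measurable (F t)" if "t \<in> {0..T}" for t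
    unfolding M_def using l2_martingaleD(1)[OF X] that by (intro borel_measurable_lim_metric) simp
  show ?thesis
  proof (rule that, unfold has_ito_integral_iff[OF \<Sigma>], intro conjI ballI exI[of _ s] allI)
    show "simple_adapted P F T (s j)" for j by (rule s)
    show "L2_lim (time_prod P T) (\<lambda>j. case_prod (simple_process (s j))) (case_prod \<Sigma>)" by (rule lim)
    show "M t \<in> borel_measurable (F t)" if "t \<in> {0..T}" for t by (rule Mm[OF that])
    have "AE \<omega> in P. \<forall>j. continuous_on {0..T} (\<lambda>t. X j t \<omega>)" using Xc
        by (simp add: AE_all_countable)
    with unif show "AE \<omega> in P. continuous_on {0..T} (\<lambda>t. M t \<omega>)"
    proof eventually_elim
      case (elim \<omega>)
      show ?case by (rule uniform_limit_theorem[OF _ elim(1)]) (use elim(2) in auto)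
    qed
    fix t assume t: "t \<in> {0..T}"
    have sq: "sq_integrable P (X j t')" if "t' \<in> {0..T}" for j t' using l2_martingaleD(2)[OF X] that
        by simp
    have "L2_Cauchy P (\<lambda>j. X j t)"
      unfolding L2_Cauchy_def
    proof (intro conjI allI impI)
      show "sq_integrable P (X j t)" for j by (rule sq[OF t])
      fix e :: real assume "0 < e"
      then obtain N where N: "\<And>j k. N \<le> j \<Longrightarrow> N \<le> k \<Longrightarrow>
          (\<integral>p. (norm (case_prod (simple_process (s j)) p
              - case_prod (simple_process (s k)) p))\<^sup>2 \<partial>time_prod P T) < e"
        using L2_lim_Cauchy[OF lim] unfolding L2_Cauchy_def by meson
      have "(\<integral>\<omega>. (norm (X j t \<omega> - X k t \<omega>))\<^sup>2 \<partial>P) < e" if "N \<le> j" "N \<le> k" for j k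
      proof -
        \<comment> \<open>Second moments of a martingale grow in time, so closeness at
          \<open>T\<close> controls all earlier times.\<close>
        have "(\<integral>\<omega>. (norm (X j t \<omega> - X k t \<omega>))\<^sup>2 \<partial>P) \<le> (\<integral>\<omega>. (norm (X j T \<omega> - X k T \<omega>))\<^sup>2 \<partial>P)"
          using l2_martingale_sq_mono[OF l2_martingale_diff[OF X[of j] X[of k]], of t T] t by simp
        then show ?thesis using N[OF that] unfolding dist by linarith
      qed
      then show "\<exists>N. \<forall>j\<ge>N. \<forall>k\<ge>N. (\<integral>\<omega>. (norm (X j t \<omega> - X k t \<omega>))\<^sup>2 \<partial>P) < e" by blast
    qed
    moreover have "M t \<in> borel_measurable P" using F_measurable[OF _ Mm[OF t]] t by simp
    moreover have "AE \<omega> in P. (\<lambda>j. X j t \<omega>) \<longlonglongrightarrow> M t \<omega>"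
      using unif by eventually_elim (rule tendsto_uniform_limitI[OF _ t])
    ultimately show "L2_lim P (\<lambda>j. simple_integral W (s j) t) (M t)"
      unfolding X_def[symmetric] by (rule L2_lim_Cauchy_AE)
  qed
qed

text \<open>\<open>N\<close> is any version of the integral of the combination. By the isometry the
  second moment of the terminal defect equals the same expression in the integrands, where it is
  identically zero. With \<open>a = 1\<close> and \<open>b = 0\<close> this is uniqueness of the
  integral.\<close>

lemma ito_integral_lincomb:
  fixes \<Sigma> \<Sigma>' :: "real \<Rightarrow> 'w \<Rightarrow> real ^ 'm ^ 'n"
  assumes T: "0 < T"
    and \<Sigma>: "\<Sigma> \<in> L2a P F T (\<lambda>x. (norm x)\<^sup>2)" and M: "has_ito_integral P F W T \<Sigma> M"
    and \<Sigma>': "\<Sigma>' \<in> L2a P F T (\<lambda>x. (norm x)\<^sup>2)" and M': "has_ito_integral P F W T \<Sigma>' M'"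
    and N: "has_ito_integral P F W T (\<lambda>t \<omega>. a *\<^sub>R \<Sigma> t \<omega> + b *\<^sub>R \<Sigma>' t \<omega>) N"
  shows "AE \<omega> in P. \<forall>t\<in>{0..T}. N t \<omega> = a *\<^sub>R M t \<omega> + b *\<^sub>R M' t \<omega>"
proof -
  let ?\<Gamma> = "\<lambda>t \<omega>. a *\<^sub>R \<Sigma> t \<omega> + b *\<^sub>R \<Sigma>' t \<omega>"
  have T0: "0 \<le> T" using T by simp
  have \<Gamma>: "?\<Gamma> \<in> L2a P F T (\<lambda>x. (norm x)\<^sup>2)" by (intro L2a_add L2a_scaleR \<Sigma> \<Sigma>')
  note mM = has_ito_integral_martingale[OF \<Sigma> M] and mM' = has_ito_integral_martingale[OF \<Sigma>' M']
    and mN = has_ito_integral_martingale[OF \<Gamma> N]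
  have X: "l2_martingale T (\<lambda>t \<omega>. N t \<omega> - (a *\<^sub>R M t \<omega> + b *\<^sub>R M' t \<omega>))"
    by (intro l2_martingale_diff l2_martingale_add l2_martingale_scaleR mM mM' mN)
  have Xc: "AE \<omega> in P. continuous_on {0..T} (\<lambda>t. N t \<omega> - (a *\<^sub>R M t \<omega> + b *\<^sub>R M' t \<omega>))"
    using mM(2) mM'(2) mN(2) by eventually_elim (intro continuous_intros)
  have sq: "sq_integrable P (M T)" "sq_integrable P (M' T)" "sq_integrable P (N T)"
    using l2_martingaleD(2) mM(1) mM'(1) mN(1) T0 by blast+
  have sqp: "sq_integrable (time_prod P T) (case_prod \<Sigma>)" "sq_integrable (time_prod P T) (case_prod
      \<Sigma>')"
    "sq_integrable (time_prod P T) (case_prod ?\<Gamma>)"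
    using \<Sigma> \<Sigma>' \<Gamma> by (simp_all only: L2a_iff)
  have "(\<integral>\<omega>. (norm (N T \<omega> - (a *\<^sub>R M T \<omega> + b *\<^sub>R M' T \<omega>)))\<^sup>2 \<partial>P)
      = (\<integral>p. (norm (case_prod ?\<Gamma> p - (a *\<^sub>R case_prod \<Sigma> p + b *\<^sub>R case_prod \<Sigma>' p)))\<^sup>2 \<partial>time_prod P T)"
    unfolding sq_integral_diff2[OF sq(3,1,2)] sq_integral_diff2[OF sqp(3,1,2)]
      ito_isometry[OF T0 \<Gamma> N \<Gamma> N] ito_isometry[OF T0 \<Gamma> N \<Sigma> M] ito_isometry[OF T0 \<Gamma> N \<Sigma>' M']
      ito_isometry[OF T0 \<Sigma> M \<Sigma> M] ito_isometry[OF T0 \<Sigma> M \<Sigma>' M'] ito_isometry[OF T0 \<Sigma>' M' \<Sigma>' M'] ..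
  also have "\<dots> = 0" by (simp add: case_prod_beta')
  finally have "AE \<omega> in P. \<forall>t\<in>{0..T}. N t \<omega> - (a *\<^sub>R M t \<omega> + b *\<^sub>R M' t \<omega>) = 0"
    by (rule l2_martingale_eq_0[OF T X Xc])
  then show ?thesis by eventually_elim simp
qed

end

section \<open>Representation of semimartingales by their intensity\<close>

text \<open>Vanishing primitives give vanishing integrals over intervals, and by induction over
  Borel sets over all of these. Testing on the set where \<open>h t \<bullet> c\<close> is positive
  shows that it is null; the directions \<open>b\<close> and \<open>- b\<close> for all basis
  vectors then force \<open>h\<close> to vanish.\<close>

lemma AE_zero_of_integral_zero:
  fixes f :: "real \<Rightarrow> 'b :: euclidean_space"
  assumes T: "0 \<le> T" and f: "set_integrable lborel {0..T} f"
    and z: "\<And>t. t \<in> {0..T} \<Longrightarrow> (LINT s:{0..t}|lborel. f s) = 0"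
  shows "AE t in lborel. t \<in> {0..T} \<longrightarrow> f t = 0"
proof -
  define h where "h t = indicator {0..T} t *\<^sub>R f t" for t
  have h: "integrable lborel h" unfolding h_def using f by (simp add: set_integrable_def)
  have hA: "integrable lborel (\<lambda>t. indicator A t *\<^sub>R h t)" if "A \<in> sets borel" for A
    using integrable_mult_indicator[of A lborel h] h that by simp
  have h0: "(\<integral>t. indicator {0..c} t *\<^sub>R h t \<partial>lborel) = 0" if "c \<in> {0..T}" for c
  proof -
    have "indicator {0..c} t *\<^sub>R h t = indicator {0..c} t *\<^sub>R f t" for t using that
        by (auto simp: h_def indicator_def)
    then show ?thesis using z[OF that] by (simp only: set_lebesgue_integral_def)
  qed
  have int0: "(\<integral>t. indicator A t *\<^sub>R h t \<partial>lborel) = 0" if "A \<in> sets borel" for A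
    using that
  proof (induction rule: borel_set_induct)
    case (interval a b)
    \<comment> \<open>\<open>h\<close> vanishes outside \<open>{0..T}\<close>, so the end points may
      be clamped there. The difference of the two integrals then loses at most the left end point of
      the closed interval, a null set.\<close>
    define a' b' where "a' = max 0 (min T a)" and "b' = max 0 (min T b)"
    have ab: "a' \<in> {0..T}" "b' \<in> {0..T}" using T by (auto simp: a'_def b'_def)
    have "(\<integral>t. indicator {a..b} t *\<^sub>R h t \<partial>lborel)
        = (\<integral>t. indicator {0..b'} t *\<^sub>R h t - indicator {0..a'} t *\<^sub>R h t \<partial>lborel)"
    proof (rule integral_cong_AE)
      show "AE t in lborel. indicator {a..b} t *\<^sub>R h t
          = indicator {0..b'} t *\<^sub>R h t - indicator {0..a'} t *\<^sub>R h t"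
        using AE_lborel_singleton[of a']
      proof eventually_elim
        case (elim t)
        then show ?case
          using interval T by (cases "t \<in> {0..T}") (auto simp: h_def indicator_def a'_def b'_def
              max_def min_def split: if_splits)
      qed
    qed (use h in auto)
    also have "\<dots> = 0" using hA h0[OF ab(1)] h0[OF ab(2)] by simp
    finally show ?case .
  next
    case (compl A)
    have "indicator (- A) t *\<^sub>R h t = indicator {0..T} t *\<^sub>R h t - indicator A t *\<^sub>R h t" for t
      by (auto simp: h_def indicator_def)
    then show ?case using hA[of A] hA[of "{0..T}"] h0[of T] compl T by simp
  next
    case (union A)
    have "set_integrable lborel (\<Union>i. A i) h" using hA[of "\<Union>i. A i"] union
        by (simp add: set_integrable_def)
    then have "(LINT t:(\<Union>i. A i)|lborel. h t) = (\<Sum>i. LINT t:(A i)|lborel. h t)"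
      using union by (intro lebesgue_integral_countable_add) (auto simp: disjoint_family_on_def)
    then show ?case using union by (simp add: set_lebesgue_integral_def)
  qed simp
  have "AE t in lborel. h t \<bullet> b = 0" for b
  proof -
    have hm [measurable]: "h \<in> borel_measurable borel" using h by auto
    have sgn: "AE t in lborel. h t \<bullet> c \<le> 0" for c
    proof -
      define A where "A = {t. 0 < h t \<bullet> c}"
      have A [measurable]: "A \<in> sets borel" unfolding A_def by measurable
      have "(\<integral>t. (indicator A t *\<^sub>R h t) \<bullet> c \<partial>lborel) = 0"
        using integral_inner_left[of c lborel "\<lambda>t. indicator A t *\<^sub>R h t"] hA[OF A] int0[OF A]
            by simp
      moreover have "integrable lborel (\<lambda>t. (indicator A t *\<^sub>R h t) \<bullet> c)"
        by (rule integrable_inner_left[OF hA[OF A]])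
      moreover have "AE t in lborel. 0 \<le> (indicator A t *\<^sub>R h t) \<bullet> c"
          by (auto simp: A_def indicator_def)
      ultimately have "AE t in lborel. (indicator A t *\<^sub>R h t) \<bullet> c = 0"
        using integral_nonneg_eq_0_iff_AE by blast
      then show ?thesis
      proof eventually_elim
        case (elim t)
        then show ?case by (cases "t \<in> A") (auto simp: A_def)
      qed
    qed
    show ?thesis using sgn[of b] sgn[of "- b"] by eventually_elim simp
  qed
  then have "AE t in lborel. \<forall>b\<in>Basis. h t \<bullet> b = 0" by (intro AE_finite_allI) auto
  then show ?thesis
  proof eventually_elim
    case (elim t)
    have "h t = 0" by (rule euclidean_eqI) (use elim in simp)
    then show ?case by (auto simp: h_def)
  qed
qed

text \<open>The Cauchy--Schwarz bound \<open>|\<integral>\<^sub>a\<^sup>b f|\<^sup>2 \<le> (b - a) \<integral>\<^sub>a\<^sup>b |f|\<^sup>2\<close>, summed over a uniform partition of \<open>[0, T]\<close>.\<close>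

lemma sum_sq_increments_le:
  fixes f :: "real \<Rightarrow> 'b :: euclidean_space"
  assumes d: "0 \<le> d" and n: "real n * d \<le> T" and f: "sq_integrable (restrict_space lborel {0..T}) f"
  shows "(\<Sum>i<n. (norm ((LINT s:{0..real (Suc i) * d}|lborel. f s)
      - (LINT s:{0..real i * d}|lborel. f s)))\<^sup>2)
    \<le> d * (LINT s:{0..T}|lborel. (norm (f s))\<^sup>2)"
proof -
  have T: "0 \<le> T" using d n by (meson mult_nonneg_nonneg of_nat_0_le_iff order_trans)
  define h where "h t = indicator {0..T} t *\<^sub>R f t" for t
  from sq_integrable_integrable[OF finite_measure_time f] have h: "integrable lborel h"
    unfolding h_def by (simp add: integrable_restrict_space)
  then have hm [measurable]: "h \<in> borel_measurable borel" by auto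
  have "integrable lborel (\<lambda>t. indicator {0..T} t *\<^sub>R (norm (f t))\<^sup>2)"
    using sq_integrableD(2)[OF f] by (simp add: integrable_restrict_space)
  then have h2: "integrable lborel (\<lambda>t. (norm (h t))\<^sup>2)"
    by (rule Bochner_Integration.integrable_cong[THEN iffD1, rotated 2]) (auto simp: h_def
        indicator_def)
  then have hsq: "sq_integrable lborel h" by (simp add: sq_integrable_def)
  have hA2: "integrable lborel (\<lambda>t. indicator A t * (norm (h t))\<^sup>2)" if "A \<in> sets borel" for A
    using integrable_mult_indicator[OF _ h2, of A] that by simp
  have hA: "integrable lborel (\<lambda>t. indicator A t *\<^sub>R h t)" if "A \<in> sets borel" for A
    using integrable_mult_indicator[OF _ h, of A] that by simp
  have L: "(LINT s:{0..c}|lborel. f s) = (\<integral>s. indicator {0..c} s *\<^sub>R h s \<partial>lborel)" if "c \<le> T" for c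
    unfolding set_lebesgue_integral_def
    by (intro Bochner_Integration.integral_cong) (use that in \<open>auto simp: h_def indicator_def\<close>)
  have step: "(norm ((LINT s:{0..b}|lborel. f s) - (LINT s:{0..a}|lborel. f s)))\<^sup>2
      \<le> (b - a) * (\<integral>s. indicator {a<..b} s * (norm (h s))\<^sup>2 \<partial>lborel)"
    if ab: "0 \<le> a" "a \<le> b" "b \<le> T" for a b
  proof -
    have "(LINT s:{0..b}|lborel. f s) - (LINT s:{0..a}|lborel. f s)
        = (\<integral>s. indicator {0..b} s *\<^sub>R h s - indicator {0..a} s *\<^sub>R h s \<partial>lborel)"
      using L[of a] L[of b] ab hA by simp
    also have "\<dots> = (\<integral>s. indicator {a<..b} s *\<^sub>R h s \<partial>lborel)"
      by (intro Bochner_Integration.integral_cong) (use ab in \<open>auto simp: indicator_def\<close>)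
    finally have "norm ((LINT s:{0..b}|lborel. f s) - (LINT s:{0..a}|lborel. f s))
        \<le> (\<integral>s. norm (indicator {a<..b} s *\<^sub>R h s) \<partial>lborel)"
      by (simp only: integral_norm_bound)
    \<comment> \<open>The indicator is written as its own square: one copy will contribute the
      length \<open>b - a\<close>, the other stays with \<open>h\<close>.\<close>
    also have "\<dots> = (\<integral>s. (indicator {a<..b} s :: real) \<bullet> (indicator {a<..b} s *\<^sub>R norm (h s))
        \<partial>lborel)"
      by (intro Bochner_Integration.integral_cong) (auto simp: indicator_def)
    also have "\<dots> \<le> \<bar>\<dots>\<bar>" by simp
    also have "\<dots> \<le> sqrt (\<integral>s. (norm (indicator {a<..b} s :: real))\<^sup>2 \<partial>lborel)
        * sqrt (\<integral>s. (norm (indicator {a<..b} s *\<^sub>R norm (h s)))\<^sup>2 \<partial>lborel)"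
    proof (rule Cauchy_Schwarz_sq_integrable)
      have e: "(norm (indicator {a<..b} s :: real))\<^sup>2 = indicator {a<..b} s" for s
          by (simp add: indicator_def)
      have "integrable lborel (indicator {a<..b} :: real \<Rightarrow> real)" using ab by simp
      then show "sq_integrable lborel (indicator {a<..b} :: real \<Rightarrow> real)"
        unfolding sq_integrable_def e by simp
      have "(norm (indicator {a<..b} s *\<^sub>R norm (h s)))\<^sup>2 = indicator {a<..b} s * (norm (h s))\<^sup>2" for s
        by (simp add: indicator_def)
      then show "sq_integrable lborel (\<lambda>s. indicator {a<..b} s *\<^sub>R norm (h s))"
        unfolding sq_integrable_def using hA2[of "{a<..b}"] by simp
    qed
    also have "(\<integral>s. (norm (indicator {a<..b} s :: real))\<^sup>2 \<partial>lborel)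
        = (\<integral>s. indicator {a<..b} s \<partial>lborel)"
      by (intro Bochner_Integration.integral_cong) (auto simp: indicator_def)
    also have "\<dots> = b - a" using ab by simp
    also have "(\<integral>s. (norm (indicator {a<..b} s *\<^sub>R norm (h s)))\<^sup>2 \<partial>lborel)
        = (\<integral>s. indicator {a<..b} s * (norm (h s))\<^sup>2 \<partial>lborel)"
      by (intro Bochner_Integration.integral_cong) (auto simp: indicator_def)
    finally have "(norm ((LINT s:{0..b}|lborel. f s) - (LINT s:{0..a}|lborel. f s)))\<^sup>2
        \<le> (sqrt (b - a) * sqrt (\<integral>s. indicator {a<..b} s * (norm (h s))\<^sup>2 \<partial>lborel))\<^sup>2"
      by (rule power_mono) simp
    also have "\<dots> = (b - a) * (\<integral>s. indicator {a<..b} s * (norm (h s))\<^sup>2 \<partial>lborel)"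
      using ab by (simp add: power_mult_distrib)
    finally show ?thesis .
  qed
  have "(\<Sum>i<k. (norm ((LINT s:{0..real (Suc i) * d}|lborel. f s)
      - (LINT s:{0..real i * d}|lborel. f s)))\<^sup>2)
      \<le> d * (\<integral>s. indicator {0<..real k * d} s * (norm (h s))\<^sup>2 \<partial>lborel)" if "k \<le> n" for k
    using that
  proof (induction k)
    case (Suc k)
    have "real (Suc k) * d \<le> real n * d" using Suc.prems d by (intro mult_right_mono) auto
    then have kd: "0 \<le> real k * d" "real k * d \<le> real (Suc k) * d" "real (Suc k) * d \<le> T"
      using d n by (auto simp: algebra_simps)
    have "(\<integral>s. indicator {0<..real (Suc k) * d} s * (norm (h s))\<^sup>2 \<partial>lborel)
        = (\<integral>s. indicator {0<..real k * d} s * (norm (h s))\<^sup>2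
            + indicator {real k * d<..real (Suc k) * d} s * (norm (h s))\<^sup>2 \<partial>lborel)"
      by (intro Bochner_Integration.integral_cong) (use kd in \<open>auto simp: indicator_def\<close>)
    also have "\<dots> = (\<integral>s. indicator {0<..real k * d} s * (norm (h s))\<^sup>2 \<partial>lborel)
        + (\<integral>s. indicator {real k * d<..real (Suc k) * d} s * (norm (h s))\<^sup>2 \<partial>lborel)"
      using hA2 by simp
    finally have split: "(\<integral>s. indicator {0<..real (Suc k) * d} s * (norm (h s))\<^sup>2 \<partial>lborel) = \<dots>" .
    have "real (Suc k) * d - real k * d = d" by (simp add: algebra_simps)
    then show ?case
      using Suc.IH Suc.prems step[OF kd] unfolding split distrib_left by simp
  qed simp
  from this[OF order_refl] have "(\<Sum>i<n. (norm ((LINT s:{0..real (Suc i) * d}|lborel. f s)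
      - (LINT s:{0..real i * d}|lborel. f s)))\<^sup>2)
      \<le> d * (\<integral>s. indicator {0<..real n * d} s * (norm (h s))\<^sup>2 \<partial>lborel)" .
  also have "\<dots> \<le> d * (LINT s:{0..T}|lborel. (norm (f s))\<^sup>2)"
  proof (rule mult_left_mono[OF _ d])
    have "(LINT s:{0..T}|lborel. (norm (f s))\<^sup>2) = (\<integral>s. (norm (h s))\<^sup>2 \<partial>lborel)"
      unfolding set_lebesgue_integral_def
      by (intro Bochner_Integration.integral_cong) (auto simp: h_def indicator_def)
    moreover have "(\<integral>s. indicator {0<..real n * d} s * (norm (h s))\<^sup>2 \<partial>lborel)
        \<le> (\<integral>s. (norm (h s))\<^sup>2 \<partial>lborel)"
      by (rule integral_mono[OF hA2 h2]) (auto simp: indicator_def)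
    ultimately show "(\<integral>s. indicator {0<..real n * d} s * (norm (h s))\<^sup>2 \<partial>lborel)
        \<le> (LINT s:{0..T}|lborel. (norm (f s))\<^sup>2)"
      by simp
  qed
  finally show ?thesis .
qed

context filtered_prob_space begin

text \<open>By Tonelli the pathwise square integrals have finite expectation, so almost all of them
  are finite. For these paths the drift is a genuine Lebesgue integral and not the default value
  \<open>0\<close> of a non-integrable function, which its additivity and the Cauchy-Schwarz bound
  rely on.\<close>

lemma AE_section_sq_integrable:
  fixes v :: "real \<Rightarrow> 'w \<Rightarrow> 'b :: euclidean_space"
  assumes v: "v \<in> L2a P F T (\<lambda>x. (norm x)\<^sup>2)"
  shows "AE \<omega> in P. sq_integrable (restrict_space lborel {0..T}) (\<lambda>t. v t \<omega>)"
proof -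
  have sq: "sq_integrable (time_prod P T) (case_prod v)" using v by (simp add: L2a_iff)
  note vm [measurable] = sq_integrableD(1)[OF sq]
  have vM: "(\<lambda>t. v t \<omega>) \<in> borel_measurable (restrict_space lborel {0..T})" if "\<omega> \<in> space P" for \<omega>
    using measurable_compose[OF measurable_Pair2'[OF that] vm] by simp
  have "(\<lambda>p. ennreal ((norm (case_prod v p))\<^sup>2)) \<in> borel_measurable (time_prod P T)" by measurable
  from nn_integral_time_prod[OF this]
  have "(\<integral>\<^sup>+ \<omega>. (\<integral>\<^sup>+ t. ennreal ((norm (v t \<omega>))\<^sup>2) \<partial>restrict_space lborel {0..T}) \<partial>P) < \<infinity>"
    using sq by (simp add: sq_integrable_iff_nn_integral[OF vm] nn_integral_restrict_space)
  moreover have "(\<lambda>\<omega>. \<integral>\<^sup>+ t. ennreal ((norm (v t \<omega>))\<^sup>2) \<partial>restrict_space lborel {0..T})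
      \<in> borel_measurable P"
  proof -
    interpret pair_sigma_finite "restrict_space lborel {0..T}" P by (rule pair_sigma_finite_time)
    have "(\<lambda>p. ennreal ((norm (case_prod v p))\<^sup>2)) \<in> borel_measurable (time_prod P T)" by measurable
    from measurable_pair_swap[OF this]
    have "(\<lambda>(\<omega>, t). ennreal ((norm (v t \<omega>))\<^sup>2))
        \<in> borel_measurable (P \<Otimes>\<^sub>M restrict_space lborel {0..T})"
      by simp
    then show ?thesis by (rule M1.borel_measurable_nn_integral)
  qed
  ultimately have "AE \<omega> in P. (\<integral>\<^sup>+ t. ennreal ((norm (v t \<omega>))\<^sup>2) \<partial>restrict_space lborel {0..T}) \<noteq> \<infinity>"
    by (intro nn_integral_PInf_AE) auto
  then show ?thesis
    using AE_space
  proof eventually_elim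
    case (elim \<omega>)
    then show ?case by (simp add: sq_integrable_iff_nn_integral[OF vM] less_top)
  qed
qed

lemma AE_section_eq_0:
  fixes v :: "real \<Rightarrow> 'w \<Rightarrow> 'b :: euclidean_space"
  assumes v: "v \<in> L2a P F T (\<lambda>x. (norm x)\<^sup>2)"
  shows "(AE p in time_prod P T. case_prod v p = 0) \<longleftrightarrow>
    (AE \<omega> in P. AE t in lborel. t \<in> {0..T} \<longrightarrow> v t \<omega> = 0)"
proof -
  interpret pair_sigma_finite "restrict_space lborel {0..T}" P by (rule pair_sigma_finite_time)
  have [measurable]: "case_prod v \<in> borel_measurable (time_prod P T)"
    using v by (auto simp: L2a_iff sq_integrable_def)
  have "{p \<in> space (time_prod P T). case_prod v p = 0} \<in> sets (time_prod P T)" by measurable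
  then have set: "{p \<in> space (time_prod P T). v (fst p) (snd p) = 0} \<in> sets (time_prod P T)"
    by (simp add: case_prod_beta')
  show ?thesis
    using AE_pair_iff[OF set] AE_commute[OF set]
        by (simp add: AE_restrict_space_iff case_prod_beta')
qed

end

section \<open>Linearity, existence and uniqueness of intensities\<close>

context brownian_motion begin

text \<open>An integral \<open>N\<close> of the combined integrand is taken from the existence
  result and identified with the combination of the given integrals. The drifts add on all paths
  where both are integrable.\<close>

lemma has_intensity_lincomb:
  fixes m m' v v' :: "real \<Rightarrow> 'w \<Rightarrow> real ^ 'n" and \<Sigma> \<Sigma>' :: "real \<Rightarrow> 'w \<Rightarrow> real ^ 'm ^ 'n"
  assumes T: "0 < T" and m: "has_intensity P F W T m v \<Sigma>" and m': "has_intensity P F W T m' v' \<Sigma>'"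
  shows "has_intensity P F W T (\<lambda>t \<omega>. a *\<^sub>R m t \<omega> + b *\<^sub>R m' t \<omega>)
    (\<lambda>t \<omega>. a *\<^sub>R v t \<omega> + b *\<^sub>R v' t \<omega>) (\<lambda>t \<omega>. a *\<^sub>R \<Sigma> t \<omega> + b *\<^sub>R \<Sigma>' t \<omega>)"
proof -
  obtain M where v: "v \<in> L2a P F T (\<lambda>x. (norm x)\<^sup>2)" and \<Sigma>: "\<Sigma> \<in> L2a P F T (\<lambda>x. (norm x)\<^sup>2)"
    and M: "has_ito_integral P F W T \<Sigma> M"
    and mM: "AE \<omega> in P. \<forall>t\<in>{0..T}. m t \<omega> = (LINT s:{0..t}|lborel. v s \<omega>) + M t \<omega>"
    using m unfolding has_intensity_def vec_sq_eq mat_sq_eq by blast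
  obtain M' where v': "v' \<in> L2a P F T (\<lambda>x. (norm x)\<^sup>2)" and \<Sigma>': "\<Sigma>' \<in> L2a P F T (\<lambda>x. (norm x)\<^sup>2)"
    and M': "has_ito_integral P F W T \<Sigma>' M'"
    and mM': "AE \<omega> in P. \<forall>t\<in>{0..T}. m' t \<omega> = (LINT s:{0..t}|lborel. v' s \<omega>) + M' t \<omega>"
    using m' unfolding has_intensity_def vec_sq_eq mat_sq_eq by blast
  have \<Gamma>: "(\<lambda>t \<omega>. a *\<^sub>R \<Sigma> t \<omega> + b *\<^sub>R \<Sigma>' t \<omega>) \<in> L2a P F T (\<lambda>x. (norm x)\<^sup>2)"
      by (intro L2a_add L2a_scaleR \<Sigma> \<Sigma>')
  obtain N where N: "has_ito_integral P F W T (\<lambda>t \<omega>. a *\<^sub>R \<Sigma> t \<omega> + b *\<^sub>R \<Sigma>' t \<omega>) N"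
    using ito_integral_exists[OF T \<Gamma>] by blast
  note NM = ito_integral_lincomb[OF T \<Sigma> M \<Sigma>' M' N]
  have int: "AE \<omega> in P. set_integrable lborel {0..T} (\<lambda>s. u s \<omega>)" if "u \<in> L2a P F T (\<lambda>x. (norm x)\<^sup>2)"
    for u :: "real \<Rightarrow> 'w \<Rightarrow> real ^ 'n"
    using AE_section_sq_integrable[OF that]
  proof eventually_elim
    case (elim \<omega>)
    from sq_integrable_integrable[OF finite_measure_time this] show ?case
      by (simp add: set_integrable_def integrable_restrict_space)
  qed
  have "AE \<omega> in P. \<forall>t\<in>{0..T}. a *\<^sub>R m t \<omega> + b *\<^sub>R m' t \<omega>
      = (LINT s:{0..t}|lborel. a *\<^sub>R v s \<omega> + b *\<^sub>R v' s \<omega>) + N t \<omega>"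
    using mM mM' NM int[OF v] int[OF v']
  proof eventually_elim
    case (elim \<omega>)
    show ?case
    proof
      fix t assume t: "t \<in> {0..T}"
      have i: "set_integrable lborel {0..t} (\<lambda>s. v s \<omega>)" "set_integrable lborel {0..t} (\<lambda>s. v' s \<omega>)"
        using t by (auto intro: set_integrable_subset[OF elim(4)] set_integrable_subset[OF elim(5)])
      have "(LINT s:{0..t}|lborel. a *\<^sub>R v s \<omega> + b *\<^sub>R v' s \<omega>)
          = a *\<^sub>R (LINT s:{0..t}|lborel. v s \<omega>) + b *\<^sub>R (LINT s:{0..t}|lborel. v' s \<omega>)"
        using i by (subst set_integral_add) auto
      then show "a *\<^sub>R m t \<omega> + b *\<^sub>R m' t \<omega>
          = (LINT s:{0..t}|lborel. a *\<^sub>R v s \<omega> + b *\<^sub>R v' s \<omega>) + N t \<omega>"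
        using elim(1-3) t by (simp add: algebra_simps)
    qed
  qed
  then show ?thesis
    using \<Gamma> N L2a_add[OF L2a_scaleR[OF v] L2a_scaleR[OF v']]
    unfolding has_intensity_def vec_sq_eq mat_sq_eq by blast
qed

lemma has_intensity_exists:
  fixes v :: "real \<Rightarrow> 'w \<Rightarrow> real ^ 'n" and \<Sigma> :: "real \<Rightarrow> 'w \<Rightarrow> real ^ 'm ^ 'n"
  assumes T: "0 < T" and v: "v \<in> L2a P F T (\<lambda>x. (norm x)\<^sup>2)" and \<Sigma>: "\<Sigma> \<in> L2a P F T (\<lambda>x. (norm x)\<^sup>2)"
  obtains m where "has_intensity P F W T m v \<Sigma>"
proof -
  obtain M where "has_ito_integral P F W T \<Sigma> M" using ito_integral_exists[OF T \<Sigma>] by blast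
  then have "has_intensity P F W T (\<lambda>t \<omega>. (LINT s:{0..t}|lborel. v s \<omega>) + M t \<omega>) v \<Sigma>"
    using v \<Sigma> unfolding has_intensity_def vec_sq_eq mat_sq_eq by auto
  then show ?thesis by (rule that)
qed

lemma ito_integral_eq_0:
  fixes \<Sigma> :: "real \<Rightarrow> 'w \<Rightarrow> real ^ 'm ^ 'n"
  assumes T: "0 < T" and \<Sigma>: "\<Sigma> \<in> L2a P F T (\<lambda>x. (norm x)\<^sup>2)" and M: "has_ito_integral P F W T \<Sigma> M"
    and z: "AE p in time_prod P T. case_prod \<Sigma> p = 0"
  shows "AE \<omega> in P. \<forall>t\<in>{0..T}. M t \<omega> = 0"
proof -
  have "sq_integrable (time_prod P T) (case_prod \<Sigma>)" using \<Sigma> by (simp add: L2a_iff)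
  from sq_integral_eq_0_iff[OF this] z have "(\<integral>\<omega>. (norm (M T \<omega>))\<^sup>2 \<partial>P) = 0"
    using ito_isometry[OF less_imp_le[OF T] \<Sigma> M \<Sigma> M] by (simp add: power2_norm_eq_inner)
  with has_ito_integral_martingale[OF \<Sigma> M] show ?thesis by (intro l2_martingale_eq_0[OF T]) auto
qed

lemma has_intensity_zero:
  fixes m v :: "real \<Rightarrow> 'w \<Rightarrow> real ^ 'n" and \<Sigma> :: "real \<Rightarrow> 'w \<Rightarrow> real ^ 'm ^ 'n"
  assumes T: "0 < T" and m: "has_intensity P F W T m v \<Sigma>"
    and v0: "AE p in time_prod P T. case_prod v p = 0"
        and \<Sigma>0: "AE p in time_prod P T. case_prod \<Sigma> p = 0"
  shows "AE \<omega> in P. \<forall>t\<in>{0..T}. m t \<omega> = 0"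
proof -
  obtain M where v: "v \<in> L2a P F T (\<lambda>x. (norm x)\<^sup>2)" and \<Sigma>: "\<Sigma> \<in> L2a P F T (\<lambda>x. (norm x)\<^sup>2)"
    and M: "has_ito_integral P F W T \<Sigma> M"
    and mM: "AE \<omega> in P. \<forall>t\<in>{0..T}. m t \<omega> = (LINT s:{0..t}|lborel. v s \<omega>) + M t \<omega>"
    using m unfolding has_intensity_def vec_sq_eq mat_sq_eq by blast
  have "AE \<omega> in P. AE t in lborel. t \<in> {0..T} \<longrightarrow> v t \<omega> = 0" using v0 AE_section_eq_0[OF v] by simp
  with mM ito_integral_eq_0[OF T \<Sigma> M \<Sigma>0] show ?thesis
  proof eventually_elim
    case (elim \<omega>)
    have "(LINT s:{0..t}|lborel. v s \<omega>) = 0" if t: "t \<in> {0..T}" for t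
      unfolding set_lebesgue_integral_def
    proof (rule integral_eq_zero_AE)
      show "AE s in lborel. indicator {0..t} s *\<^sub>R v s \<omega> = 0"
        using elim(3) by eventually_elim (use t in \<open>auto simp: indicator_def\<close>)
    qed
    then show ?case using elim by simp
  qed
qed

text \<open>If \<open>m\<close> vanishes, the martingale part \<open>M\<close> is minus the drift. Its increments over a partition of
  mesh \<open>d\<close> are orthogonal, whence \<open>E |M(T)|\<^sup>2 = \<Sum> E |\<Delta>M|\<^sup>2 \<le> d E \<integral> |v|\<^sup>2\<close>, which tends to \<open>0\<close> with \<open>d\<close>.\<close>

lemma zero_has_intensity:
  fixes m v :: "real \<Rightarrow> 'w \<Rightarrow> real ^ 'n" and \<Sigma> :: "real \<Rightarrow> 'w \<Rightarrow> real ^ 'm ^ 'n"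
  assumes T: "0 < T" and m: "has_intensity P F W T m v \<Sigma>" and m0: "AE \<omega> in P. \<forall>t\<in>{0..T}. m t \<omega> = 0"
  shows "AE p in time_prod P T. case_prod v p = 0" and "AE p in time_prod P T. case_prod \<Sigma> p = 0"
proof -
  have T0: "0 \<le> T" using T by simp
  obtain M where v: "v \<in> L2a P F T (\<lambda>x. (norm x)\<^sup>2)" and \<Sigma>: "\<Sigma> \<in> L2a P F T (\<lambda>x. (norm x)\<^sup>2)"
    and M: "has_ito_integral P F W T \<Sigma> M"
    and mM: "AE \<omega> in P. \<forall>t\<in>{0..T}. m t \<omega> = (LINT s:{0..t}|lborel. v s \<omega>) + M t \<omega>"
    using m unfolding has_intensity_def vec_sq_eq mat_sq_eq by blast
  note mart = has_ito_integral_martingale[OF \<Sigma> M]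
  have M_drift: "AE \<omega> in P. \<forall>t\<in>{0..T}. M t \<omega> = - (LINT s:{0..t}|lborel. v s \<omega>)"
    using mM m0 by eventually_elim (metis add.commute add_eq_0_iff)
  have vsq: "sq_integrable (time_prod P T) (case_prod v)" using v by (simp add: L2a_iff)
  note [measurable] = sq_integrableD(1)[OF vsq]
  define K where "K = (\<integral>p. (norm (case_prod v p))\<^sup>2 \<partial>time_prod P T)"
  have bound: "(\<integral>\<omega>. (norm (M T \<omega>))\<^sup>2 \<partial>P) \<le> T * K / real n" if n: "0 < n" for n :: nat
  proof -
    define d where "d = T / real n"
    have d: "0 \<le> d" "real n * d = T" using n T by (auto simp: d_def)
    have kd: "0 \<le> real k * d" "real k * d \<le> T" if "k \<le> n" for k
    proof -
      show "0 \<le> real k * d" using d by simp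
      have "real k * d \<le> real n * d" using that d by (intro mult_right_mono) auto
      then show "real k * d \<le> T" using d by simp
    qed
    have Msq: "sq_integrable P (M (real k * d))" if "k \<le> n" for k
      using l2_martingaleD(2)[OF mart(1)] kd[OF that] by blast
    have tel: "(\<integral>\<omega>. (norm (M (real k * d) \<omega>))\<^sup>2 \<partial>P)
        = (\<Sum>i<k. \<integral>\<omega>. (norm (M (real (Suc i) * d) \<omega> - M (real i * d) \<omega>))\<^sup>2 \<partial>P)" if "k \<le> n" for k
      using that
    proof (induction k)
      case 0
      \<comment> \<open>The starting value is read off from the drift at time \<open>0\<close>, an
        integral over a single point.\<close>
      have "AE \<omega> in P. M 0 \<omega> = 0"
        using M_drift
      proof eventually_elim
        case (elim \<omega>)
        have "(LINT s:{0..0}|lborel. v s \<omega>) = 0"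
          unfolding set_lebesgue_integral_def
          by (rule integral_eq_zero_AE, use AE_lborel_singleton[of "0 :: real"] in eventually_elim)
              (simp add: indicator_def)
        then show ?case using elim T0 by simp
      qed
      then show ?case using sq_integral_eq_0_iff[OF Msq[of 0]] by simp
    next
      case (Suc k)
      have "real k * d \<le> real (Suc k) * d" using d by (intro mult_right_mono) auto
      then show ?case
        using Suc kd[of k] kd[of "Suc k"] l2_martingale_sq_increment[OF mart(1), of "real k
            * d" "real (Suc k) * d"] by simp
    qed
    let ?D = "\<lambda>i \<omega>. M (real (Suc i) * d) \<omega> - M (real i * d) \<omega>"
    have Dsq: "sq_integrable P (?D i)" if "i < n" for i using Msq[of i] Msq[of "Suc i"] that
        by (intro sq_integrable_diff) auto
    have "(\<integral>\<omega>. (norm (M T \<omega>))\<^sup>2 \<partial>P) = (\<Sum>i<n. \<integral>\<omega>. (norm (?D i \<omega>))\<^sup>2 \<partial>P)"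
      using tel[OF order_refl] by (simp only: d(2))
    also have "\<dots> = (\<integral>\<omega>. (\<Sum>i<n. (norm (?D i \<omega>))\<^sup>2) \<partial>P)"
      using Dsq by (intro Bochner_Integration.integral_sum[symmetric]) (auto simp:
          sq_integrable_def)
    finally have MT: "(\<integral>\<omega>. (norm (M T \<omega>))\<^sup>2 \<partial>P) = (\<integral>\<omega>. (\<Sum>i<n. (norm (?D i \<omega>))\<^sup>2) \<partial>P)" .
    have int: "integrable P (\<lambda>\<omega>. \<Sum>i<n. (norm (?D i \<omega>))\<^sup>2)"
      using Dsq by (intro Bochner_Integration.integrable_sum) (auto simp: sq_integrable_def)
    \<comment> \<open>Compared through extended integrals, whose monotonicity asks for no prior
      integrability of the bounding function of \<open>\<omega>\<close>.\<close>
    have "ennreal (\<integral>\<omega>. (norm (M T \<omega>))\<^sup>2 \<partial>P) = (\<integral>\<^sup>+ \<omega>. ennreal (\<Sum>i<n. (norm (?D i \<omega>))\<^sup>2) \<partial>P)"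
      unfolding MT by (rule nn_integral_eq_integral[OF int, symmetric]) (auto intro!: sum_nonneg)
    also have "\<dots> \<le> (\<integral>\<^sup>+ \<omega>. (\<integral>\<^sup>+ t\<in>{0..T}. ennreal d * ennreal ((norm (v t \<omega>))\<^sup>2) \<partial>lborel) \<partial>P)"
    proof (rule nn_integral_mono_AE)
      show "AE \<omega> in P. ennreal (\<Sum>i<n. (norm (?D i \<omega>))\<^sup>2)
          \<le> (\<integral>\<^sup>+ t\<in>{0..T}. ennreal d * ennreal ((norm (v t \<omega>))\<^sup>2) \<partial>lborel)"
        using M_drift AE_section_sq_integrable[OF v]
      proof eventually_elim
        case (elim \<omega>)
        have D_eq: "norm (?D i \<omega>) = norm ((LINT s:{0..real (Suc i) * d}|lborel. v s \<omega>)
            - (LINT s:{0..real i * d}|lborel. v s \<omega>))"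
          if "i < n" for i
          using elim(1) kd[of i] kd[of "Suc i"] that by (simp add: norm_minus_commute)
        have "(\<Sum>i<n. (norm (?D i \<omega>))\<^sup>2) \<le> d * (LINT s:{0..T}|lborel. (norm (v s \<omega>))\<^sup>2)"
          using sum_sq_increments_le[OF d(1) _ elim(2), of n] d(2) D_eq by simp
        then have "ennreal (\<Sum>i<n. (norm (?D i \<omega>))\<^sup>2)
            \<le> ennreal d * ennreal (LINT s:{0..T}|lborel. (norm (v s \<omega>))\<^sup>2)"
          using d by (simp add: ennreal_leI flip: ennreal_mult')
        also have "ennreal (LINT s:{0..T}|lborel. (norm (v s \<omega>))\<^sup>2)
            = (\<integral>\<^sup>+ t. ennreal ((norm (v t \<omega>))\<^sup>2) \<partial>restrict_space lborel {0..T})"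
          unfolding nn_integral_sq_eq_integral[OF elim(2)]
          by (simp add: set_lebesgue_integral_def integral_restrict_space)
        also have "\<dots> = (\<integral>\<^sup>+ t\<in>{0..T}. ennreal ((norm (v t \<omega>))\<^sup>2) \<partial>lborel)"
          by (simp add: nn_integral_restrict_space)
        also have "ennreal d * \<dots> = (\<integral>\<^sup>+ t\<in>{0..T}. ennreal d * ennreal ((norm (v t \<omega>))\<^sup>2) \<partial>lborel)"
        proof -
          have "(\<lambda>t. ennreal ((norm (v t \<omega>))\<^sup>2)) \<in> borel_measurable (restrict_space lborel {0..T})"
            using sq_integrableD(1)[OF elim(2)] by measurable
          from nn_integral_cmult[OF this, of "ennreal d"] show ?thesis
              by (simp add: nn_integral_restrict_space)
        qed
        finally show ?case .
      qed
    qed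
    also have "\<dots> = (\<integral>\<^sup>+ p. ennreal d * ennreal ((norm (case_prod v p))\<^sup>2) \<partial>time_prod P T)"
      by (subst nn_integral_time_prod) simp_all
    also have "\<dots> = ennreal d * ennreal K"
      unfolding K_def nn_integral_sq_eq_integral[OF vsq, symmetric]
          by (rule nn_integral_cmult) measurable
    finally have "ennreal (\<integral>\<omega>. (norm (M T \<omega>))\<^sup>2 \<partial>P) \<le> ennreal (d * K)" using d
        by (simp add: ennreal_mult')
    moreover have "0 \<le> d * K" using d by (simp add: K_def)
    ultimately have "(\<integral>\<omega>. (norm (M T \<omega>))\<^sup>2 \<partial>P) \<le> d * K" by (simp only: ennreal_le_iff)
    then show ?thesis by (simp add: d_def)
  qed
  have "(\<lambda>n. T * K * (1 / real (Suc n))) \<longlonglongrightarrow> T * K * 0"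
    by (rule tendsto_mult[OF tendsto_const LIMSEQ_Suc[OF lim_1_over_n]])
  then have "(\<lambda>n. T * K / real (Suc n)) \<longlonglongrightarrow> 0" by simp
  then have "(\<integral>\<omega>. (norm (M T \<omega>))\<^sup>2 \<partial>P) \<le> 0"
    by (rule LIMSEQ_le_const) (use bound in blast)
  then have MT0: "(\<integral>\<omega>. (norm (M T \<omega>))\<^sup>2 \<partial>P) = 0" by (simp add: antisym)
  have "sq_integrable (time_prod P T) (case_prod \<Sigma>)" using \<Sigma> by (simp add: L2a_iff)
  from sq_integral_eq_0_iff[OF this] show "AE p in time_prod P T. case_prod \<Sigma> p = 0"
    using ito_isometry[OF T0 \<Sigma> M \<Sigma> M] MT0 by (simp add: power2_norm_eq_inner)
  have M0: "AE \<omega> in P. \<forall>t\<in>{0..T}. M t \<omega> = 0" by (rule l2_martingale_eq_0[OF T mart MT0])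
  have "AE \<omega> in P. AE t in lborel. t \<in> {0..T} \<longrightarrow> v t \<omega> = 0"
    using M0 M_drift AE_section_sq_integrable[OF v]
  proof eventually_elim
    case (elim \<omega>)
    have "set_integrable lborel {0..T} (\<lambda>s. v s \<omega>)"
      using sq_integrable_integrable[OF finite_measure_time elim(3)]
      by (simp add: set_integrable_def integrable_restrict_space)
    then show ?case by (rule AE_zero_of_integral_zero[OF T0]) (use elim(1,2) in auto)
  qed
  then show "AE p in time_prod P T. case_prod v p = 0" using AE_section_eq_0[OF v] by simp
qed

text \<open>Existence yields only some process with zero intensity; its combination with
  coefficients \<open>0\<close> and \<open>0\<close> is literally the zero process.\<close>

lemma SM_zero:
  assumes T: "0 < T"
  shows "has_intensity P F W T (\<lambda>t \<omega>. 0 :: real ^ 'n) (\<lambda>t \<omega>. 0) (\<lambda>t \<omega>. 0)"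
proof -
  obtain m :: "real \<Rightarrow> 'w \<Rightarrow> real ^ 'n" where "has_intensity P F W T m (\<lambda>t \<omega>. 0) (\<lambda>t \<omega>. 0)"
    using has_intensity_exists[OF T L2a_zero L2a_zero] by blast
  from has_intensity_lincomb[OF T this this, of 0 0] show ?thesis by simp
qed

text \<open>The difference of the processes has the difference of the intensities, which reduces the
  equivalence to the zero process; its two directions are then \<open>zero_has_intensity\<close> and
  \<open>has_intensity_zero\<close>.\<close>

lemma has_intensity_cong:
  fixes m v m' v' :: "real \<Rightarrow> 'w \<Rightarrow> real ^ 'n" and \<Sigma> \<Sigma>' :: "real \<Rightarrow> 'w \<Rightarrow> real ^ 'm ^ 'n"
  assumes T: "0 < T" and m: "has_intensity P F W T m v \<Sigma>" and m': "has_intensity P F W T m' v' \<Sigma>'"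
  shows "(m, m') \<in> SM_rel P F W T \<longleftrightarrow>
    (v, v') \<in> L2a_rel P F T vec_sq \<and> (\<Sigma>, \<Sigma>') \<in> L2a_rel P F T mat_sq"
proof -
  have mem: "m \<in> SM P F W T" "m' \<in> SM P F W T" using m m' by (auto simp: SM_def)
  have v: "v \<in> L2a P F T vec_sq" "v' \<in> L2a P F T vec_sq" "\<Sigma> \<in> L2a P F T mat_sq" "\<Sigma>'
      \<in> L2a P F T mat_sq"
    using m m' by (auto simp: has_intensity_def)
  have diff: "has_intensity P F W T (\<lambda>t \<omega>. m t \<omega> - m' t \<omega>) (\<lambda>t \<omega>. v t \<omega> - v' t \<omega>) (\<lambda>t \<omega>. \<Sigma> t \<omega>
      - \<Sigma>' t \<omega>)"
    using has_intensity_lincomb[OF T m m', of 1 "-1"] by simp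
  have "(m, m') \<in> SM_rel P F W T \<longleftrightarrow> (AE \<omega> in P. \<forall>t\<in>{0..T}. m t \<omega> - m' t \<omega> = 0)"
    using mem by (simp add: SM_rel_def)
  also have "\<dots> \<longleftrightarrow> (AE p in time_prod P T. case_prod (\<lambda>t \<omega>. v t \<omega> - v' t \<omega>) p = 0) \<and>
      (AE p in time_prod P T. case_prod (\<lambda>t \<omega>. \<Sigma> t \<omega> - \<Sigma>' t \<omega>) p = 0)"
    using zero_has_intensity[OF T diff] has_intensity_zero[OF T diff] by blast
  also have "\<dots> \<longleftrightarrow> (v, v') \<in> L2a_rel P F T vec_sq \<and> (\<Sigma>, \<Sigma>') \<in> L2a_rel P F T mat_sq"
    using v by (simp add: L2a_rel_iff case_prod_beta')
  finally show ?thesis .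
qed

section \<open>The quotient space, its norm and the intensity map\<close>

lemma process_quotient_SM:
  assumes T: "0 < T"
  shows "process_quotient (SM P F W T :: (real \<Rightarrow> 'w \<Rightarrow> real ^ 'n) set) (SM_rel P F W T)"
proof
  let ?S = "SM P F W T :: (real \<Rightarrow> 'w \<Rightarrow> real ^ 'n) set"
      and ?R = "SM_rel P F W T :: (real \<Rightarrow> 'w \<Rightarrow> real ^ 'n) rel"
  show "(\<lambda>t \<omega>. 0) \<in> ?S" using SM_zero[OF T] unfolding SM_def by blast
  show add: "(\<lambda>t \<omega>. x t \<omega> + y t \<omega>) \<in> ?S" if "x \<in> ?S" "y \<in> ?S" for x y
    using that has_intensity_lincomb[OF T, of x _ _ y _ _ 1 1] unfolding SM_def by fastforce
  show scale: "(\<lambda>t \<omega>. c *\<^sub>R x t \<omega>) \<in> ?S" if "x \<in> ?S" for x c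
    using that has_intensity_lincomb[OF T, of x _ _ x _ _ c 0] unfolding SM_def by fastforce
  show "equiv ?S ?R"
  proof (rule equivI)
    show "refl_on ?S ?R" by (auto simp: refl_on_def SM_rel_def)
    show "?R \<subseteq> ?S \<times> ?S" by (auto simp: SM_rel_def)
    show "sym ?R" unfolding sym_def SM_rel_def by (auto elim!: eventually_mono)
    show "trans ?R"
    proof (rule transI)
      fix x y z assume xy: "(x, y) \<in> ?R" and yz: "(y, z) \<in> ?R"
      have "AE \<omega> in P. \<forall>t\<in>{0..T}. x t \<omega> = y t \<omega>" "AE \<omega> in P. \<forall>t\<in>{0..T}. y t \<omega> = z t \<omega>"
        using xy yz by (auto simp: SM_rel_def)
      then have "AE \<omega> in P. \<forall>t\<in>{0..T}. x t \<omega> = z t \<omega>" by eventually_elim simp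
      then show "(x, z) \<in> ?R" using xy yz by (auto simp: SM_rel_def)
    qed
  qed
  show "(\<lambda>t \<omega>. x t \<omega> + y t \<omega>, \<lambda>t \<omega>. x' t \<omega> + y' t \<omega>) \<in> ?R" if xx: "(x, x') \<in> ?R"
      and yy: "(y, y') \<in> ?R" for x x' y y'
  proof -
    have "AE \<omega> in P. \<forall>t\<in>{0..T}. x t \<omega> = x' t \<omega>" "AE \<omega> in P. \<forall>t\<in>{0..T}. y t \<omega> = y' t \<omega>"
      using xx yy by (auto simp: SM_rel_def)
    then have "AE \<omega> in P. \<forall>t\<in>{0..T}. x t \<omega> + y t \<omega> = x' t \<omega> + y' t \<omega>" by eventually_elim simp
    then show ?thesis using xx yy add by (auto simp: SM_rel_def)
  qed
  show "(\<lambda>t \<omega>. c *\<^sub>R x t \<omega>, \<lambda>t \<omega>. c *\<^sub>R x' t \<omega>) \<in> ?R" if xx: "(x, x') \<in> ?R" for x x' c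
  proof -
    have "AE \<omega> in P. \<forall>t\<in>{0..T}. x t \<omega> = x' t \<omega>" using xx by (auto simp: SM_rel_def)
    then have "AE \<omega> in P. \<forall>t\<in>{0..T}. c *\<^sub>R x t \<omega> = c *\<^sub>R x' t \<omega>" by eventually_elim simp
    then show ?thesis using xx scale by (auto simp: SM_rel_def)
  qed
qed

lemma L2a_norm_intensity:
  fixes v :: "real \<Rightarrow> 'w \<Rightarrow> 'b :: euclidean_space"
  assumes "v \<in> L2a P F T (\<lambda>x. (norm x)\<^sup>2)"
  shows "(L2a_norm P T (\<lambda>x. (norm x)\<^sup>2) (L2a_rel P F T (\<lambda>x. (norm x)\<^sup>2) `` {v}))\<^sup>2
    = enn2real (expect_int P T (\<lambda>t \<omega>. (norm (v t \<omega>))\<^sup>2))"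
  by (simp add: L2a_norm_class[OF assms] expect_int_L2a[OF assms])

text \<open>The \<open>THE\<close> ranges over all indistinguishable processes and over all their
  intensities. By \<open>has_intensity_cong\<close> these intensities agree almost everywhere, so
  every choice gives the same number.\<close>

lemma SM_norm_class:
  fixes m v :: "real \<Rightarrow> 'w \<Rightarrow> real ^ 'n"
  assumes T: "0 < T" and m: "has_intensity P F W T m v \<Sigma>"
  shows "SM_norm P F W T (SM_rel P F W T `` {m}) =
    sqrt (enn2real (expect_int P T (\<lambda>t \<omega>. vec_sq (v t \<omega>)))
        + enn2real (expect_int P T (\<lambda>t \<omega>. mat_sq (\<Sigma> t \<omega>))))"
  unfolding SM_norm_def
proof (rule the_equality)
  interpret SM: process_quotient "SM P F W T :: (real \<Rightarrow> 'w \<Rightarrow> real ^ 'n) set" "SM_rel P F W T"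
    by (rule process_quotient_SM[OF T])
  have "m \<in> SM P F W T" using m by (auto simp: SM_def)
  then have "m \<in> SM_rel P F W T `` {m}" using SM.rel_refl by auto
  then show "\<exists>m\<in>SM_rel P F W T `` {m}. \<exists>v' \<Sigma>'. has_intensity P F W T m v' \<Sigma>' \<and>
      sqrt (enn2real (expect_int P T (\<lambda>t \<omega>. vec_sq (v t \<omega>)))
          + enn2real (expect_int P T (\<lambda>t \<omega>. mat_sq (\<Sigma> t \<omega>))))
      = sqrt (enn2real (expect_int P T (\<lambda>t \<omega>. vec_sq (v' t \<omega>)))
          + enn2real (expect_int P T (\<lambda>t \<omega>. mat_sq (\<Sigma>' t \<omega>))))"
    using m by blast
  fix r
  assume "\<exists>m\<in>SM_rel P F W T `` {m}. \<exists>v' \<Sigma>'. has_intensity P F W T m v' \<Sigma>' \<and>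
      r = sqrt (enn2real (expect_int P T (\<lambda>t \<omega>. vec_sq (v' t \<omega>)))
          + enn2real (expect_int P T (\<lambda>t \<omega>. mat_sq (\<Sigma>' t \<omega>))))"
  then obtain m' v' \<Sigma>' where mm: "(m, m') \<in> SM_rel P F W T" and m': "has_intensity P F W T m' v' \<Sigma>'"
    and r: "r = sqrt (enn2real (expect_int P T (\<lambda>t \<omega>. vec_sq (v' t \<omega>)))
        + enn2real (expect_int P T (\<lambda>t \<omega>. mat_sq (\<Sigma>' t \<omega>))))"
    by blast
  have rel: "(v, v') \<in> L2a_rel P F T (\<lambda>x. (norm x)\<^sup>2)" "(\<Sigma>, \<Sigma>') \<in> L2a_rel P F T (\<lambda>x. (norm x)\<^sup>2)"
    using has_intensity_cong[OF T m m'] mm by (simp_all add: vec_sq_eq mat_sq_eq)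
  have "enn2real (expect_int P T (\<lambda>t \<omega>. (norm (v' t \<omega>))\<^sup>2))
      = enn2real (expect_int P T (\<lambda>t \<omega>. (norm (v t \<omega>))\<^sup>2))"
    using rel(1) L2a.class_eqI[OF rel(1)] L2a_norm_intensity[of v T] L2a_norm_intensity[of v' T]
        by (simp add: L2a_rel_iff)
  moreover have "enn2real (expect_int P T (\<lambda>t \<omega>. (norm (\<Sigma>' t \<omega>))\<^sup>2))
      = enn2real (expect_int P T (\<lambda>t \<omega>. (norm (\<Sigma> t \<omega>))\<^sup>2))"
    using rel(2) L2a.class_eqI[OF rel(2)] L2a_norm_intensity[of \<Sigma> T] L2a_norm_intensity[of \<Sigma>' T]
        by (simp add: L2a_rel_iff)
  ultimately show "r = sqrt (enn2real (expect_int P T (\<lambda>t \<omega>. vec_sq (v t \<omega>)))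
      + enn2real (expect_int P T (\<lambda>t \<omega>. mat_sq (\<Sigma> t \<omega>))))"
    unfolding r vec_sq_eq mat_sq_eq by simp
qed

text \<open>\<open>\<Phi>\<close> reads off the intensity and is thus the inverse of the map that
  builds a semimartingale from a pair. The two directions of \<open>has_intensity_cong\<close> make
  it well defined and injective, and surjectivity is the existence of the stochastic
  integral.\<close>

lemma SM_isometric_isomorphism:
  assumes T: "0 < T"
  obtains \<Phi> where "isometric_isomorphism
      (SM_space P F W T :: (real, (real \<Rightarrow> 'w \<Rightarrow> real ^ 'n) set) module) (SM_norm P F W T)
      (prod_space (L2a_space P F T (vec_sq :: real ^ 'n \<Rightarrow> real)) (L2a_space P F T (mat_sq :: real ^
          'm ^ 'n \<Rightarrow> real)))
      (prod_norm (L2a_norm P T vec_sq) (L2a_norm P T mat_sq)) \<Phi>"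
    "\<And>m v \<Sigma>. has_intensity P F W T m v \<Sigma> \<Longrightarrow>
      \<Phi> (SM_rel P F W T `` {m}) = (L2a_rel P F T vec_sq `` {v}, L2a_rel P F T mat_sq `` {\<Sigma>})"
proof -
  let ?S = "SM P F W T :: (real \<Rightarrow> 'w \<Rightarrow> real ^ 'n) set"
      and ?R = "SM_rel P F W T :: (real \<Rightarrow> 'w \<Rightarrow> real ^ 'n) rel"
  let ?V = "SM_space P F W T :: (real, (real \<Rightarrow> 'w \<Rightarrow> real ^ 'n) set) module"
  let ?Lv = "L2a_space P F T (vec_sq :: real ^ 'n \<Rightarrow> real)"
  let ?Lm = "L2a_space P F T (mat_sq :: real ^ 'm ^ 'n \<Rightarrow> real)"
  let ?Rv = "L2a_rel P F T (vec_sq :: real ^ 'n \<Rightarrow> real)"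
  let ?Rm = "L2a_rel P F T (mat_sq :: real ^ 'm ^ 'n \<Rightarrow> real)"
  interpret SM: process_quotient ?S ?R by (rule process_quotient_SM[OF T])
  interpret Lv: process_quotient "L2a P F T (vec_sq :: real ^ 'n \<Rightarrow> real)" ?Rv
    unfolding vec_sq_eq by (rule L2a.process_quotient_axioms)
  interpret Lm: process_quotient "L2a P F T (mat_sq :: real ^ 'm ^ 'n \<Rightarrow> real)" ?Rm
    unfolding mat_sq_eq by (rule L2a.process_quotient_axioms)
  \<comment> \<open>A representative and an intensity are chosen together; the next fact shows that
    the classes do not depend on this choice.\<close>
  define \<Phi> where "\<Phi> X = (let (m, v, \<Sigma>) = (SOME (m, v, \<Sigma>). m \<in> X \<and> has_intensity P F W T m v \<Sigma>)
      in (?Rv `` {v}, ?Rm `` {\<Sigma>}))" for X :: "(real \<Rightarrow> 'w \<Rightarrow> real ^ 'n) set"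
  have \<Phi>: "\<Phi> (?R `` {m}) = (?Rv `` {v}, ?Rm `` {\<Sigma>})" if m: "has_intensity P F W T m v \<Sigma>" for m v \<Sigma>
  proof -
    let ?Q = "\<lambda>(m', v' :: real \<Rightarrow> 'w \<Rightarrow> real ^ 'n, \<Sigma>' :: real \<Rightarrow> 'w \<Rightarrow> real ^ 'm ^ 'n).
      m' \<in> ?R `` {m} \<and> has_intensity P F W T m' v' \<Sigma>'"
    have "m \<in> ?S" using m by (auto simp: SM_def)
    then have "?Q (m, v, \<Sigma>)" using m SM.rel_refl by auto
    then have "?Q (SOME x. ?Q x)" by (rule someI)
    moreover obtain m' v' \<Sigma>' where eq: "(SOME x. ?Q x) = (m', v', \<Sigma>')" by (rule prod_cases3)
    ultimately have "(m, m') \<in> ?R" and m': "has_intensity P F W T m' v' \<Sigma>'" by auto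
    then have "(v, v') \<in> ?Rv" "(\<Sigma>, \<Sigma>') \<in> ?Rm" using has_intensity_cong[OF T m m'] by auto
    then have "?Rv `` {v'} = ?Rv `` {v}" "?Rm `` {\<Sigma>'} = ?Rm `` {\<Sigma>}"
      using Lv.class_eqI Lm.class_eqI by metis+
    then show ?thesis unfolding \<Phi>_def eq by simp
  qed
  have V: "carrier ?V = carrier (process_space ?S ?R)" by (simp add: SM_space_def)
  have classE: "\<exists>m v \<Sigma>. has_intensity P F W T m v \<Sigma> \<and> X = ?R `` {m}" if X: "X \<in> carrier ?V" for X
  proof -
    obtain m where "m \<in> ?S" "X = ?R `` {m}" by (rule SM.classE[OF X[unfolded V]])
    then show ?thesis unfolding SM_def by blast
  qed
  have int_mem: "v \<in> L2a P F T vec_sq" "\<Sigma> \<in> L2a P F T mat_sq" "m \<in> ?S"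
      if "has_intensity P F W T m v \<Sigma>" for m v \<Sigma>
    using that by (auto simp: has_intensity_def SM_def)
  have "isometric_isomorphism ?V (SM_norm P F W T) (prod_space ?Lv ?Lm) (prod_norm (L2a_norm P T
      vec_sq) (L2a_norm P T mat_sq)) \<Phi>"
    unfolding isometric_isomorphism_def
  proof (intro conjI ballI allI)
    show "bij_betw \<Phi> (carrier ?V) (carrier (prod_space ?Lv ?Lm))"
      unfolding bij_betw_def
    proof (intro conjI inj_onI)
      fix X Y assume X: "X \<in> carrier ?V" and Y: "Y \<in> carrier ?V" and eq: "\<Phi> X = \<Phi> Y"
      obtain m v \<Sigma> where m: "has_intensity P F W T m v \<Sigma>" "X = ?R `` {m}" using classE[OF X]
          by blast
      obtain m' v' \<Sigma>' where m': "has_intensity P F W T m' v' \<Sigma>'" "Y = ?R `` {m'}" using classE[OF Y]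
          by blast
      have "?Rv `` {v} = ?Rv `` {v'}" "?Rm `` {\<Sigma>} = ?Rm `` {\<Sigma>'}"
        using eq \<Phi>[OF m(1)] \<Phi>[OF m'(1)] by (simp_all add: m(2) m'(2))
      then have "(v, v') \<in> ?Rv" "(\<Sigma>, \<Sigma>') \<in> ?Rm"
        using Lv.rel_refl[OF int_mem(1)[OF m'(1)]] Lm.rel_refl[OF int_mem(2)[OF m'(1)]] by auto
      then have "(m, m') \<in> ?R" using has_intensity_cong[OF T m(1) m'(1)] by simp
      then show "X = Y" unfolding m(2) m'(2) by (rule SM.class_eqI)
    next
      show "\<Phi> ` carrier ?V = carrier (prod_space ?Lv ?Lm)"
      proof (intro equalityI subsetI)
        fix Z assume "Z \<in> \<Phi> ` carrier ?V"
        then obtain m v \<Sigma> where m: "has_intensity P F W T m v \<Sigma>" "Z = \<Phi> (?R `` {m})" using classE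
            by blast
        then show "Z \<in> carrier (prod_space ?Lv ?Lm)"
          using \<Phi>[OF m(1)] Lv.class_mem[OF int_mem(1)[OF m(1)]] Lm.class_mem[OF int_mem(2)[OF m(1)]]
          by (simp add: prod_space_def L2a_space_def)
      next
        fix Z assume "Z \<in> carrier (prod_space ?Lv ?Lm)"
        then obtain v \<Sigma> where v: "v \<in> L2a P F T vec_sq" and \<Sigma>: "\<Sigma> \<in> L2a P F T mat_sq"
            and Z: "Z = (?Rv `` {v}, ?Rm `` {\<Sigma>})"
          by (auto simp: prod_space_def L2a_space_def elim!: Lv.classE Lm.classE)
        obtain m where m: "has_intensity P F W T m v \<Sigma>"
          using has_intensity_exists[OF T v[unfolded vec_sq_eq] \<Sigma>[unfolded mat_sq_eq]] by blast
        show "Z \<in> \<Phi> ` carrier ?V"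
          unfolding Z \<Phi>[OF m, symmetric] V by (intro imageI SM.class_mem int_mem(3)[OF m])
      qed
    qed
  next
    fix X Y assume X: "X \<in> carrier ?V" and Y: "Y \<in> carrier ?V"
    obtain m v \<Sigma> where m: "has_intensity P F W T m v \<Sigma>" "X = ?R `` {m}" using classE[OF X] by blast
    obtain m' v' \<Sigma>' where m': "has_intensity P F W T m' v' \<Sigma>'" "Y = ?R `` {m'}" using classE[OF Y]
        by blast
    have sum: "has_intensity P F W T (\<lambda>t \<omega>. m t \<omega> + m' t \<omega>) (\<lambda>t \<omega>. v t \<omega> + v' t \<omega>) (\<lambda>t \<omega>. \<Sigma> t \<omega>
        + \<Sigma>' t \<omega>)"
      using has_intensity_lincomb[OF T m(1) m'(1), of 1 1] by simp
    have "X \<oplus>\<^bsub>?V\<^esub> Y = ?R `` {\<lambda>t \<omega>. m t \<omega> + m' t \<omega>}"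
      unfolding m(2) m'(2) SM_space_def
          by (rule SM.add_class[OF int_mem(3)[OF m(1)] int_mem(3)[OF m'(1)]])
    then have "\<Phi> (X \<oplus>\<^bsub>?V\<^esub> Y) = (?Rv `` {\<lambda>t \<omega>. v t \<omega> + v' t \<omega>}, ?Rm `` {\<lambda>t \<omega>. \<Sigma> t \<omega> + \<Sigma>' t \<omega>})"
      using \<Phi>[OF sum] by simp
    then show "\<Phi> (X \<oplus>\<^bsub>?V\<^esub> Y) = \<Phi> X \<oplus>\<^bsub>prod_space ?Lv ?Lm\<^esub> \<Phi> Y"
      unfolding m(2) m'(2) \<Phi>[OF m(1)] \<Phi>[OF m'(1)] prod_space_def L2a_space_def
      using Lv.add_class[OF int_mem(1)[OF m(1)] int_mem(1)[OF m'(1)]] Lm.add_class[OF int_mem(2)[OF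
          m(1)] int_mem(2)[OF m'(1)]]
      by simp
  next
    fix c X assume X: "X \<in> carrier ?V"
    obtain m v \<Sigma> where m: "has_intensity P F W T m v \<Sigma>" "X = ?R `` {m}" using classE[OF X] by blast
    have sc: "has_intensity P F W T (\<lambda>t \<omega>. c *\<^sub>R m t \<omega>) (\<lambda>t \<omega>. c *\<^sub>R v t \<omega>) (\<lambda>t \<omega>. c *\<^sub>R \<Sigma> t \<omega>)"
      using has_intensity_lincomb[OF T m(1) m(1), of c 0] by simp
    have "c \<odot>\<^bsub>?V\<^esub> X = ?R `` {\<lambda>t \<omega>. c *\<^sub>R m t \<omega>}"
      unfolding m(2) SM_space_def by (rule SM.scale_class[OF int_mem(3)[OF m(1)]])
    then have "\<Phi> (c \<odot>\<^bsub>?V\<^esub> X) = (?Rv `` {\<lambda>t \<omega>. c *\<^sub>R v t \<omega>}, ?Rm `` {\<lambda>t \<omega>. c *\<^sub>R \<Sigma> t \<omega>})"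
      using \<Phi>[OF sc] by simp
    then show "\<Phi> (c \<odot>\<^bsub>?V\<^esub> X) = c \<odot>\<^bsub>prod_space ?Lv ?Lm\<^esub> \<Phi> X"
      unfolding m(2) \<Phi>[OF m(1)] prod_space_def L2a_space_def
      using Lv.scale_class[OF int_mem(1)[OF m(1)]] Lm.scale_class[OF int_mem(2)[OF m(1)]]
      by simp
  next
    fix X assume X: "X \<in> carrier ?V"
    obtain m v \<Sigma> where m: "has_intensity P F W T m v \<Sigma>" "X = ?R `` {m}" using classE[OF X] by blast
    show "prod_norm (L2a_norm P T vec_sq) (L2a_norm P T mat_sq) (\<Phi> X) = SM_norm P F W T X"
      unfolding m(2) \<Phi>[OF m(1)] SM_norm_class[OF T m(1)] prod_norm_def prod.case
      using L2a_norm_intensity[OF int_mem(1)[OF m(1), unfolded vec_sq_eq]]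
        L2a_norm_intensity[OF int_mem(2)[OF m(1), unfolded mat_sq_eq]]
      by (simp add: vec_sq_eq mat_sq_eq)
  qed
  then show ?thesis using that \<Phi> by blast
qed

end

text \<open>The norm identity is asserted for every representative and every intensity, so it
  contains the independence of these choices that \<open>SM_norm\<close> leaves open. Likewise the
  last clause names the isomorphism as the intensity map, which is stronger than the mere existence
  of an isometry.\<close>

theorem theorem4p3:
  fixes P :: "'w measure" and F :: "real \<Rightarrow> 'w measure"
    and W :: "real \<Rightarrow> 'w \<Rightarrow> real ^ 'm" and T :: real
  assumes "brownian_motion P F W" and "0 < T"
  shows "real_vector_space
      (SM_space P F W T :: (real, (real \<Rightarrow> 'w \<Rightarrow> real ^ 'n) set) module) \<and>
    (\<forall>(m :: real \<Rightarrow> 'w \<Rightarrow> real ^ 'n) v \<Sigma>. has_intensity P F W T m v \<Sigma> \<longrightarrow>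
      (SM_norm P F W T (SM_rel P F W T `` {m}))\<^sup>2 =
        enn2real (expect_int P T (\<lambda>t \<omega>. vec_sq (v t \<omega>))) +
        enn2real (expect_int P T (\<lambda>t \<omega>. mat_sq (\<Sigma> t \<omega>)))) \<and>
    hilbert_space
      (SM_space P F W T :: (real, (real \<Rightarrow> 'w \<Rightarrow> real ^ 'n) set) module) (SM_norm P F W T) \<and>
    (\<exists>\<Phi>. isometric_isomorphism
        (SM_space P F W T :: (real, (real \<Rightarrow> 'w \<Rightarrow> real ^ 'n) set) module) (SM_norm P F W T)
        (prod_space (L2a_space P F T (vec_sq :: real ^ 'n \<Rightarrow> real))
          (L2a_space P F T (mat_sq :: real ^ 'm ^ 'n \<Rightarrow> real)))
        (prod_norm (L2a_norm P T vec_sq) (L2a_norm P T mat_sq)) \<Phi> \<and>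
      (\<forall>m v \<Sigma>. has_intensity P F W T m v \<Sigma> \<longrightarrow>
        \<Phi> (SM_rel P F W T `` {m}) =
          (L2a_rel P F T vec_sq `` {v}, L2a_rel P F T mat_sq `` {\<Sigma>})))"
proof -
  interpret brownian_motion P F W by (rule assms(1))
  note T = \<open>0 < T\<close>
  let ?V = "SM_space P F W T :: (real, (real \<Rightarrow> 'w \<Rightarrow> real ^ 'n) set) module"
  interpret SM: process_quotient "SM P F W T :: (real \<Rightarrow> 'w \<Rightarrow> real ^ 'n) set" "SM_rel P F W T"
    by (rule process_quotient_SM[OF T])
  obtain \<Phi> where iso: "isometric_isomorphism ?V (SM_norm P F W T)
      (prod_space (L2a_space P F T (vec_sq :: real ^ 'n \<Rightarrow> real)) (L2a_space P F T (mat_sq :: real ^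
          'm ^ 'n \<Rightarrow> real)))
      (prod_norm (L2a_norm P T vec_sq) (L2a_norm P T mat_sq)) \<Phi>"
    and \<Phi>: "\<And>m v \<Sigma>. has_intensity P F W T m v \<Sigma> \<Longrightarrow>
      \<Phi> (SM_rel P F W T `` {m}) = (L2a_rel P F T vec_sq `` {v}, L2a_rel P F T mat_sq `` {\<Sigma>})"
    using SM_isometric_isomorphism[OF T] by blast
  have V: "real_vector_space ?V" unfolding SM_space_def by (rule SM.real_vector_space_process)
  have L: "hilbert_space (prod_space (L2a_space P F T (vec_sq :: real ^ 'n \<Rightarrow> real)) (L2a_space P F T
      (mat_sq :: real ^ 'm ^ 'n \<Rightarrow> real)))
      (prod_norm (L2a_norm P T vec_sq) (L2a_norm P T mat_sq))"
    unfolding vec_sq_eq mat_sq_eq by (intro hilbert_space_prod hilbert_space_L2a)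
  have H: "hilbert_space ?V (SM_norm P F W T)" by (rule hilbert_space_transport[OF V L iso])
  have N: "(SM_norm P F W T (SM_rel P F W T `` {m}))\<^sup>2 =
      enn2real (expect_int P T (\<lambda>t \<omega>. vec_sq (v t \<omega>)))
          + enn2real (expect_int P T (\<lambda>t \<omega>. mat_sq (\<Sigma> t \<omega>)))"
    if "has_intensity P F W T m v \<Sigma>" for m v :: "real \<Rightarrow> 'w \<Rightarrow> real ^ 'n" and \<Sigma>
    unfolding SM_norm_class[OF T that] by simp
  show ?thesis
    by (intro conjI allI impI exI[of _ \<Phi>] V H iso N \<Phi>)
qed

end
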